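(* Let $M$ and $N$ be objects of an abelian category $\mathcal{A}$. The following hold both with all words in parentheses omitted and with all of them included. (1) If $\mathcal{A}$ is AB3* and $M\oplus N$ is (strictly) ESSIP, then $N$ is (strongly) $M$-CS-Baer. (2) If $\mathcal{A}$ is AB3 and $M\oplus N$ is (strictly) LSSSP, then $N$ is dual (strongly) $M$-CS-Baer.
   Context: An abelian category is AB3 (AB3* ) if it has arbitrary coproducts (products); it then has arbitrary sums (intersections) of families of subobjects. A subobject $i:K\to X$ is fully invariant if for every $h:X\to X$ one has $hi=i\alpha$ for some $\alpha:K\to K$. A subobject $L$ of $X$ lies above a direct summand $K$ of $X$ if $K\subseteq L$ and $L/K$ is superfluous in $X/K$ (a subobject $A$ of $B$ is superfluous if $A+C=B$ implies $C=B$ for every subobject $C$ of $B$). In an AB3* abelian category: an object $X$ is (strictly) ESSIP if for any family of direct summands of $X$, their intersection is essential in a (fully invariant) direct summand of $X$; $N$ is (strongly) $M$-CS-Baer if for every family $(f_i)_{i\in I}$ of morphisms $f_i:M\to N$, $\bigcap_{i\in I}\mathrm{Ker}(f_i)$ is essential in a (fully invariant) direct summand of $M$. In an AB3 abelian category: $X$ is (strictly) LSSSP if for any family of direct summands of $X$, their sum lies above a (fully invariant) direct summand of $X$; $N$ is dual (strongly) $M$-CS-Baer if for every family $(f_i)_{i\in I}$ of morphisms $f_i:M\to N$, $\sum_{i\in I}\mathrm{Im}(f_i)$ lies above a (fully invariant) direct summand of $N$. *)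

theory Defs
  imports "HOL-Algebra.Group" "HOL-Library.Infinite_Typeclass"
begin

section \<open>Abelian categories\<close>

record ('o, 'm) ab_cat =
  Obj :: "'o set"
  Arr :: "'m set"
  Dom :: "'m \<Rightarrow> 'o"
  Cod :: "'m \<Rightarrow> 'o"
  Ident :: "'o \<Rightarrow> 'm"
  Comp :: "'m \<Rightarrow> 'm \<Rightarrow> 'm" (infixl "\<cdot>\<index>" 70)
  Add :: "'m \<Rightarrow> 'm \<Rightarrow> 'm"
  Zero :: "'o \<Rightarrow> 'o \<Rightarrow> 'm"

definition Hom :: "('o, 'm, 'x) ab_cat_scheme \<Rightarrow> 'o \<Rightarrow> 'o \<Rightarrow> 'm set" where
  "Hom C X Y = {f \<in> Arr C. Dom C f = X \<and> Cod C f = Y}"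

definition hom_group :: "('o, 'm, 'x) ab_cat_scheme \<Rightarrow> 'o \<Rightarrow> 'o \<Rightarrow> 'm monoid" where
  "hom_group C X Y = \<lparr>carrier = Hom C X Y, monoid.mult = Add C, one = Zero C X Y\<rparr>"

definition monic :: "('o, 'm, 'x) ab_cat_scheme \<Rightarrow> 'm \<Rightarrow> bool" where
  "monic C f \<longleftrightarrow> f \<in> Arr C \<and>
    (\<forall>Z \<in> Obj C. \<forall>g \<in> Hom C Z (Dom C f). \<forall>h \<in> Hom C Z (Dom C f).
       f \<cdot>\<^bsub>C\<^esub> g = f \<cdot>\<^bsub>C\<^esub> h \<longrightarrow> g = h)"

definition epic :: "('o, 'm, 'x) ab_cat_scheme \<Rightarrow> 'm \<Rightarrow> bool" where
  "epic C f \<longleftrightarrow> f \<in> Arr C \<and>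
    (\<forall>Z \<in> Obj C. \<forall>g \<in> Hom C (Cod C f) Z. \<forall>h \<in> Hom C (Cod C f) Z.
       g \<cdot>\<^bsub>C\<^esub> f = h \<cdot>\<^bsub>C\<^esub> f \<longrightarrow> g = h)"

definition zero_object :: "('o, 'm, 'x) ab_cat_scheme \<Rightarrow> 'o \<Rightarrow> bool" where
  "zero_object C Z \<longleftrightarrow> Z \<in> Obj C \<and>
    (\<forall>X \<in> Obj C. (\<exists>!f. f \<in> Hom C X Z) \<and> (\<exists>!f. f \<in> Hom C Z X))"

definition biproduct ::
  "('o, 'm, 'x) ab_cat_scheme \<Rightarrow> 'o \<Rightarrow> 'o \<Rightarrow> 'o \<Rightarrow> 'm \<Rightarrow> 'm \<Rightarrow> 'm \<Rightarrow> 'm \<Rightarrow> bool" where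
  "biproduct C A B P i\<^sub>1 i\<^sub>2 p\<^sub>1 p\<^sub>2 \<longleftrightarrow>
    A \<in> Obj C \<and> B \<in> Obj C \<and> P \<in> Obj C \<and>
    i\<^sub>1 \<in> Hom C A P \<and> i\<^sub>2 \<in> Hom C B P \<and> p\<^sub>1 \<in> Hom C P A \<and> p\<^sub>2 \<in> Hom C P B \<and>
    p\<^sub>1 \<cdot>\<^bsub>C\<^esub> i\<^sub>1 = Ident C A \<and> p\<^sub>2 \<cdot>\<^bsub>C\<^esub> i\<^sub>2 = Ident C B \<and>
    p\<^sub>1 \<cdot>\<^bsub>C\<^esub> i\<^sub>2 = Zero C B A \<and> p\<^sub>2 \<cdot>\<^bsub>C\<^esub> i\<^sub>1 = Zero C A B \<and>
    Add C (i\<^sub>1 \<cdot>\<^bsub>C\<^esub> p\<^sub>1) (i\<^sub>2 \<cdot>\<^bsub>C\<^esub> p\<^sub>2) = Ident C P"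

definition is_kernel :: "('o, 'm, 'x) ab_cat_scheme \<Rightarrow> 'm \<Rightarrow> 'm \<Rightarrow> bool" where
  "is_kernel C f k \<longleftrightarrow> f \<in> Arr C \<and> k \<in> Arr C \<and> Cod C k = Dom C f \<and>
    f \<cdot>\<^bsub>C\<^esub> k = Zero C (Dom C k) (Cod C f) \<and>
    (\<forall>Z \<in> Obj C. \<forall>g \<in> Hom C Z (Dom C f). f \<cdot>\<^bsub>C\<^esub> g = Zero C Z (Cod C f) \<longrightarrow>
       (\<exists>!h. h \<in> Hom C Z (Dom C k) \<and> k \<cdot>\<^bsub>C\<^esub> h = g))"

definition is_cokernel :: "('o, 'm, 'x) ab_cat_scheme \<Rightarrow> 'm \<Rightarrow> 'm \<Rightarrow> bool" where
  "is_cokernel C f q \<longleftrightarrow> f \<in> Arr C \<and> q \<in> Arr C \<and> Dom C q = Cod C f \<and>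
    q \<cdot>\<^bsub>C\<^esub> f = Zero C (Dom C f) (Cod C q) \<and>
    (\<forall>Z \<in> Obj C. \<forall>g \<in> Hom C (Cod C f) Z. g \<cdot>\<^bsub>C\<^esub> f = Zero C (Dom C f) Z \<longrightarrow>
       (\<exists>!h. h \<in> Hom C (Cod C q) Z \<and> h \<cdot>\<^bsub>C\<^esub> q = g))"

locale category =
  fixes C :: "('o, 'm, 'x) ab_cat_scheme" (structure)
  assumes Dom_Obj: "f \<in> Arr C \<Longrightarrow> Dom C f \<in> Obj C"
    and Cod_Obj: "f \<in> Arr C \<Longrightarrow> Cod C f \<in> Obj C"
    and Id_Hom: "X \<in> Obj C \<Longrightarrow> Ident C X \<in> Hom C X X"
    and Comp_Hom: "\<lbrakk>f \<in> Hom C X Y; g \<in> Hom C Y Z\<rbrakk> \<Longrightarrow> g \<cdot> f \<in> Hom C X Z"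
    and Comp_Id: "f \<in> Hom C X Y \<Longrightarrow> f \<cdot> Ident C X = f"
    and Id_Comp: "f \<in> Hom C X Y \<Longrightarrow> Ident C Y \<cdot> f = f"
    and Comp_assoc:
      "\<lbrakk>f \<in> Hom C W X; g \<in> Hom C X Y; h \<in> Hom C Y Z\<rbrakk> \<Longrightarrow> (h \<cdot> g) \<cdot> f = h \<cdot> (g \<cdot> f)"

locale preadditive_category = category +
  assumes Hom_comm_group: "\<lbrakk>X \<in> Obj C; Y \<in> Obj C\<rbrakk> \<Longrightarrow> comm_group (hom_group C X Y)"
    and Comp_Add:
      "\<lbrakk>f \<in> Hom C X Y; f' \<in> Hom C X Y; g \<in> Hom C Y Z\<rbrakk>
        \<Longrightarrow> g \<cdot> Add C f f' = Add C (g \<cdot> f) (g \<cdot> f')"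
    and Add_Comp:
      "\<lbrakk>f \<in> Hom C X Y; g \<in> Hom C Y Z; g' \<in> Hom C Y Z\<rbrakk>
        \<Longrightarrow> Add C g g' \<cdot> f = Add C (g \<cdot> f) (g' \<cdot> f)"

locale abelian_category = preadditive_category +
  assumes ex_zero_object: "\<exists>Z. zero_object C Z"
    and ex_biproduct:
      "\<lbrakk>A \<in> Obj C; B \<in> Obj C\<rbrakk> \<Longrightarrow> \<exists>P i\<^sub>1 i\<^sub>2 p\<^sub>1 p\<^sub>2. biproduct C A B P i\<^sub>1 i\<^sub>2 p\<^sub>1 p\<^sub>2"
    and ex_kernel: "f \<in> Arr C \<Longrightarrow> \<exists>k. is_kernel C f k"
    and ex_cokernel: "f \<in> Arr C \<Longrightarrow> \<exists>q. is_cokernel C f q"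
    and monic_normal: "monic C f \<Longrightarrow> \<exists>g. is_kernel C g f"
    and epic_normal: "epic C f \<Longrightarrow> \<exists>g. is_cokernel C g f"

text \<open>
  The kernel, cokernel, intersection and sum below are representatives, picked by choice, of
  notions that are determined up to isomorphism.  They are meaningful only when the object
  in question exists; kernels and cokernels always do in an abelian category.
\<close>

definition Ker :: "('o, 'm, 'x) ab_cat_scheme \<Rightarrow> 'm \<Rightarrow> 'm" where
  "Ker C f = (SOME k. is_kernel C f k)"

definition Coker :: "('o, 'm, 'x) ab_cat_scheme \<Rightarrow> 'm \<Rightarrow> 'm" where
  "Coker C f = (SOME q. is_cokernel C f q)"

definition Img :: "('o, 'm, 'x) ab_cat_scheme \<Rightarrow> 'm \<Rightarrow> 'm" where
  "Img C f = Ker C (Coker C f)"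


section \<open>Products and coproducts of families\<close>

text \<open>
  If products (or coproducts) were required for index sets as large as the type of arrows,
  only trivial categories would qualify.  Smallness is therefore measured by an index type
  \<open>'i\<close>, independent of the types of objects and arrows: ``arbitrary'' products,
  coproducts and families are those indexed by subsets of \<open>'i\<close>.  Since \<open>'i\<close> is a type
  variable, a theorem about all infinite \<open>'i\<close> covers families of every size.  (Over a
  finite type only families of bounded length would be seen.)
\<close>

definition is_product ::
  "('o, 'm, 'x) ab_cat_scheme \<Rightarrow> 'i set \<Rightarrow> ('i \<Rightarrow> 'o) \<Rightarrow> 'o \<Rightarrow> ('i \<Rightarrow> 'm) \<Rightarrow> bool" where
  "is_product C I A P p \<longleftrightarrow> P \<in> Obj C \<and> (\<forall>i \<in> I. p i \<in> Hom C P (A i)) \<and>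
    (\<forall>Z \<in> Obj C. \<forall>g. (\<forall>i \<in> I. g i \<in> Hom C Z (A i)) \<longrightarrow>
       (\<exists>!h. h \<in> Hom C Z P \<and> (\<forall>i \<in> I. p i \<cdot>\<^bsub>C\<^esub> h = g i)))"

definition is_coproduct ::
  "('o, 'm, 'x) ab_cat_scheme \<Rightarrow> 'i set \<Rightarrow> ('i \<Rightarrow> 'o) \<Rightarrow> 'o \<Rightarrow> ('i \<Rightarrow> 'm) \<Rightarrow> bool" where
  "is_coproduct C I A P j \<longleftrightarrow> P \<in> Obj C \<and> (\<forall>i \<in> I. j i \<in> Hom C (A i) P) \<and>
    (\<forall>Z \<in> Obj C. \<forall>g. (\<forall>i \<in> I. g i \<in> Hom C (A i) Z) \<longrightarrow>
       (\<exists>!h. h \<in> Hom C P Z \<and> (\<forall>i \<in> I. h \<cdot>\<^bsub>C\<^esub> j i = g i)))"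

definition AB3 :: "'i itself \<Rightarrow> ('o, 'm, 'x) ab_cat_scheme \<Rightarrow> bool" where
  "AB3 (T :: 'i itself) C \<longleftrightarrow>
    (\<forall>(I :: 'i set) A. (\<forall>i \<in> I. A i \<in> Obj C) \<longrightarrow> (\<exists>P j. is_coproduct C I A P j))"

definition AB3_star :: "'i itself \<Rightarrow> ('o, 'm, 'x) ab_cat_scheme \<Rightarrow> bool" where
  "AB3_star (T :: 'i itself) C \<longleftrightarrow>
    (\<forall>(I :: 'i set) A. (\<forall>i \<in> I. A i \<in> Obj C) \<longrightarrow> (\<exists>P p. is_product C I A P p))"


section \<open>Subobjects\<close>

text \<open>
  A subobject of \<open>X\<close> is represented by a monomorphism into \<open>X\<close>; two of them are the same
  subobject when each factors through the other.
\<close>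

definition subobject :: "('o, 'm, 'x) ab_cat_scheme \<Rightarrow> 'o \<Rightarrow> 'm \<Rightarrow> bool" where
  "subobject C X k \<longleftrightarrow> monic C k \<and> Cod C k = X"

definition sub_le :: "('o, 'm, 'x) ab_cat_scheme \<Rightarrow> 'm \<Rightarrow> 'm \<Rightarrow> bool" where
  "sub_le C k l \<longleftrightarrow> (\<exists>u \<in> Hom C (Dom C k) (Dom C l). l \<cdot>\<^bsub>C\<^esub> u = k)"

definition sub_eq :: "('o, 'm, 'x) ab_cat_scheme \<Rightarrow> 'm \<Rightarrow> 'm \<Rightarrow> bool" where
  "sub_eq C k l \<longleftrightarrow> sub_le C k l \<and> sub_le C l k"

definition is_intersection ::
  "('o, 'm, 'x) ab_cat_scheme \<Rightarrow> 'o \<Rightarrow> 'm set \<Rightarrow> 'm \<Rightarrow> bool" where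
  "is_intersection C X S k \<longleftrightarrow> subobject C X k \<and> (\<forall>s \<in> S. sub_le C k s) \<and>
    (\<forall>l. subobject C X l \<and> (\<forall>s \<in> S. sub_le C l s) \<longrightarrow> sub_le C l k)"

definition is_sum ::
  "('o, 'm, 'x) ab_cat_scheme \<Rightarrow> 'o \<Rightarrow> 'm set \<Rightarrow> 'm \<Rightarrow> bool" where
  "is_sum C X S k \<longleftrightarrow> subobject C X k \<and> (\<forall>s \<in> S. sub_le C s k) \<and>
    (\<forall>l. subobject C X l \<and> (\<forall>s \<in> S. sub_le C s l) \<longrightarrow> sub_le C k l)"

definition Intersection :: "('o, 'm, 'x) ab_cat_scheme \<Rightarrow> 'o \<Rightarrow> 'm set \<Rightarrow> 'm" where
  "Intersection C X S = (SOME k. is_intersection C X S k)"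

definition Sum_of :: "('o, 'm, 'x) ab_cat_scheme \<Rightarrow> 'o \<Rightarrow> 'm set \<Rightarrow> 'm" where
  "Sum_of C X S = (SOME k. is_sum C X S k)"

definition fully_invariant :: "('o, 'm, 'x) ab_cat_scheme \<Rightarrow> 'o \<Rightarrow> 'm \<Rightarrow> bool" where
  "fully_invariant C X k \<longleftrightarrow> subobject C X k \<and>
    (\<forall>h \<in> Hom C X X. \<exists>a \<in> Hom C (Dom C k) (Dom C k). h \<cdot>\<^bsub>C\<^esub> k = k \<cdot>\<^bsub>C\<^esub> a)"

definition direct_summand :: "('o, 'm, 'x) ab_cat_scheme \<Rightarrow> 'o \<Rightarrow> 'm \<Rightarrow> bool" where
  "direct_summand C X k \<longleftrightarrow> subobject C X k \<and>
    (\<exists>B l p q. biproduct C (Dom C k) B X k l p q)"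

definition essential :: "('o, 'm, 'x) ab_cat_scheme \<Rightarrow> 'o \<Rightarrow> 'm \<Rightarrow> bool" where
  "essential C B a \<longleftrightarrow> subobject C B a \<and>
    (\<forall>c. subobject C B c \<and> zero_object C (Dom C (Intersection C B {a, c}))
       \<longrightarrow> zero_object C (Dom C c))"

definition superfluous :: "('o, 'm, 'x) ab_cat_scheme \<Rightarrow> 'o \<Rightarrow> 'm \<Rightarrow> bool" where
  "superfluous C B a \<longleftrightarrow> subobject C B a \<and>
    (\<forall>c. subobject C B c \<and> sub_eq C (Sum_of C B {a, c}) (Ident C B)
       \<longrightarrow> sub_eq C c (Ident C B))"

text \<open>For subobjects \<open>k\<close> and \<open>d\<close> of the same object: \<open>k\<close> is contained in \<open>d\<close> and essential in it.\<close>

definition essential_in :: "('o, 'm, 'x) ab_cat_scheme \<Rightarrow> 'm \<Rightarrow> 'm \<Rightarrow> bool" where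
  "essential_in C k d \<longleftrightarrow>
    (\<exists>u \<in> Hom C (Dom C k) (Dom C d). d \<cdot>\<^bsub>C\<^esub> u = k \<and> essential C (Dom C d) u)"

text \<open>
  For subobjects \<open>k \<subseteq> l\<close> of the same object \<open>X\<close>, the arrow \<open>m\<close> is the canonical
  \<open>L/K \<rightarrow> X/K\<close> induced by \<open>l\<close>.
\<close>

definition lies_above :: "('o, 'm, 'x) ab_cat_scheme \<Rightarrow> 'm \<Rightarrow> 'm \<Rightarrow> bool" where
  "lies_above C l k \<longleftrightarrow>
    (\<exists>u \<in> Hom C (Dom C k) (Dom C l). l \<cdot>\<^bsub>C\<^esub> u = k \<and>
      (\<exists>m \<in> Hom C (Cod C (Coker C u)) (Cod C (Coker C k)).
         m \<cdot>\<^bsub>C\<^esub> Coker C u = Coker C k \<cdot>\<^bsub>C\<^esub> l \<and>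
         superfluous C (Cod C (Coker C k)) m))"


section \<open>ESSIP, LSSSP and CS-Baer objects\<close>

definition ESSIP :: "'i itself \<Rightarrow> ('o, 'm, 'x) ab_cat_scheme \<Rightarrow> 'o \<Rightarrow> bool" where
  "ESSIP (T :: 'i itself) C X \<longleftrightarrow>
    (\<forall>(I :: 'i set) s. (\<forall>i \<in> I. direct_summand C X (s i)) \<longrightarrow>
      (\<exists>d. direct_summand C X d \<and> essential_in C (Intersection C X (s ` I)) d))"

definition strictly_ESSIP :: "'i itself \<Rightarrow> ('o, 'm, 'x) ab_cat_scheme \<Rightarrow> 'o \<Rightarrow> bool" where
  "strictly_ESSIP (T :: 'i itself) C X \<longleftrightarrow>
    (\<forall>(I :: 'i set) s. (\<forall>i \<in> I. direct_summand C X (s i)) \<longrightarrow>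
      (\<exists>d. direct_summand C X d \<and> fully_invariant C X d \<and>
           essential_in C (Intersection C X (s ` I)) d))"

definition LSSSP :: "'i itself \<Rightarrow> ('o, 'm, 'x) ab_cat_scheme \<Rightarrow> 'o \<Rightarrow> bool" where
  "LSSSP (T :: 'i itself) C X \<longleftrightarrow>
    (\<forall>(I :: 'i set) s. (\<forall>i \<in> I. direct_summand C X (s i)) \<longrightarrow>
      (\<exists>d. direct_summand C X d \<and> lies_above C (Sum_of C X (s ` I)) d))"

definition strictly_LSSSP :: "'i itself \<Rightarrow> ('o, 'm, 'x) ab_cat_scheme \<Rightarrow> 'o \<Rightarrow> bool" where
  "strictly_LSSSP (T :: 'i itself) C X \<longleftrightarrow>
    (\<forall>(I :: 'i set) s. (\<forall>i \<in> I. direct_summand C X (s i)) \<longrightarrow>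
      (\<exists>d. direct_summand C X d \<and> fully_invariant C X d \<and>
           lies_above C (Sum_of C X (s ` I)) d))"

text \<open>In the following definitions \<open>M\<close> comes before \<open>N\<close>: ``\<open>N\<close> is (dual) (strongly) \<open>M\<close>-CS-Baer''.\<close>

definition CS_Baer :: "'i itself \<Rightarrow> ('o, 'm, 'x) ab_cat_scheme \<Rightarrow> 'o \<Rightarrow> 'o \<Rightarrow> bool" where
  "CS_Baer (T :: 'i itself) C M N \<longleftrightarrow>
    (\<forall>(I :: 'i set) f. (\<forall>i \<in> I. f i \<in> Hom C M N) \<longrightarrow>
      (\<exists>d. direct_summand C M d \<and>
           essential_in C (Intersection C M ((\<lambda>i. Ker C (f i)) ` I)) d))"

definition strongly_CS_Baer ::
  "'i itself \<Rightarrow> ('o, 'm, 'x) ab_cat_scheme \<Rightarrow> 'o \<Rightarrow> 'o \<Rightarrow> bool" where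
  "strongly_CS_Baer (T :: 'i itself) C M N \<longleftrightarrow>
    (\<forall>(I :: 'i set) f. (\<forall>i \<in> I. f i \<in> Hom C M N) \<longrightarrow>
      (\<exists>d. direct_summand C M d \<and> fully_invariant C M d \<and>
           essential_in C (Intersection C M ((\<lambda>i. Ker C (f i)) ` I)) d))"

definition dual_CS_Baer ::
  "'i itself \<Rightarrow> ('o, 'm, 'x) ab_cat_scheme \<Rightarrow> 'o \<Rightarrow> 'o \<Rightarrow> bool" where
  "dual_CS_Baer (T :: 'i itself) C M N \<longleftrightarrow>
    (\<forall>(I :: 'i set) f. (\<forall>i \<in> I. f i \<in> Hom C M N) \<longrightarrow>
      (\<exists>d. direct_summand C N d \<and>
           lies_above C (Sum_of C N ((\<lambda>i. Img C (f i)) ` I)) d))"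

definition dual_strongly_CS_Baer ::
  "'i itself \<Rightarrow> ('o, 'm, 'x) ab_cat_scheme \<Rightarrow> 'o \<Rightarrow> 'o \<Rightarrow> bool" where
  "dual_strongly_CS_Baer (T :: 'i itself) C M N \<longleftrightarrow>
    (\<forall>(I :: 'i set) f. (\<forall>i \<in> I. f i \<in> Hom C M N) \<longrightarrow>
      (\<exists>d. direct_summand C N d \<and> fully_invariant C N d \<and>
           lies_above C (Sum_of C N ((\<lambda>i. Img C (f i)) ` I)) d))"

end

(* Let P be the biproduct of M and N. For f : M -> N the arrow p2 + f p1 is a retraction of i2, and
   together with p2 it has i1 (Ker f) as joint kernel. So i1 carries an intersection of kernels of
   arrows M -> N to an intersection K of direct summands of P, which is essential in some direct
   summand D of P. If D is fully invariant, it lies inside M and is a fully invariant summand of M.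
   Otherwise let a : M -> D restrict the retraction onto D. It is monic on K, so L := Ker a meets K
   trivially; i1 L is the intersection of the summands Ker p2 and Ker q (q the retraction of P onto
   D), and the hypothesis applied to these two makes L a direct summand of M. Correcting the
   retraction of L so that it kills K gives a complement of L in M that contains K; a is monic on
   it, and K is essential in it because its image under a lies in D.

   The argument is phrased with joint kernels of retractions rather than with intersections of
   summands, since then part (2) is part (1) in the opposite category: the sum of a family of
   summands of P is the kernel of the joint cokernel of the split monomorphisms. *)

theory Submission
  imports Defs
begin

text \<open>What blocks a direct argument: \<open>p\<^sub>1 \<cdot> d\<close> embeds D into M, and
  it contains K essentially, but no retraction of it is at hand. Composing it with
  \<open>q \<cdot> i\<^sub>1\<close> gives an endomorphism of D that fixes K. This endomorphism is
  monic because K is essential, yet it need not be invertible, so D cannot simply be carried over to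
  M. The summand of M is therefore obtained as a complement of L, and this is why the hypothesis on
  P is used a second time: nothing else would make L split off. Full invariance removes the
  obstacle, since invariance under the projection onto N already forces D into M. The index type has
  to be infinite because the family of retractions contains one member more than the given family of
  arrows M -> N.\<close>

definition Sub :: "('o, 'm, 'x) ab_cat_scheme \<Rightarrow> 'm \<Rightarrow> 'm \<Rightarrow> 'm" (infixl "\<ominus>\<index>" 65) where
  "f \<ominus>\<^bsub>C\<^esub> g = Add C f (inv\<^bsub>hom_group C (Dom C g) (Cod C g)\<^esub> g)"

text \<open>The kernel of the arrow into a product with the members of \<open>F\<close> as
  components, described without the product. For empty \<open>F\<close> it is an isomorphism onto
  \<open>X\<close>. In the opposite category it is a joint cokernel, whose kernel is a sum of
  subobjects.\<close>

definition joint_kernel :: "('o, 'm, 'x) ab_cat_scheme \<Rightarrow> 'o \<Rightarrow> 'm set \<Rightarrow> 'm \<Rightarrow> bool" where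
  "joint_kernel C X F k \<longleftrightarrow> k \<in> Arr C \<and> Cod C k = X \<and>
    (\<forall>f \<in> F. f \<in> Arr C \<and> Dom C f = X \<and> f \<cdot>\<^bsub>C\<^esub> k = Zero C (Dom C k) (Cod C f)) \<and>
    (\<forall>Z \<in> Obj C. \<forall>g \<in> Hom C Z X. (\<forall>f \<in> F. f \<cdot>\<^bsub>C\<^esub> g = Zero C Z (Cod C f)) \<longrightarrow>
       (\<exists>!h. h \<in> Hom C Z (Dom C k) \<and> k \<cdot>\<^bsub>C\<^esub> h = g))"

text \<open>A direct summand with a chosen projection. The condition is self-dual: reversing arrows
  exchanges \<open>d\<close> and \<open>r\<close>.\<close>

definition retract :: "('o, 'm, 'x) ab_cat_scheme \<Rightarrow> 'o \<Rightarrow> 'm \<Rightarrow> 'm \<Rightarrow> bool" where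
  "retract C X d r \<longleftrightarrow> d \<in> Hom C (Dom C d) X \<and> r \<in> Hom C X (Dom C d) \<and>
    r \<cdot>\<^bsub>C\<^esub> d = Ident C (Dom C d)"

text \<open>
  Trivial intersection is tested on arrows (\<open>u g = c h\<close> forces \<open>g = 0\<close>), so that the dual notion
  (coessential epimorphisms, whose kernels are superfluous) is \<open>ess\<close> in the opposite category.
\<close>

definition ess :: "('o, 'm, 'x) ab_cat_scheme \<Rightarrow> 'm \<Rightarrow> bool" where
  "ess C u \<longleftrightarrow> monic C u \<and>
    (\<forall>Z \<in> Obj C. \<forall>c \<in> Hom C Z (Cod C u). monic C c \<longrightarrow>
      (\<forall>W \<in> Obj C. \<forall>g \<in> Hom C W (Dom C u). \<forall>h \<in> Hom C W Z.
         u \<cdot>\<^bsub>C\<^esub> g = c \<cdot>\<^bsub>C\<^esub> h \<longrightarrow> g = Zero C W (Dom C u)) \<longrightarrow>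
      c = Zero C Z (Cod C u))"

text \<open>\<open>d \<cdot> r\<close> is the projection onto the summand, so the equation says that
  \<open>h\<close> maps the summand into itself. Read in the opposite category it says that
  \<open>h\<close> preserves the kernel of a split epimorphism.\<close>

definition invariant_retract :: "('o, 'm, 'x) ab_cat_scheme \<Rightarrow> 'o \<Rightarrow> 'm \<Rightarrow> 'm \<Rightarrow> bool" where
  "invariant_retract C X d r \<longleftrightarrow>
    (\<forall>h \<in> Hom C X X. d \<cdot>\<^bsub>C\<^esub> (r \<cdot>\<^bsub>C\<^esub> (h \<cdot>\<^bsub>C\<^esub> d)) = h \<cdot>\<^bsub>C\<^esub> d)"

text \<open>The flag \<open>s\<close> selects the versions with the words in parentheses (fully invariant summands).\<close>

definition ess_in_retract :: "bool \<Rightarrow> ('o, 'm, 'x) ab_cat_scheme \<Rightarrow> 'o \<Rightarrow> 'm \<Rightarrow> bool" where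
  "ess_in_retract s C X k \<longleftrightarrow>
    (\<exists>d r u. retract C X d r \<and> (s \<longrightarrow> invariant_retract C X d r) \<and>
       u \<in> Hom C (Dom C k) (Dom C d) \<and> d \<cdot>\<^bsub>C\<^esub> u = k \<and> ess C u)"

text \<open>The summands are the kernels of the retractions in \<open>F\<close>, and
  \<open>j\<close> is their intersection. The function \<open>g\<close> bounds the size of
  \<open>F\<close> by the index type while \<open>F\<close> remains a plain set. Existence of
  \<open>j\<close> is kept apart from the property.\<close>

definition retraction_ESSIP ::
  "'i itself \<Rightarrow> bool \<Rightarrow> ('o, 'm, 'x) ab_cat_scheme \<Rightarrow> 'o \<Rightarrow> bool" where
  "retraction_ESSIP (T :: 'i itself) s C X \<longleftrightarrow>
    (\<forall>(g :: 'i \<Rightarrow> 'm) F j. F \<subseteq> range g \<and> (\<forall>c \<in> F. \<exists>t. retract C X t c) \<and> joint_kernel C X F j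
      \<longrightarrow> ess_in_retract s C X j)"

section \<open>Composition, monomorphisms and epimorphisms\<close>

context category
begin

lemma Hom_arr: "f \<in> Arr C \<Longrightarrow> f \<in> Hom C (Dom C f) (Cod C f)"
  by (simp add: Hom_def)

lemma Comp_arr [simp]:
  assumes "f \<in> Arr C" "g \<in> Arr C" "Cod C f = Dom C g"
  shows "g \<cdot> f \<in> Arr C" "Dom C (g \<cdot> f) = Dom C f" "Cod C (g \<cdot> f) = Cod C g"
  using Comp_Hom[of f "Dom C f" "Dom C g" g "Cod C g"] assms by (auto simp: Hom_def)

lemma assoc [simp]:
  assumes "f \<in> Arr C" "g \<in> Arr C" "h \<in> Arr C" "Cod C f = Dom C g" "Cod C g = Dom C h"
  shows "(h \<cdot> g) \<cdot> f = h \<cdot> (g \<cdot> f)"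
  using Comp_assoc[of f "Dom C f" "Dom C g" g "Dom C h" h "Cod C h"] assms by (auto simp: Hom_def)

text \<open>The simplifier brackets composites to the right, which hides a factor
  \<open>h \<cdot> g\<close> whose value is known; this rule brings it back.\<close>

lemma Comp_reassoc:
  assumes "h \<cdot> g = k" "f \<in> Arr C" "g \<in> Arr C" "h \<in> Arr C" "Cod C f = Dom C g" "Cod C g = Dom C h"
  shows "h \<cdot> (g \<cdot> f) = k \<cdot> f"
  using assms by (simp flip: assms(1))

lemma Ident_arr [simp]:
  assumes "X \<in> Obj C"
  shows "Ident C X \<in> Arr C" "Dom C (Ident C X) = X" "Cod C (Ident C X) = X"
  using Id_Hom[OF assms] by (auto simp: Hom_def)

lemma Ident_comp [simp]:
  "f \<in> Arr C \<Longrightarrow> Dom C f = X \<Longrightarrow> f \<cdot> Ident C X = f"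
  "f \<in> Arr C \<Longrightarrow> Cod C f = X \<Longrightarrow> Ident C X \<cdot> f = f"
  using Comp_Id[OF Hom_arr] Id_Comp[OF Hom_arr] by auto

lemmas [simp] = Dom_Obj Cod_Obj

lemma monicD:
  assumes "monic C f" "f \<cdot> g = f \<cdot> h" "g \<in> Arr C" "h \<in> Arr C"
    "Dom C g = Dom C h" "Cod C g = Dom C f" "Cod C h = Dom C f"
  shows "g = h"
proof -
  have "g \<in> Hom C (Dom C h) (Dom C f)" "h \<in> Hom C (Dom C h) (Dom C f)"
    using assms by (auto simp: Hom_def)
  then show ?thesis
    using assms(1,2) Dom_Obj[OF assms(4)] unfolding monic_def by blast
qed

lemma epicD:
  assumes "epic C f" "g \<cdot> f = h \<cdot> f" "g \<in> Arr C" "h \<in> Arr C"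
    "Cod C g = Cod C h" "Dom C g = Cod C f" "Dom C h = Cod C f"
  shows "g = h"
proof -
  have "g \<in> Hom C (Cod C f) (Cod C h)" "h \<in> Hom C (Cod C f) (Cod C h)"
    using assms by (auto simp: Hom_def)
  then show ?thesis
    using assms(1,2) Cod_Obj[OF assms(4)] unfolding epic_def by blast
qed

lemma monic_arr [simp]: "monic C f \<Longrightarrow> f \<in> Arr C"
  by (simp add: monic_def)

lemma epic_arr [simp]: "epic C f \<Longrightarrow> f \<in> Arr C"
  by (simp add: epic_def)

lemma monic_comp:
  assumes "monic C f" "monic C g" "Cod C f = Dom C g"
  shows "monic C (g \<cdot> f)"
  unfolding monic_def
proof (intro conjI ballI impI)
  show "g \<cdot> f \<in> Arr C" using assms by simp
  fix Z x y
  assume Z: "Z \<in> Obj C" "x \<in> Hom C Z (Dom C (g \<cdot> f))" "y \<in> Hom C Z (Dom C (g \<cdot> f))"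
    and e: "g \<cdot> f \<cdot> x = g \<cdot> f \<cdot> y"
  have "f \<cdot> x = f \<cdot> y"
    by (rule monicD[OF assms(2)]) (use Z e assms in \<open>auto simp: Hom_def\<close>)
  then show "x = y"
    by (rule monicD[OF assms(1)]) (use Z assms in \<open>auto simp: Hom_def\<close>)
qed

lemma monic_comp_left:
  assumes "monic C (g \<cdot> f)" "f \<in> Arr C" "g \<in> Arr C" "Cod C f = Dom C g"
  shows "monic C f"
  unfolding monic_def
proof (intro conjI ballI impI)
  show "f \<in> Arr C" by fact
  fix Z x y
  assume Z: "Z \<in> Obj C" "x \<in> Hom C Z (Dom C f)" "y \<in> Hom C Z (Dom C f)" and e: "f \<cdot> x = f \<cdot> y"
  show "x = y"
    by (rule monicD[OF assms(1)]) (use Z e assms in \<open>auto simp: Hom_def\<close>)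
qed

lemma monic_Ident: "X \<in> Obj C \<Longrightarrow> monic C (Ident C X)"
  by (simp add: monic_def Hom_def del: monic_arr)

lemma retract_monic: "retract C X d r \<Longrightarrow> monic C d"
proof -
  assume "retract C X d r"
  then have "monic C (r \<cdot> d)" "d \<in> Arr C" "r \<in> Arr C" "Cod C d = Dom C r"
    using monic_Ident[OF Dom_Obj] by (auto simp: retract_def Hom_def)
  then show ?thesis by (rule monic_comp_left)
qed

end

section \<open>Sums and differences of arrows\<close>

context preadditive_category
begin

lemma hom_group_simps [simp]:
  "carrier (hom_group C X Y) = Hom C X Y" "x \<otimes>\<^bsub>hom_group C X Y\<^esub> y = Add C x y"
  "\<one>\<^bsub>hom_group C X Y\<^esub> = Zero C X Y"
  by (simp_all add: hom_group_def)

lemma Zero_arr [simp]: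
  assumes "X \<in> Obj C" "Y \<in> Obj C"
  shows "Zero C X Y \<in> Arr C" "Dom C (Zero C X Y) = X" "Cod C (Zero C X Y) = Y"
proof -
  interpret G: comm_group "hom_group C X Y" using assms by (rule Hom_comm_group)
  show "Zero C X Y \<in> Arr C" "Dom C (Zero C X Y) = X" "Cod C (Zero C X Y) = Y"
    using G.one_closed by (auto simp: Hom_def)
qed

lemma Add_arr [simp]:
  assumes "f \<in> Arr C" "g \<in> Arr C" "Dom C g = Dom C f" "Cod C g = Cod C f"
  shows "Add C f g \<in> Arr C" "Dom C (Add C f g) = Dom C f" "Cod C (Add C f g) = Cod C f"
proof -
  interpret G: comm_group "hom_group C (Dom C f) (Cod C f)" using assms by (simp add: Hom_comm_group)
  show "Add C f g \<in> Arr C" "Dom C (Add C f g) = Dom C f" "Cod C (Add C f g) = Cod C f"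
    using G.m_closed[of f g] assms by (auto simp: Hom_def)
qed

lemma Add_Zero [simp]:
  assumes "f \<in> Arr C"
  shows "Dom C f = X \<Longrightarrow> Cod C f = Y \<Longrightarrow> Add C f (Zero C X Y) = f"
    "Dom C f = X \<Longrightarrow> Cod C f = Y \<Longrightarrow> Add C (Zero C X Y) f = f"
proof -
  interpret G: comm_group "hom_group C (Dom C f) (Cod C f)" using assms by (simp add: Hom_comm_group)
  show "Dom C f = X \<Longrightarrow> Cod C f = Y \<Longrightarrow> Add C f (Zero C X Y) = f"
    "Dom C f = X \<Longrightarrow> Cod C f = Y \<Longrightarrow> Add C (Zero C X Y) f = f"
    using G.r_one[of f] G.l_one[of f] assms by (auto simp: Hom_def)
qed

lemma Comp_Add' [simp]:
  assumes "f \<in> Arr C" "g \<in> Arr C" "h \<in> Arr C" "Dom C f = Dom C g" "Cod C f = Cod C g" "Cod C g = Dom C h"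
  shows "h \<cdot> Add C f g = Add C (h \<cdot> f) (h \<cdot> g)"
  using Comp_Add[of f "Dom C f" "Cod C f" g h "Cod C h"] assms by (auto simp: Hom_def)

lemma Add_Comp' [simp]:
  assumes "f \<in> Arr C" "g \<in> Arr C" "h \<in> Arr C" "Dom C f = Dom C g" "Cod C f = Cod C g" "Cod C h = Dom C g"
  shows "Add C f g \<cdot> h = Add C (f \<cdot> h) (g \<cdot> h)"
  using Add_Comp[of h "Dom C h" "Dom C f" f "Cod C f" g] assms by (auto simp: Hom_def)

text \<open>Cancellation in the hom group. With distributivity it yields that composing with a zero
  arrow gives a zero arrow.\<close>

lemma Add_idem_Zero:
  assumes "f \<in> Arr C" "Add C f f = f"
  shows "f = Zero C (Dom C f) (Cod C f)"
proof -
  interpret G: comm_group "hom_group C (Dom C f) (Cod C f)" using assms by (simp add: Hom_comm_group)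
  show ?thesis
    using G.l_cancel_one[of f f] assms by (auto simp: Hom_def)
qed

lemma Comp_Zero [simp]:
  assumes "g \<in> Arr C" "Z \<in> Obj C" "Dom C g = Y"
  shows "g \<cdot> Zero C Z Y = Zero C Z (Cod C g)"
proof -
  have Y: "Y \<in> Obj C" using assms by auto
  have "g \<cdot> Add C (Zero C Z Y) (Zero C Z Y) = Add C (g \<cdot> Zero C Z Y) (g \<cdot> Zero C Z Y)"
    by (rule Comp_Add') (use assms Y in auto)
  then show ?thesis using Add_idem_Zero[of "g \<cdot> Zero C Z Y"] assms Y by simp
qed

lemma Zero_Comp [simp]:
  assumes "g \<in> Arr C" "Z \<in> Obj C" "Cod C g = Y"
  shows "Zero C Y Z \<cdot> g = Zero C (Dom C g) Z"
proof -
  have Y: "Y \<in> Obj C" using assms by auto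
  have "Add C (Zero C Y Z) (Zero C Y Z) \<cdot> g = Add C (Zero C Y Z \<cdot> g) (Zero C Y Z \<cdot> g)"
    by (rule Add_Comp') (use assms Y in auto)
  then show ?thesis using Add_idem_Zero[of "Zero C Y Z \<cdot> g"] assms Y by simp
qed

lemma
  assumes "f \<in> Arr C" "g \<in> Arr C" "Dom C f = Dom C g" "Cod C f = Cod C g"
  shows Sub_arr [simp]: "f \<ominus> g \<in> Arr C" "Dom C (f \<ominus> g) = Dom C g" "Cod C (f \<ominus> g) = Cod C g"
    and Sub_add: "Add C (f \<ominus> g) g = f"
    and Sub_eqI: "\<And>h. h \<in> Hom C (Dom C g) (Cod C g) \<Longrightarrow> Add C h g = f \<Longrightarrow> f \<ominus> g = h"
proof -
  interpret G: comm_group "hom_group C (Dom C g) (Cod C g)" using assms by (simp add: Hom_comm_group)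
  have f: "f \<in> carrier (hom_group C (Dom C g) (Cod C g))" and
    g: "g \<in> carrier (hom_group C (Dom C g) (Cod C g))" using assms by (auto simp: Hom_def)
  have e: "f \<ominus> g = f \<otimes>\<^bsub>hom_group C (Dom C g) (Cod C g)\<^esub> inv\<^bsub>hom_group C (Dom C g) (Cod C g)\<^esub> g"
    by (simp add: Sub_def)
  have "f \<ominus> g \<in> carrier (hom_group C (Dom C g) (Cod C g))"
    unfolding e using f g by (intro G.m_closed G.inv_closed)
  then show "f \<ominus> g \<in> Arr C" "Dom C (f \<ominus> g) = Dom C g" "Cod C (f \<ominus> g) = Cod C g"
    by (auto simp: Hom_def)
  have "(f \<ominus> g) \<otimes>\<^bsub>hom_group C (Dom C g) (Cod C g)\<^esub> g = f"
    unfolding e using f g by (simp only: G.m_assoc G.inv_closed G.l_inv G.r_one)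
  then show a: "Add C (f \<ominus> g) g = f" by simp
  show "f \<ominus> g = h" if "h \<in> Hom C (Dom C g) (Cod C g)" "Add C h g = f" for h
    using G.right_cancel[of g "f \<ominus> g" h] that a g \<open>f \<ominus> g \<in> carrier _\<close> by simp
qed

lemma Comp_Sub [simp]:
  assumes "f \<in> Arr C" "g \<in> Arr C" "h \<in> Arr C" "Dom C f = Dom C g" "Cod C f = Cod C g" "Cod C g = Dom C h"
  shows "h \<cdot> (f \<ominus> g) = h \<cdot> f \<ominus> h \<cdot> g"
proof (rule Sub_eqI[symmetric])
  have "Add C (h \<cdot> (f \<ominus> g)) (h \<cdot> g) = h \<cdot> Add C (f \<ominus> g) g"
    by (rule Comp_Add'[symmetric]) (use assms in auto)
  then show "Add C (h \<cdot> (f \<ominus> g)) (h \<cdot> g) = h \<cdot> f" using assms by (simp only: Sub_add)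
qed (use assms in \<open>auto simp: Hom_def\<close>)

lemma Sub_Comp [simp]:
  assumes "f \<in> Arr C" "g \<in> Arr C" "h \<in> Arr C" "Dom C f = Dom C g" "Cod C f = Cod C g" "Cod C h = Dom C g"
  shows "(f \<ominus> g) \<cdot> h = f \<cdot> h \<ominus> g \<cdot> h"
proof (rule Sub_eqI[symmetric])
  have "Add C ((f \<ominus> g) \<cdot> h) (g \<cdot> h) = Add C (f \<ominus> g) g \<cdot> h"
    by (rule Add_Comp'[symmetric]) (use assms in auto)
  then show "Add C ((f \<ominus> g) \<cdot> h) (g \<cdot> h) = f \<cdot> h" using assms by (simp only: Sub_add)
qed (use assms in \<open>auto simp: Hom_def\<close>)

lemma Sub_Zero [simp]:
  assumes "f \<in> Arr C" "Dom C f = X" "Cod C f = Y"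
  shows "f \<ominus> Zero C X Y = f"
  by (rule Sub_eqI) (use assms in \<open>auto simp: Hom_def\<close>)

lemma Sub_self [simp]:
  assumes "f \<in> Arr C"
  shows "f \<ominus> f = Zero C (Dom C f) (Cod C f)"
  by (rule Sub_eqI) (use assms in \<open>auto simp: Hom_def\<close>)

lemma Sub_eq_Zero:
  assumes "f \<in> Arr C" "g \<in> Arr C" "Dom C f = Dom C g" "Cod C f = Cod C g"
    and "f \<ominus> g = Zero C (Dom C g) (Cod C g)"
  shows "f = g"
  using Sub_add[OF assms(1-4)] assms by simp

text \<open>Taking differences reduces left cancellation to the case of a zero composite.\<close>

lemma monicI:
  assumes "f \<in> Arr C"
    and "\<And>g. g \<in> Arr C \<Longrightarrow> Cod C g = Dom C f \<Longrightarrow> f \<cdot> g = Zero C (Dom C g) (Cod C f)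
      \<Longrightarrow> g = Zero C (Dom C g) (Dom C f)"
  shows "monic C f"
  unfolding monic_def
proof (intro conjI ballI impI)
  show "f \<in> Arr C" by fact
  fix Z x y
  assume Z: "Z \<in> Obj C" "x \<in> Hom C Z (Dom C f)" "y \<in> Hom C Z (Dom C f)" and e: "f \<cdot> x = f \<cdot> y"
  note [simp] = Z[unfolded Hom_def, simplified] assms(1)
  have "x \<ominus> y = Zero C (Dom C (x \<ominus> y)) (Dom C f)"
    by (rule assms(2)) (use e in simp_all)
  with Sub_eq_Zero[of x y] show "x = y" by simp
qed

lemma monic_Zero:
  assumes "monic C f" "g \<in> Arr C" "Cod C g = Dom C f" "f \<cdot> g = Zero C (Dom C g) (Cod C f)"
  shows "g = Zero C (Dom C g) (Dom C f)"
  by (rule monicD[OF assms(1)]) (use assms in \<open>auto simp: Hom_def\<close>)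

lemma epic_Zero:
  assumes "epic C f" "g \<in> Arr C" "Dom C g = Cod C f" "g \<cdot> f = Zero C (Dom C f) (Cod C g)"
  shows "g = Zero C (Cod C f) (Cod C g)"
  by (rule epicD[OF assms(1)]) (use assms in \<open>auto simp: Hom_def\<close>)

lemma epicI:
  assumes "f \<in> Arr C"
    and "\<And>g. g \<in> Arr C \<Longrightarrow> Dom C g = Cod C f \<Longrightarrow> g \<cdot> f = Zero C (Dom C f) (Cod C g)
      \<Longrightarrow> g = Zero C (Cod C f) (Cod C g)"
  shows "epic C f"
  unfolding epic_def
proof (intro conjI ballI impI)
  show "f \<in> Arr C" by fact
  fix Z x y
  assume Z: "Z \<in> Obj C" "x \<in> Hom C (Cod C f) Z" "y \<in> Hom C (Cod C f) Z" and e: "x \<cdot> f = y \<cdot> f"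
  note [simp] = Z[unfolded Hom_def, simplified] assms(1)
  have "x \<ominus> y = Zero C (Cod C f) (Cod C (x \<ominus> y))"
    by (rule assms(2)) (use e in simp_all)
  with Sub_eq_Zero[of x y] show "x = y" by simp
qed

section \<open>Joint kernels, kernels and cokernels\<close>

lemma joint_kernel_monic:
  assumes "joint_kernel C X F k"
  shows "monic C k"
  unfolding monic_def
proof (intro conjI ballI impI)
  show k: "k \<in> Arr C" using assms by (simp add: joint_kernel_def)
  fix Z x y
  assume Z: "Z \<in> Obj C" "x \<in> Hom C Z (Dom C k)" "y \<in> Hom C Z (Dom C k)" and e: "k \<cdot> x = k \<cdot> y"
  note [simp] = Z[unfolded Hom_def, simplified] k
  have kx: "k \<cdot> x \<in> Hom C Z X" using assms by (auto simp: joint_kernel_def Hom_def)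
  have "f \<cdot> (k \<cdot> x) = Zero C Z (Cod C f)" if "f \<in> F" for f
  proof -
    have f: "f \<in> Arr C" "Dom C f = Cod C k" "f \<cdot> k = Zero C (Dom C k) (Cod C f)"
      using assms that by (auto simp: joint_kernel_def)
    have "f \<cdot> (k \<cdot> x) = (f \<cdot> k) \<cdot> x" using f(1,2) by simp
    then show ?thesis using f by simp
  qed
  then have "\<exists>!h. h \<in> Hom C Z (Dom C k) \<and> k \<cdot> h = k \<cdot> x"
    using assms kx \<open>Z \<in> Obj C\<close> by (simp add: joint_kernel_def)
  then show "x = y" using Z e by auto
qed

lemma joint_kernel_lift:
  assumes "joint_kernel C X F k" "g \<in> Arr C" "Cod C g = X"
    and "\<And>f. f \<in> F \<Longrightarrow> f \<cdot> g = Zero C (Dom C g) (Cod C f)"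
  obtains h where "h \<in> Arr C" "Dom C h = Dom C g" "Cod C h = Dom C k" "k \<cdot> h = g"
proof -
  have "g \<in> Hom C (Dom C g) X" using assms by (simp add: Hom_def)
  then obtain h where "h \<in> Hom C (Dom C g) (Dom C k)" "k \<cdot> h = g"
    using assms unfolding joint_kernel_def by (meson Dom_Obj)
  then show thesis using that by (auto simp: Hom_def)
qed

lemma joint_kernelI:
  assumes "monic C k" "Cod C k = X"
    and "\<And>f. f \<in> F \<Longrightarrow> f \<in> Arr C \<and> Dom C f = X \<and> f \<cdot> k = Zero C (Dom C k) (Cod C f)"
    and "\<And>g. g \<in> Arr C \<Longrightarrow> Cod C g = X \<Longrightarrow> (\<And>f. f \<in> F \<Longrightarrow> f \<cdot> g = Zero C (Dom C g) (Cod C f))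
      \<Longrightarrow> \<exists>h. h \<in> Hom C (Dom C g) (Dom C k) \<and> k \<cdot> h = g"
  shows "joint_kernel C X F k"
  unfolding joint_kernel_def
proof (intro conjI ballI impI)
  fix Z g
  assume "Z \<in> Obj C" and g: "g \<in> Hom C Z X" "\<forall>f\<in>F. f \<cdot> g = Zero C Z (Cod C f)"
  then obtain h where h: "h \<in> Hom C Z (Dom C k)" "k \<cdot> h = g"
    using assms(4)[of g] by (auto simp: Hom_def)
  show "\<exists>!h. h \<in> Hom C Z (Dom C k) \<and> k \<cdot> h = g"
    by (rule ex1I[of _ h]) (use h monicD[OF assms(1)] in \<open>auto simp: Hom_def\<close>)
qed (use assms in auto)

lemma is_kernel_iff_joint:
  "is_kernel C f k \<longleftrightarrow> f \<in> Arr C \<and> joint_kernel C (Dom C f) {f} k"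
  by (auto simp: is_kernel_def joint_kernel_def)

lemma is_kernelD:
  assumes "is_kernel C f k"
  shows "monic C k" "f \<in> Arr C" "Cod C k = Dom C f" "f \<cdot> k = Zero C (Dom C k) (Cod C f)"
proof -
  show "monic C k" using assms joint_kernel_monic unfolding is_kernel_iff_joint by blast
qed (use assms in \<open>simp_all add: is_kernel_def\<close>)

lemma is_kernel_lift:
  assumes "is_kernel C f k" "g \<in> Arr C" "Cod C g = Dom C f" "f \<cdot> g = Zero C (Dom C g) (Cod C f)"
  obtains h where "h \<in> Arr C" "Dom C h = Dom C g" "Cod C h = Dom C k" "k \<cdot> h = g"
  using joint_kernel_lift[of "Dom C f" "{f}" k g] assms unfolding is_kernel_iff_joint by blast

lemma is_cokernel_desc:
  assumes "is_cokernel C f q" "g \<in> Arr C" "Dom C g = Cod C f" "g \<cdot> f = Zero C (Dom C f) (Cod C g)"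
  obtains h where "h \<in> Arr C" "Cod C h = Cod C g" "Dom C h = Cod C q" "h \<cdot> q = g"
proof -
  have "g \<in> Hom C (Cod C f) (Cod C g)" using assms by (simp add: Hom_def)
  then obtain h where "h \<in> Hom C (Cod C q) (Cod C g)" "h \<cdot> q = g"
    using assms unfolding is_cokernel_def by (meson Cod_Obj)
  then show thesis using that by (auto simp: Hom_def)
qed

lemma is_cokernelD:
  assumes "is_cokernel C f q"
  shows "epic C q" "f \<in> Arr C" "Dom C q = Cod C f" "q \<cdot> f = Zero C (Dom C f) (Cod C q)"
proof -
  show q: "f \<in> Arr C" "Dom C q = Cod C f" "q \<cdot> f = Zero C (Dom C f) (Cod C q)"
    using assms by (auto simp: is_cokernel_def)
  have [simp]: "q \<in> Arr C" using assms by (auto simp: is_cokernel_def)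
  note [simp] = q(1,2)
  show "epic C q"
    unfolding epic_def
  proof (intro conjI ballI impI)
    fix Z x y
    assume Z: "Z \<in> Obj C" "x \<in> Hom C (Cod C q) Z" "y \<in> Hom C (Cod C q) Z" and e: "x \<cdot> q = y \<cdot> q"
    note [simp] = Z[unfolded Hom_def, simplified]
    have "(x \<cdot> q) \<cdot> f = Zero C (Dom C f) Z" by (simp add: q(3))
    moreover have "x \<cdot> q \<in> Hom C (Cod C f) Z" by (simp add: Hom_def)
    ultimately have "\<exists>!h. h \<in> Hom C (Cod C q) Z \<and> h \<cdot> q = x \<cdot> q"
      using assms \<open>Z \<in> Obj C\<close> by (simp add: is_cokernel_def)
    then show "x = y" using Z e by auto
  qed simp
qed

section \<open>Rules for essential monomorphisms\<close>

lemma ess_monic: "ess C u \<Longrightarrow> monic C u"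
  by (simp add: ess_def)

lemma essD:
  assumes "ess C u" "monic C c" "Cod C c = Cod C u"
    and "\<And>g h. g \<in> Arr C \<Longrightarrow> h \<in> Arr C \<Longrightarrow> Dom C h = Dom C g \<Longrightarrow> Cod C g = Dom C u \<Longrightarrow> Cod C h = Dom C c
      \<Longrightarrow> u \<cdot> g = c \<cdot> h \<Longrightarrow> g = Zero C (Dom C g) (Dom C u)"
  shows "c = Zero C (Dom C c) (Cod C c)"
proof -
  have "c \<in> Hom C (Dom C c) (Cod C u)" using assms by (auto simp: Hom_def)
  moreover have "\<forall>W\<in>Obj C. \<forall>g\<in>Hom C W (Dom C u). \<forall>h\<in>Hom C W (Dom C c).
      u \<cdot> g = c \<cdot> h \<longrightarrow> g = Zero C W (Dom C u)"
    using assms(4) by (auto simp: Hom_def)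
  ultimately show ?thesis using assms(1-3) by (simp add: ess_def)
qed

lemma essI:
  assumes "monic C u"
    and "\<And>c. monic C c \<Longrightarrow> Cod C c = Cod C u \<Longrightarrow>
      (\<And>g h. g \<in> Arr C \<Longrightarrow> h \<in> Arr C \<Longrightarrow> Dom C h = Dom C g \<Longrightarrow> Cod C g = Dom C u \<Longrightarrow> Cod C h = Dom C c
        \<Longrightarrow> u \<cdot> g = c \<cdot> h \<Longrightarrow> g = Zero C (Dom C g) (Dom C u))
      \<Longrightarrow> c = Zero C (Dom C c) (Cod C c)"
  shows "ess C u"
  unfolding ess_def
proof (intro conjI ballI impI)
  fix Z c
  assume "Z \<in> Obj C" and c: "c \<in> Hom C Z (Cod C u)" "monic C c"
    and *: "\<forall>W\<in>Obj C. \<forall>g\<in>Hom C W (Dom C u). \<forall>h\<in>Hom C W Z.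
      u \<cdot> g = c \<cdot> h \<longrightarrow> g = Zero C W (Dom C u)"
  have "c = Zero C (Dom C c) (Cod C c)"
  proof (rule assms(2))
    fix g h
    assume gh: "g \<in> Arr C" "h \<in> Arr C" "Dom C h = Dom C g" "Cod C g = Dom C u" "Cod C h = Dom C c"
      "u \<cdot> g = c \<cdot> h"
    then have "g \<in> Hom C (Dom C g) (Dom C u)" "h \<in> Hom C (Dom C g) Z"
      using c by (auto simp: Hom_def)
    with * gh show "g = Zero C (Dom C g) (Dom C u)" by (meson Dom_Obj)
  qed (use c in \<open>simp_all add: Hom_def\<close>)
  then show "c = Zero C Z (Cod C u)" using c by (simp add: Hom_def)
qed (use assms in auto)

end

section \<open>Exactness in abelian categories\<close>

context abelian_category
begin

lemma is_kernel_Ker: "f \<in> Arr C \<Longrightarrow> is_kernel C f (Ker C f)"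
  unfolding Ker_def by (rule someI_ex) (rule ex_kernel)

lemma is_cokernel_Coker: "f \<in> Arr C \<Longrightarrow> is_cokernel C f (Coker C f)"
  unfolding Coker_def by (rule someI_ex) (rule ex_cokernel)

text \<open>By normality \<open>m\<close> is the kernel of some \<open>g\<close>. As
  \<open>g\<close> kills \<open>m\<close>, it factors through \<open>c\<close>; hence whatever
  \<open>c\<close> kills is killed by \<open>g\<close> and factors through \<open>m\<close>.\<close>

lemma monic_kernel_of_cokernel:
  assumes "monic C m" "is_cokernel C m c"
  shows "is_kernel C c m"
proof -
  note c = is_cokernelD[OF assms(2)]
  have [simp]: "m \<in> Arr C" "c \<in> Arr C" "Dom C c = Cod C m" using assms c by auto
  obtain g where g: "is_kernel C g m" using monic_normal[OF assms(1)] by auto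
  note gD = is_kernelD[OF g]
  have [simp]: "g \<in> Arr C" "Dom C g = Cod C m" using gD by auto
  obtain g' where g': "g' \<in> Arr C" "Cod C g' = Cod C g" "Dom C g' = Cod C c" "g' \<cdot> c = g"
    by (rule is_cokernel_desc[OF assms(2), of g]) (use gD in auto)
  show ?thesis
    unfolding is_kernel_iff_joint
  proof (intro conjI joint_kernelI)
    fix x assume x: "x \<in> Arr C" "Cod C x = Dom C c"
      and "\<And>f. f \<in> {c} \<Longrightarrow> f \<cdot> x = Zero C (Dom C x) (Cod C f)"
    then have cx: "c \<cdot> x = Zero C (Dom C x) (Cod C c)" by simp
    have "g \<cdot> x = g' \<cdot> (c \<cdot> x)" using g'(1-3) x by (simp flip: g'(4))
    then have gx: "g \<cdot> x = Zero C (Dom C x) (Cod C g)" using g'(1-3) x by (simp add: cx)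
    obtain h where "h \<in> Arr C" "Dom C h = Dom C x" "Cod C h = Dom C m" "m \<cdot> h = x"
      by (rule is_kernel_lift[OF g, of x]) (use x gx in auto)
    then show "\<exists>h. h \<in> Hom C (Dom C x) (Dom C m) \<and> m \<cdot> h = x" by (auto simp: Hom_def)
  qed (use assms c in auto)
qed

text \<open>By normality \<open>q\<close> is the cokernel of some \<open>x\<close>. As
  \<open>q\<close> kills \<open>x\<close>, this \<open>x\<close> factors through \<open>k\<close>;
  hence \<open>g\<close> kills \<open>x\<close> and descends along \<open>q\<close>.\<close>

lemma epic_cokernel_of_kernel:
  assumes "epic C q" "is_kernel C q k" "g \<in> Arr C" "Dom C g = Dom C q"
    and "g \<cdot> k = Zero C (Dom C k) (Cod C g)"
  obtains h where "h \<in> Arr C" "Cod C h = Cod C g" "Dom C h = Cod C q" "h \<cdot> q = g"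
proof -
  note k = is_kernelD[OF assms(2)]
  have [simp]: "k \<in> Arr C" "q \<in> Arr C" "Cod C k = Dom C q" using assms k by auto
  obtain x where x: "is_cokernel C x q" using epic_normal[OF assms(1)] by auto
  note xD = is_cokernelD[OF x]
  have [simp]: "x \<in> Arr C" "Cod C x = Dom C q" using xD by auto
  obtain y where y: "y \<in> Arr C" "Dom C y = Dom C x" "Cod C y = Dom C k" "k \<cdot> y = x"
    by (rule is_kernel_lift[OF assms(2), of x]) (use xD in auto)
  have "g \<cdot> x = (g \<cdot> k) \<cdot> y" using y(1-3) assms(3,4) by (simp flip: y(4))
  then have "g \<cdot> x = Zero C (Dom C x) (Cod C g)"
    unfolding assms(5) using assms(3,4) y(1-3) by simp
  then show thesis using is_cokernel_desc[OF x, of g] assms that by auto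
qed

lemma image_factorization:
  assumes "x \<in> Arr C"
  obtains c e where "monic C c" "epic C e" "Dom C e = Dom C x" "Cod C e = Dom C c"
    "Cod C c = Cod C x" "c \<cdot> e = x" "c = Img C x"
proof -
  let ?q = "Coker C x" and ?c = "Img C x"
  note qk = is_cokernel_Coker[OF assms]
  note q = is_cokernelD[OF qk]
  have ck: "is_kernel C ?q ?c" unfolding Img_def by (rule is_kernel_Ker) (use q in auto)
  note c = is_kernelD[OF ck]
  have [simp]: "x \<in> Arr C" "?q \<in> Arr C" "Dom C ?q = Cod C x" "?c \<in> Arr C" "Cod C ?c = Cod C x"
    using assms q c by auto
  obtain e where e [simp]: "e \<in> Arr C" "Dom C e = Dom C x" "Cod C e = Dom C ?c" and ce: "?c \<cdot> e = x"
    by (rule is_kernel_lift[OF ck, of x]) (use q in auto)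
  \<comment> \<open>If \<open>t\<close> kills \<open>e\<close>, then \<open>x\<close> factors
    through the smaller subobject \<open>?c \<cdot> ?n\<close>. That subobject is the kernel of some
    \<open>g\<close>; \<open>g\<close> kills \<open>x\<close>, hence factors through the cokernel of
    \<open>x\<close> and kills the whole image. So \<open>?c\<close> lies in
    \<open>?c \<cdot> ?n\<close>, which makes \<open>?n\<close> split epic and \<open>t\<close>
    zero.\<close>
  have "epic C e"
  proof (rule epicI)
    fix t assume t [simp]: "t \<in> Arr C" "Dom C t = Cod C e"
      and te: "t \<cdot> e = Zero C (Dom C e) (Cod C t)"
    have nk: "is_kernel C t (Ker C t)" by (rule is_kernel_Ker) simp
    note n = is_kernelD[OF nk]
    let ?n = "Ker C t"
    have [simp]: "?n \<in> Arr C" "Cod C ?n = Dom C ?c" using n by auto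
    obtain y where y [simp]: "y \<in> Arr C" "Dom C y = Dom C x" "Cod C y = Dom C ?n" and ny: "?n \<cdot> y = e"
      by (rule is_kernel_lift[OF nk, of e]) (use te in auto)
    have "monic C (?c \<cdot> ?n)" by (rule monic_comp) (use c n in auto)
    then obtain g where gk: "is_kernel C g (?c \<cdot> ?n)" using monic_normal by blast
    note g = is_kernelD[OF gk]
    have [simp]: "g \<in> Arr C" "Dom C g = Cod C x" using g by auto
    have gcn: "g \<cdot> (?c \<cdot> ?n) = Zero C (Dom C ?n) (Cod C g)" using g by simp
    have "g \<cdot> x = (g \<cdot> (?c \<cdot> ?n)) \<cdot> y" by (simp add: ny ce)
    then have "g \<cdot> x = Zero C (Dom C x) (Cod C g)" unfolding gcn by simp
    then obtain h where h [simp]: "h \<in> Arr C" "Cod C h = Cod C g" "Dom C h = Cod C ?q" and hq: "h \<cdot> ?q = g"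
      using is_cokernel_desc[OF qk, of g] by auto
    have "g \<cdot> ?c = h \<cdot> (?q \<cdot> ?c)" by (simp flip: hq)
    then have "g \<cdot> ?c = Zero C (Dom C ?c) (Cod C g)" by (simp add: c(4))
    then obtain w where w [simp]: "w \<in> Arr C" "Dom C w = Dom C ?c" "Cod C w = Dom C (?c \<cdot> ?n)"
      and cw: "(?c \<cdot> ?n) \<cdot> w = ?c"
      using is_kernel_lift[OF gk, of ?c] by auto
    have [simp]: "Cod C w = Dom C ?n" using w(3) by simp
    have "?n \<cdot> w = Ident C (Dom C ?c)"
      by (rule monicD[OF c(1)]) (use cw in \<open>auto simp: Hom_def\<close>)
    then have "t = (t \<cdot> ?n) \<cdot> w" by simp
    also have "\<dots> = Zero C (Cod C e) (Cod C t)" unfolding n(4) by simp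
    finally show "t = Zero C (Cod C e) (Cod C t)" .
  qed simp
  then show thesis using that[of ?c e] c ce by simp
qed

text \<open>Stability of epimorphisms under pullback, the substitute for choosing preimages of
  elements: \<open>h\<close> lifts along \<open>x\<close> after composition with an epimorphism. The
  pullback is the kernel \<open>w\<close> of the difference map \<open>g\<close> on a biproduct.
  Since \<open>g \<cdot> i\<^sub>1 = x\<close>, \<open>g\<close> is epic and so behaves as the
  cokernel of \<open>w\<close>: an arrow \<open>t\<close> killing \<open>p\<^sub>2 \<cdot> w\<close>
  satisfies \<open>t \<cdot> p\<^sub>2 = s \<cdot> g\<close>, and restricting to the first summand
  gives \<open>s \<cdot> x = 0\<close>.\<close>

lemma epic_pullback:
  assumes x: "epic C x" "h \<in> Arr C" "Cod C h = Cod C x"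
  obtains e z where "epic C e" "Cod C e = Dom C h" "z \<in> Arr C" "Dom C z = Dom C e" "Cod C z = Dom C x"
    "x \<cdot> z = h \<cdot> e"
proof -
  have [simp]: "x \<in> Arr C" "h \<in> Arr C" "Cod C h = Cod C x" using x by auto
  obtain P i\<^sub>1 i\<^sub>2 p\<^sub>1 p\<^sub>2 where b: "biproduct C (Dom C x) (Dom C h) P i\<^sub>1 i\<^sub>2 p\<^sub>1 p\<^sub>2"
    using ex_biproduct[of "Dom C x" "Dom C h"] by auto
  note [simp] = b[unfolded biproduct_def Hom_def, simplified]
  define g where "g = x \<cdot> p\<^sub>1 \<ominus> h \<cdot> p\<^sub>2"
  have [simp]: "g \<in> Arr C" "Dom C g = P" "Cod C g = Cod C x" by (simp_all add: g_def)
  have gi1: "g \<cdot> i\<^sub>1 = x" by (simp add: g_def)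
  have ge: "epic C g"
  proof (rule epicI)
    fix t assume t [simp]: "t \<in> Arr C" "Dom C t = Cod C g" and tg: "t \<cdot> g = Zero C (Dom C g) (Cod C t)"
    have "t \<cdot> x = (t \<cdot> g) \<cdot> i\<^sub>1" using gi1 by simp
    then have "t \<cdot> x = Zero C (Dom C x) (Cod C t)" unfolding tg by simp
    then show "t = Zero C (Cod C g) (Cod C t)" using epic_Zero[OF x(1), of t] by simp
  qed simp
  define w where "w = Ker C g"
  have wk: "is_kernel C g w" unfolding w_def by (rule is_kernel_Ker) simp
  note wD = is_kernelD[OF wk]
  have [simp]: "w \<in> Arr C" "Cod C w = P" using wD by auto
  have "epic C (p\<^sub>2 \<cdot> w)"
  proof (rule epicI)
    fix t assume t [simp]: "t \<in> Arr C" "Dom C t = Cod C (p\<^sub>2 \<cdot> w)"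
      and t0: "t \<cdot> (p\<^sub>2 \<cdot> w) = Zero C (Dom C (p\<^sub>2 \<cdot> w)) (Cod C t)"
    have [simp]: "Dom C t = Dom C h" by simp
    obtain s where s [simp]: "s \<in> Arr C" "Cod C s = Cod C (t \<cdot> p\<^sub>2)" "Dom C s = Cod C g" and sg: "s \<cdot> g = t \<cdot> p\<^sub>2"
      by (rule epic_cokernel_of_kernel[OF ge wk, of "t \<cdot> p\<^sub>2"]) (use t0 in simp_all)
    have "s \<cdot> x = (s \<cdot> g) \<cdot> i\<^sub>1" using gi1 by simp
    then have "s \<cdot> x = Zero C (Dom C x) (Cod C s)" unfolding sg by simp
    then have "s = Zero C (Cod C x) (Cod C s)" using epic_Zero[OF x(1), of s] by simp
    then have "s \<cdot> g = Zero C (Cod C x) (Cod C t) \<cdot> g" by simp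
    then have "t \<cdot> p\<^sub>2 = Zero C P (Cod C t)" unfolding sg by simp
    then have "(t \<cdot> p\<^sub>2) \<cdot> i\<^sub>2 = Zero C (Dom C h) (Cod C t)" by simp
    then show "t = Zero C (Cod C (p\<^sub>2 \<cdot> w)) (Cod C t)" by simp
  qed simp
  moreover have "x \<cdot> (p\<^sub>1 \<cdot> w) = h \<cdot> (p\<^sub>2 \<cdot> w)"
  proof (rule Sub_eq_Zero)
    have "g \<cdot> w = x \<cdot> (p\<^sub>1 \<cdot> w) \<ominus> h \<cdot> (p\<^sub>2 \<cdot> w)" by (simp add: g_def)
    then show "x \<cdot> (p\<^sub>1 \<cdot> w) \<ominus> h \<cdot> (p\<^sub>2 \<cdot> w)
      = Zero C (Dom C (h \<cdot> (p\<^sub>2 \<cdot> w))) (Cod C (h \<cdot> (p\<^sub>2 \<cdot> w)))"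
      using wD(4) by simp
  qed simp_all
  ultimately show thesis using that[of "p\<^sub>2 \<cdot> w" "p\<^sub>1 \<cdot> w"] by simp
qed

text \<open>The kernel of \<open>f\<close> meets \<open>u\<close> trivially because \<open>f\<close>
  is monic on \<open>u\<close>; essentiality makes it zero.\<close>

lemma ess_detects_monic:
  assumes u: "ess C u" and f: "f \<in> Arr C" "Dom C f = Cod C u" and fu: "monic C (f \<cdot> u)"
  shows "monic C f"
proof (rule monicI)
  have [simp]: "f \<in> Arr C" "u \<in> Arr C" "Dom C f = Cod C u" using f ess_monic[OF u] by auto
  define c where "c = Ker C f"
  have ck: "is_kernel C f c" unfolding c_def by (rule is_kernel_Ker) simp
  note cD = is_kernelD[OF ck]
  have [simp]: "c \<in> Arr C" "Cod C c = Cod C u" using cD by auto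
  have c0: "c = Zero C (Dom C c) (Cod C c)"
  proof (rule essD[OF u cD(1)])
    fix g h
    assume [simp]: "g \<in> Arr C" "h \<in> Arr C" "Dom C h = Dom C g" "Cod C g = Dom C u" "Cod C h = Dom C c"
      and e: "u \<cdot> g = c \<cdot> h"
    have "f \<cdot> (u \<cdot> g) = Zero C (Dom C g) (Cod C f)"
      unfolding e by (subst Comp_reassoc[OF cD(4)]) simp_all
    then show "g = Zero C (Dom C g) (Dom C u)" using monic_Zero[OF fu, of g] by simp
  qed simp
  fix g assume g [simp]: "g \<in> Arr C" "Cod C g = Dom C f" and fg: "f \<cdot> g = Zero C (Dom C g) (Cod C f)"
  obtain h where h: "h \<in> Arr C" "Dom C h = Dom C g" "Cod C h = Dom C c" "c \<cdot> h = g"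
    by (rule is_kernel_lift[OF ck, of g]) (use fg in simp_all)
  have "g = Zero C (Dom C c) (Cod C c) \<cdot> h" using h(4) c0 by simp
  then show "g = Zero C (Dom C g) (Dom C f)" using h(1-3) by simp
qed (rule f)

section \<open>Passing between a biproduct and its first summand\<close>

lemma biproduct_kernel_proj:
  assumes b: "biproduct C M N P i\<^sub>1 i\<^sub>2 p\<^sub>1 p\<^sub>2" and g: "g \<in> Arr C" "Cod C g = P"
    and p2: "p\<^sub>2 \<cdot> g = Zero C (Dom C g) N"
  shows "i\<^sub>1 \<cdot> (p\<^sub>1 \<cdot> g) = g"
proof -
  note [simp] = b[unfolded biproduct_def Hom_def, simplified] g
  have "Add C (i\<^sub>1 \<cdot> p\<^sub>1) (i\<^sub>2 \<cdot> p\<^sub>2) \<cdot> g = Add C (i\<^sub>1 \<cdot> (p\<^sub>1 \<cdot> g)) (i\<^sub>2 \<cdot> (p\<^sub>2 \<cdot> g))"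
    by (subst Add_Comp') simp_all
  also have "\<dots> = i\<^sub>1 \<cdot> (p\<^sub>1 \<cdot> g)" by (simp add: p2)
  finally show ?thesis by simp
qed

text \<open>Being killed by \<open>p\<^sub>2\<close> means lying in the first summand, and there the
  hypothesis \<open>iff\<close> exchanges the conditions of \<open>G\<close> for those of
  \<open>F\<close>. It serves twice: for the given arrows M -> N, and for the single arrow
  \<open>q \<cdot> i\<^sub>1\<close>.\<close>

lemma joint_kernel_biproduct:
  assumes b: "biproduct C M N P i\<^sub>1 i\<^sub>2 p\<^sub>1 p\<^sub>2" and k: "joint_kernel C M F k"
    and G: "\<And>e. e \<in> G \<Longrightarrow> e \<in> Arr C \<and> Dom C e = P"
    and iff: "\<And>x. x \<in> Arr C \<Longrightarrow> Cod C x = M \<Longrightarrow>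
      (\<forall>f\<in>F. f \<cdot> x = Zero C (Dom C x) (Cod C f)) \<longleftrightarrow> (\<forall>e\<in>G. e \<cdot> (i\<^sub>1 \<cdot> x) = Zero C (Dom C x) (Cod C e))"
  shows "joint_kernel C P (insert p\<^sub>2 G) (i\<^sub>1 \<cdot> k)"
proof (rule joint_kernelI)
  note [simp] = b[unfolded biproduct_def Hom_def, simplified]
  have [simp]: "k \<in> Arr C" "Cod C k = M" and kF: "\<forall>f\<in>F. f \<cdot> k = Zero C (Dom C k) (Cod C f)"
    using k by (auto simp: joint_kernel_def)
  have i1: "retract C P i\<^sub>1 p\<^sub>1" by (simp add: retract_def Hom_def)
  show "monic C (i\<^sub>1 \<cdot> k)"
    by (rule monic_comp) (use joint_kernel_monic[OF k] retract_monic[OF i1] in simp_all)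
  show "Cod C (i\<^sub>1 \<cdot> k) = P" by simp
  have kG: "\<forall>e\<in>G. e \<cdot> (i\<^sub>1 \<cdot> k) = Zero C (Dom C k) (Cod C e)" using iff[of k] kF by simp
  have "p\<^sub>2 \<cdot> (i\<^sub>1 \<cdot> k) = Zero C M N \<cdot> k" by (rule Comp_reassoc) simp_all
  then show "f \<in> Arr C \<and> Dom C f = P \<and> f \<cdot> (i\<^sub>1 \<cdot> k) = Zero C (Dom C (i\<^sub>1 \<cdot> k)) (Cod C f)"
    if "f \<in> insert p\<^sub>2 G" for f
    using that kG G by auto
  fix g assume g [simp]: "g \<in> Arr C" "Cod C g = P"
    and g0: "\<And>f. f \<in> insert p\<^sub>2 G \<Longrightarrow> f \<cdot> g = Zero C (Dom C g) (Cod C f)"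
  have ip: "i\<^sub>1 \<cdot> (p\<^sub>1 \<cdot> g) = g"
    by (rule biproduct_kernel_proj[OF b]) (use g0[of p\<^sub>2] in simp_all)
  have "\<forall>f\<in>F. f \<cdot> (p\<^sub>1 \<cdot> g) = Zero C (Dom C g) (Cod C f)"
    using iff[of "p\<^sub>1 \<cdot> g"] g0 by (simp add: ip)
  then obtain h where h: "h \<in> Arr C" "Dom C h = Dom C g" "Cod C h = Dom C k" "k \<cdot> h = p\<^sub>1 \<cdot> g"
    using joint_kernel_lift[OF k, of "p\<^sub>1 \<cdot> g"] by auto
  then show "\<exists>h. h \<in> Hom C (Dom C g) (Dom C (i\<^sub>1 \<cdot> k)) \<and> (i\<^sub>1 \<cdot> k) \<cdot> h = g"
    by (intro exI[of _ h]) (simp add: Hom_def ip)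
qed

lemma ess_in_retract_biproduct_invariant:
  assumes b: "biproduct C M N P i\<^sub>1 i\<^sub>2 p\<^sub>1 p\<^sub>2" and k: "monic C k" "Cod C k = M"
    and P: "ess_in_retract True C P (i\<^sub>1 \<cdot> k)"
  shows "ess_in_retract True C M k"
proof -
  note [simp] = b[unfolded biproduct_def Hom_def, simplified] k(2)
  have [simp]: "k \<in> Arr C" using k by simp
  obtain d q u where dq: "retract C P d q" and inv: "invariant_retract C P d q"
    and u: "u \<in> Hom C (Dom C (i\<^sub>1 \<cdot> k)) (Dom C d)" and du: "d \<cdot> u = i\<^sub>1 \<cdot> k" and ess: "ess C u"
    using P unfolding ess_in_retract_def by blast
  note [simp] = dq[unfolded retract_def Hom_def, simplified] u[unfolded Hom_def, simplified]
  have p1du: "p\<^sub>1 \<cdot> (d \<cdot> u) = k"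
    unfolding du by (subst Comp_reassoc[of p\<^sub>1 i\<^sub>1 "Ident C M"]) simp_all
  have "monic C (p\<^sub>1 \<cdot> d)" by (rule ess_detects_monic[OF ess]) (use k p1du in simp_all)
  \<comment> \<open>Invariance under the idempotent \<open>i\<^sub>2 \<cdot> p\<^sub>2\<close> makes
    \<open>t\<close> its restriction to the summand. As \<open>p\<^sub>1 \<cdot> i\<^sub>2\<close>
    is zero, the monic \<open>p\<^sub>1 \<cdot> d\<close> kills \<open>t\<close>; so the component
    of \<open>d\<close> in N vanishes.\<close>
  moreover define t where "t = q \<cdot> (i\<^sub>2 \<cdot> (p\<^sub>2 \<cdot> d))"
  moreover have [simp]: "t \<in> Arr C" "Dom C t = Dom C d" "Cod C t = Dom C d" by (simp_all add: t_def)
  moreover have dt: "d \<cdot> t = i\<^sub>2 \<cdot> (p\<^sub>2 \<cdot> d)"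
    using inv[unfolded invariant_retract_def, rule_format, of "i\<^sub>2 \<cdot> p\<^sub>2"] by (simp add: t_def Hom_def)
  moreover have "(p\<^sub>1 \<cdot> d) \<cdot> t = Zero C (Dom C d) M"
    using Comp_reassoc[of p\<^sub>1 i\<^sub>2 "Zero C N M" "p\<^sub>2 \<cdot> d"] dt by simp
  ultimately have "t = Zero C (Dom C d) (Dom C d)" using monic_Zero[of "p\<^sub>1 \<cdot> d" t] by simp
  then have "i\<^sub>2 \<cdot> (p\<^sub>2 \<cdot> d) = Zero C (Dom C d) P" using dt by simp
  then have "p\<^sub>2 \<cdot> (i\<^sub>2 \<cdot> (p\<^sub>2 \<cdot> d)) = Zero C (Dom C d) N" by simp
  then have p2d: "p\<^sub>2 \<cdot> d = Zero C (Dom C d) N"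
    using Comp_reassoc[of p\<^sub>2 i\<^sub>2 "Ident C N" "p\<^sub>2 \<cdot> d"] by simp
  have ipd: "i\<^sub>1 \<cdot> (p\<^sub>1 \<cdot> d) = d" by (rule biproduct_kernel_proj[OF b]) (use p2d in simp_all)
  have "retract C M (p\<^sub>1 \<cdot> d) (q \<cdot> i\<^sub>1)" by (simp add: retract_def Hom_def ipd)
  moreover have "invariant_retract C M (p\<^sub>1 \<cdot> d) (q \<cdot> i\<^sub>1)"
    unfolding invariant_retract_def
  proof
    fix h assume h: "h \<in> Hom C M M"
    note [simp] = h[unfolded Hom_def, simplified]
    \<comment> \<open>An endomorphism \<open>h\<close> of M extends by zero to the endomorphism
      \<open>i\<^sub>1 \<cdot> (h \<cdot> p\<^sub>1)\<close> of P, to which invariance in P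
      applies.\<close>
    have "d \<cdot> (q \<cdot> (i\<^sub>1 \<cdot> (h \<cdot> (p\<^sub>1 \<cdot> d)))) = i\<^sub>1 \<cdot> (h \<cdot> (p\<^sub>1 \<cdot> d))"
      using inv[unfolded invariant_retract_def, rule_format, of "i\<^sub>1 \<cdot> (h \<cdot> p\<^sub>1)"] by (simp add: Hom_def)
    then have "p\<^sub>1 \<cdot> (d \<cdot> (q \<cdot> (i\<^sub>1 \<cdot> (h \<cdot> (p\<^sub>1 \<cdot> d))))) = p\<^sub>1 \<cdot> (i\<^sub>1 \<cdot> (h \<cdot> (p\<^sub>1 \<cdot> d)))" by simp
    also have "\<dots> = h \<cdot> (p\<^sub>1 \<cdot> d)"
      by (subst Comp_reassoc[of p\<^sub>1 i\<^sub>1 "Ident C M"]) simp_all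
    finally show "(p\<^sub>1 \<cdot> d) \<cdot> ((q \<cdot> i\<^sub>1) \<cdot> (h \<cdot> (p\<^sub>1 \<cdot> d))) = h \<cdot> (p\<^sub>1 \<cdot> d)" by simp
  qed
  moreover have "u \<in> Hom C (Dom C k) (Dom C (p\<^sub>1 \<cdot> d))" "(p\<^sub>1 \<cdot> d) \<cdot> u = k"
    by (simp_all add: Hom_def p1du)
  ultimately show ?thesis using ess unfolding ess_in_retract_def by blast
qed

text \<open>The complementary idempotent, identity minus \<open>d \<cdot> r\<close>, is killed by
  \<open>r\<close>; lifting it through the kernel \<open>\<gamma>\<close> produces the second
  projection.\<close>

lemma retract_biproduct:
  assumes dr: "retract C X d r" and ker: "is_kernel C r \<gamma>"
  obtains \<delta> where "biproduct C (Dom C d) (Dom C \<gamma>) X d \<gamma> r \<delta>"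
proof -
  note [simp] = dr[unfolded retract_def Hom_def, simplified]
  note \<gamma>D = is_kernelD[OF ker]
  have [simp]: "X \<in> Obj C" using Cod_Obj[of d] by simp
  have [simp]: "\<gamma> \<in> Arr C" "Cod C \<gamma> = X" using \<gamma>D by auto
  have r\<gamma>: "r \<cdot> \<gamma> = Zero C (Dom C \<gamma>) (Dom C d)" using \<gamma>D by simp
  have r0: "r \<cdot> (Ident C X \<ominus> d \<cdot> r) = Zero C X (Dom C d)"
    using Comp_reassoc[of r d "Ident C (Dom C d)" r] by simp
  obtain \<delta> where \<delta> [simp]: "\<delta> \<in> Arr C" "Dom C \<delta> = X" "Cod C \<delta> = Dom C \<gamma>"
    and \<gamma>\<delta>: "\<gamma> \<cdot> \<delta> = Ident C X \<ominus> d \<cdot> r"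
    by (rule is_kernel_lift[OF ker, of "Ident C X \<ominus> d \<cdot> r"]) (use r0 in simp_all)
  have "\<delta> \<cdot> \<gamma> = Ident C (Dom C \<gamma>)"
    by (rule monicD[OF \<gamma>D(1)]) (use Comp_reassoc[OF \<gamma>\<delta>, of \<gamma>] in \<open>simp_all add: r\<gamma>\<close>)
  moreover have "\<delta> \<cdot> d = Zero C (Dom C d) (Dom C \<gamma>)"
    by (rule monicD[OF \<gamma>D(1)]) (use Comp_reassoc[OF \<gamma>\<delta>, of d] in simp_all)
  moreover have "Add C (d \<cdot> r) (\<gamma> \<cdot> \<delta>) = Ident C X"
  proof -
    have "Add C (\<gamma> \<cdot> \<delta>) (d \<cdot> r) = Ident C X" unfolding \<gamma>\<delta> by (rule Sub_add) simp_all
    moreover interpret G: comm_group "hom_group C X X" by (rule Hom_comm_group) simp_all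
    have "Add C (d \<cdot> r) (\<gamma> \<cdot> \<delta>) = Add C (\<gamma> \<cdot> \<delta>) (d \<cdot> r)"
      using G.m_comm[of "d \<cdot> r" "\<gamma> \<cdot> \<delta>"] by (simp add: Hom_def)
    ultimately show ?thesis by simp
  qed
  ultimately show thesis
    using that[of \<delta>] r\<gamma> by (simp add: biproduct_def Hom_def)
qed

lemma biproduct_retract:
  assumes "biproduct C A B X a b p q"
  shows "retract C X a p" "retract C X b q"
  using assms by (auto simp: biproduct_def retract_def Hom_def)

text \<open>
  The kernel \<open>k\<^sub>1\<close> is first shown to be the whole summand \<open>d\<^sub>1\<close> in which it is essential: the image of
  \<open>d\<^sub>1\<close> under \<open>a = q i\<^sub>1\<close> meets the essential \<open>u\<close> trivially, hence is zero.
\<close>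

lemma ess_in_retract_biproduct:
  assumes b: "biproduct C M N P i\<^sub>1 i\<^sub>2 p\<^sub>1 p\<^sub>2" and k: "monic C k" "Cod C k = M"
    and dq: "retract C P d q"
    and u: "u \<in> Hom C (Dom C (i\<^sub>1 \<cdot> k)) (Dom C d)" and du: "d \<cdot> u = i\<^sub>1 \<cdot> k" and ess: "ess C u"
    and ker: "is_kernel C (q \<cdot> i\<^sub>1) k\<^sub>1" and k\<^sub>1P: "ess_in_retract False C P (i\<^sub>1 \<cdot> k\<^sub>1)"
  shows "ess_in_retract False C M k"
proof -
  note [simp] = b[unfolded biproduct_def Hom_def, simplified] k(2)
  have [simp]: "k \<in> Arr C" using k by simp
  note [simp] = dq[unfolded retract_def Hom_def, simplified] u[unfolded Hom_def, simplified]
  define a where "a = q \<cdot> i\<^sub>1"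
  have [simp]: "a \<in> Arr C" "Dom C a = M" "Cod C a = Dom C d" by (simp_all add: a_def)
  have ak: "a \<cdot> k = u"
    using Comp_reassoc[of q d "Ident C (Dom C d)" u] by (simp add: a_def du)
  have ker': "is_kernel C a k\<^sub>1" using ker by (simp add: a_def)
  note k1 = is_kernelD[OF ker']
  have [simp]: "k\<^sub>1 \<in> Arr C" "Cod C k\<^sub>1 = M" using k1 by auto
  have ak1: "a \<cdot> k\<^sub>1 = Zero C (Dom C k\<^sub>1) (Dom C d)" using k1 by simp
  obtain d\<^sub>1 q\<^sub>1 v where d1q1: "retract C P d\<^sub>1 q\<^sub>1"
    and v: "v \<in> Hom C (Dom C (i\<^sub>1 \<cdot> k\<^sub>1)) (Dom C d\<^sub>1)" and d1v: "d\<^sub>1 \<cdot> v = i\<^sub>1 \<cdot> k\<^sub>1" and ess1: "ess C v"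
    using k\<^sub>1P unfolding ess_in_retract_def by blast
  note [simp] = d1q1[unfolded retract_def Hom_def, simplified] v[unfolded Hom_def, simplified]
  define l where "l = p\<^sub>1 \<cdot> d\<^sub>1"
  have [simp]: "l \<in> Arr C" "Dom C l = Dom C d\<^sub>1" "Cod C l = M" by (simp_all add: l_def)
  have lv: "l \<cdot> v = k\<^sub>1"
    using Comp_reassoc[of p\<^sub>1 i\<^sub>1 "Ident C M" k\<^sub>1] by (simp add: l_def d1v)
  \<comment> \<open>\<open>p\<^sub>1\<close> is already monic on \<open>k\<^sub>1\<close>, which is
    essential in \<open>d\<^sub>1\<close>; so \<open>d\<^sub>1\<close> embeds into M, and
    \<open>k\<^sub>1\<close> lies inside the copy \<open>l\<close>.\<close>
  have l: "monic C l" by (rule ess_detects_monic[OF ess1]) (use k1 lv in simp_all)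
  define c where "c = Coker C k"
  have ck: "is_cokernel C k c" unfolding c_def by (rule is_cokernel_Coker) simp
  note cD = is_cokernelD[OF ck]
  have [simp]: "c \<in> Arr C" "Dom C c = M" using cD by auto
  have kc: "is_kernel C c k" by (rule monic_kernel_of_cokernel[OF k(1) ck])
  \<comment> \<open>This says that \<open>k\<close> and \<open>k\<^sub>1\<close> meet trivially:
    \<open>c\<close> is the quotient by \<open>k\<close>, and \<open>a\<close> is monic on
    \<open>k\<close> but zero on \<open>k\<^sub>1\<close>.\<close>
  have "monic C (c \<cdot> k\<^sub>1)"
  proof (rule monicI)
    fix x assume [simp]: "x \<in> Arr C" "Cod C x = Dom C (c \<cdot> k\<^sub>1)"
      and x0: "(c \<cdot> k\<^sub>1) \<cdot> x = Zero C (Dom C x) (Cod C (c \<cdot> k\<^sub>1))"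
    have [simp]: "Cod C x = Dom C k\<^sub>1" by simp
    obtain y where y [simp]: "y \<in> Arr C" "Dom C y = Dom C x" "Cod C y = Dom C k" and ky: "k \<cdot> y = k\<^sub>1 \<cdot> x"
      by (rule is_kernel_lift[OF kc, of "k\<^sub>1 \<cdot> x"]) (use x0 in simp_all)
    have "u \<cdot> y = a \<cdot> (k \<cdot> y)" by (subst Comp_reassoc[OF ak]) simp_all
    also have "\<dots> = Zero C (Dom C x) (Dom C d)" unfolding ky by (subst Comp_reassoc[OF ak1]) simp_all
    finally have "y = Zero C (Dom C x) (Dom C k)" using monic_Zero[OF ess_monic[OF ess], of y] by simp
    then have "k\<^sub>1 \<cdot> x = Zero C (Dom C x) M" by (simp flip: ky)
    then show "x = Zero C (Dom C x) (Dom C (c \<cdot> k\<^sub>1))" using monic_Zero[OF k1(1), of x] by simp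
  qed simp
  then have "monic C ((c \<cdot> l) \<cdot> v)" by (simp add: lv)
  \<comment> \<open>Essentiality of \<open>v\<close> extends the trivial intersection from
    \<open>k\<^sub>1\<close> to all of \<open>l\<close>.\<close>
  then have cl: "monic C (c \<cdot> l)" by (rule ess_detects_monic[OF ess1, rotated 2]) simp_all
  have al: "a \<cdot> l = Zero C (Dom C d\<^sub>1) (Dom C d)"
  proof -
    obtain m e where m: "monic C m" and e: "epic C e"
      and [simp]: "Dom C e = Dom C (a \<cdot> l)" "Cod C e = Dom C m" "Cod C m = Cod C (a \<cdot> l)"
      and me: "m \<cdot> e = a \<cdot> l"
      by (rule image_factorization[of "a \<cdot> l"]) simp_all
    have [simp]: "m \<in> Arr C" "e \<in> Arr C" "Dom C e = Dom C d\<^sub>1" "Cod C m = Dom C d" using m e by simp_all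
    have "m = Zero C (Dom C m) (Cod C m)"
    proof (rule essD[OF ess m])
      fix g h
      assume [simp]: "g \<in> Arr C" "h \<in> Arr C" "Dom C h = Dom C g" "Cod C g = Dom C u" "Cod C h = Dom C m"
        and ug: "u \<cdot> g = m \<cdot> h"
      \<comment> \<open>An element common to \<open>u\<close> and the image of
        \<open>a \<cdot> l\<close> has a preimage in \<open>l\<close> only after the epic cover
        \<open>e'\<close>; this \<open>z\<close> is the preimage.\<close>
      obtain e' z where e': "epic C e'" and [simp]: "Cod C e' = Dom C h" "z \<in> Arr C" "Dom C z = Dom C e'"
        "Cod C z = Dom C e" and ez: "e \<cdot> z = h \<cdot> e'"
        by (rule epic_pullback[OF e, of h]) simp_all
      have [simp]: "e' \<in> Arr C" "Cod C e' = Dom C g" "Cod C z = Dom C d\<^sub>1" using e' by simp_all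
      have "a \<cdot> (k \<cdot> (g \<cdot> e')) = u \<cdot> (g \<cdot> e')" by (subst Comp_reassoc[OF ak]) simp_all
      also have "\<dots> = m \<cdot> (h \<cdot> e')" by (subst Comp_reassoc[OF ug]) simp_all
      also have "\<dots> = a \<cdot> (l \<cdot> z)" unfolding ez[symmetric] by (subst Comp_reassoc[OF me]) simp_all
      \<comment> \<open>\<open>k \<cdot> (g \<cdot> e')\<close> and \<open>l \<cdot> z\<close> agree
        under \<open>a\<close>, so they differ by an element of its kernel \<open>k\<^sub>1\<close>,
        which lies inside \<open>l\<close>. Hence \<open>k \<cdot> (g \<cdot> e')\<close> lies both
        in \<open>k\<close> and in \<open>l\<close>, and these meet trivially.\<close>
      finally have "a \<cdot> (k \<cdot> (g \<cdot> e') \<ominus> l \<cdot> z) = Zero C (Dom C e') (Dom C d)" by simp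
      then obtain x where [simp]: "x \<in> Arr C" "Dom C x = Dom C e'" "Cod C x = Dom C k\<^sub>1"
        and k1x: "k\<^sub>1 \<cdot> x = k \<cdot> (g \<cdot> e') \<ominus> l \<cdot> z"
        using is_kernel_lift[OF ker', of "k \<cdot> (g \<cdot> e') \<ominus> l \<cdot> z"] by auto
      have "k \<cdot> (g \<cdot> e') = Add C (k\<^sub>1 \<cdot> x) (l \<cdot> z)"
        unfolding k1x by (rule Sub_add[symmetric]) simp_all
      also have "\<dots> = l \<cdot> Add C (v \<cdot> x) z"
        using Comp_reassoc[OF lv, of x] by (subst Comp_Add') simp_all
      finally have kge: "k \<cdot> (g \<cdot> e') = l \<cdot> Add C (v \<cdot> x) z" .
      have "(c \<cdot> l) \<cdot> Add C (v \<cdot> x) z = c \<cdot> (l \<cdot> Add C (v \<cdot> x) z)" by (rule assoc) simp_all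
      also have "\<dots> = c \<cdot> (k \<cdot> (g \<cdot> e'))" by (simp only: kge)
      also have "\<dots> = Zero C (Dom C e') (Cod C c)" by (subst Comp_reassoc[OF cD(4)]) simp_all
      finally have "Add C (v \<cdot> x) z = Zero C (Dom C e') (Dom C d\<^sub>1)"
        using monic_Zero[OF cl, of "Add C (v \<cdot> x) z"] by simp
      then have "k \<cdot> (g \<cdot> e') = Zero C (Dom C e') M" using kge by simp
      then have "g \<cdot> e' = Zero C (Dom C e') (Dom C k)" using monic_Zero[OF k(1), of "g \<cdot> e'"] by simp
      then show "g = Zero C (Dom C g) (Dom C u)" using epic_Zero[OF e', of g] by simp
    qed simp
    then have "m \<cdot> e = Zero C (Dom C m) (Cod C m) \<cdot> e" by simp
    then show ?thesis using me by simp
  qed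
  \<comment> \<open>As \<open>a\<close> kills \<open>l\<close>, \<open>l\<close> lies in
    \<open>k\<^sub>1\<close>; together with \<open>lv\<close> this makes them the same subobject,
    and \<open>w\<close> identifies \<open>d\<^sub>1\<close> with \<open>k\<^sub>1\<close>.\<close>
  obtain w where [simp]: "w \<in> Arr C" "Dom C w = Dom C d\<^sub>1" "Cod C w = Dom C k\<^sub>1" and k1w: "k\<^sub>1 \<cdot> w = l"
    by (rule is_kernel_lift[OF ker', of l]) (use al in simp_all)
  have wv: "w \<cdot> v = Ident C (Dom C k\<^sub>1)"
    by (rule monicD[OF k1(1)]) (use Comp_reassoc[OF k1w, of v] lv in simp_all)
  \<comment> \<open>The retraction of P onto \<open>d\<^sub>1\<close>, restricted to M and moved
    along \<open>w\<close>, retracts M onto \<open>k\<^sub>1\<close>.\<close>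
  define \<rho> where "\<rho> = w \<cdot> (q\<^sub>1 \<cdot> i\<^sub>1)"
  have [simp]: "\<rho> \<in> Arr C" "Dom C \<rho> = M" "Cod C \<rho> = Dom C k\<^sub>1" by (simp_all add: \<rho>_def)
  have \<rho>k1: "\<rho> \<cdot> k\<^sub>1 = Ident C (Dom C k\<^sub>1)"
    using Comp_reassoc[of q\<^sub>1 d\<^sub>1 "Ident C (Dom C d\<^sub>1)" v] by (simp add: \<rho>_def d1v wv)
  \<comment> \<open>\<open>p\<^sub>1 d a\<close> fixes \<open>k\<close> and kills \<open>k\<^sub>1\<close>, so \<open>\<rho>'\<close> still retracts \<open>k\<^sub>1\<close> but also kills \<open>k\<close>.\<close>
  define \<rho>' where "\<rho>' = \<rho> \<ominus> \<rho> \<cdot> ((p\<^sub>1 \<cdot> d) \<cdot> a)"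
  have [simp]: "\<rho>' \<in> Arr C" "Dom C \<rho>' = M" "Cod C \<rho>' = Dom C k\<^sub>1" by (simp_all add: \<rho>'_def)
  have \<rho>'k1: "\<rho>' \<cdot> k\<^sub>1 = Ident C (Dom C k\<^sub>1)" by (simp add: \<rho>'_def ak1 \<rho>k1)
  have p1du: "p\<^sub>1 \<cdot> (d \<cdot> u) = k"
    unfolding du by (subst Comp_reassoc[of p\<^sub>1 i\<^sub>1 "Ident C M"]) simp_all
  have \<rho>'k: "\<rho>' \<cdot> k = Zero C (Dom C k) (Dom C k\<^sub>1)" by (simp add: \<rho>'_def ak p1du)
  define \<gamma> where "\<gamma> = Ker C \<rho>'"
  have \<gamma>k: "is_kernel C \<rho>' \<gamma>" unfolding \<gamma>_def by (rule is_kernel_Ker) simp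
  note \<gamma>D = is_kernelD[OF \<gamma>k]
  have [simp]: "\<gamma> \<in> Arr C" "Cod C \<gamma> = M" using \<gamma>D by auto
  have \<rho>'\<gamma>: "\<rho>' \<cdot> \<gamma> = Zero C (Dom C \<gamma>) (Dom C k\<^sub>1)" using \<gamma>D by simp
  have \<rho>'kx: "\<rho>' \<cdot> (k\<^sub>1 \<cdot> x) = x" if "x \<in> Arr C" "Cod C x = Dom C k\<^sub>1" for x
    using Comp_reassoc[OF \<rho>'k1, of x] that by simp
  have "retract C M k\<^sub>1 \<rho>'" using \<rho>'k1 by (simp add: retract_def Hom_def)
  then obtain \<delta> where "biproduct C (Dom C k\<^sub>1) (Dom C \<gamma>) M k\<^sub>1 \<gamma> \<rho>' \<delta>"
    by (rule retract_biproduct[OF _ \<gamma>k])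
  then have \<gamma>\<delta>r: "retract C M \<gamma> \<delta>" by (rule biproduct_retract)
  obtain u' where [simp]: "u' \<in> Arr C" "Dom C u' = Dom C k" "Cod C u' = Dom C \<gamma>" and \<gamma>u': "\<gamma> \<cdot> u' = k"
    by (rule is_kernel_lift[OF \<gamma>k, of k]) (use \<rho>'k in simp_all)
  \<comment> \<open>Whatever \<open>a\<close> kills lies in \<open>k\<^sub>1\<close>. There
    \<open>\<rho>'\<close> is the identity, whereas it is zero on \<open>\<gamma>\<close>.\<close>
  have a\<gamma>: "monic C (a \<cdot> \<gamma>)"
  proof (rule monicI)
    fix x assume [simp]: "x \<in> Arr C" "Cod C x = Dom C (a \<cdot> \<gamma>)"
      and x0: "(a \<cdot> \<gamma>) \<cdot> x = Zero C (Dom C x) (Cod C (a \<cdot> \<gamma>))"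
    have [simp]: "Cod C x = Dom C \<gamma>" by simp
    obtain y where y [simp]: "y \<in> Arr C" "Dom C y = Dom C x" "Cod C y = Dom C k\<^sub>1" and ky: "k\<^sub>1 \<cdot> y = \<gamma> \<cdot> x"
      by (rule is_kernel_lift[OF ker', of "\<gamma> \<cdot> x"]) (use x0 in simp_all)
    have "y = \<rho>' \<cdot> (\<gamma> \<cdot> x)" unfolding ky[symmetric] by (simp add: \<rho>'kx)
    also have "\<dots> = Zero C (Dom C x) (Dom C k\<^sub>1)" by (subst Comp_reassoc[OF \<rho>'\<gamma>]) simp_all
    finally have "\<gamma> \<cdot> x = Zero C (Dom C x) M" by (simp flip: ky)
    then show "x = Zero C (Dom C x) (Dom C (a \<cdot> \<gamma>))" using monic_Zero[OF \<gamma>D(1), of x] by simp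
  qed simp
  \<comment> \<open>The monic \<open>a \<cdot> \<gamma>\<close> carries \<open>u'\<close> to
    \<open>u\<close>. A subobject meeting \<open>u'\<close> trivially therefore has an image in D
    that meets \<open>u\<close> trivially, which is zero since \<open>u\<close> is
    essential.\<close>
  have "ess C u'"
  proof (rule essI)
    show "monic C u'" by (rule monic_comp_left[of \<gamma>]) (use k \<gamma>u' in simp_all)
    fix m assume m: "monic C m" and [simp]: "Cod C m = Cod C u'"
      and *: "\<And>g h. g \<in> Arr C \<Longrightarrow> h \<in> Arr C \<Longrightarrow> Dom C h = Dom C g \<Longrightarrow> Cod C g = Dom C u'
        \<Longrightarrow> Cod C h = Dom C m \<Longrightarrow> u' \<cdot> g = m \<cdot> h \<Longrightarrow> g = Zero C (Dom C g) (Dom C u')"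
    have [simp]: "m \<in> Arr C" using m by simp
    have "(a \<cdot> \<gamma>) \<cdot> m = Zero C (Dom C ((a \<cdot> \<gamma>) \<cdot> m)) (Cod C ((a \<cdot> \<gamma>) \<cdot> m))"
    proof (rule essD[OF ess])
      show "monic C ((a \<cdot> \<gamma>) \<cdot> m)" by (rule monic_comp[OF m a\<gamma>]) simp
      fix g h
      assume gh [simp]: "g \<in> Arr C" "h \<in> Arr C" "Dom C h = Dom C g" "Cod C g = Dom C u"
        "Cod C h = Dom C ((a \<cdot> \<gamma>) \<cdot> m)" and ug: "u \<cdot> g = ((a \<cdot> \<gamma>) \<cdot> m) \<cdot> h"
      have [simp]: "Cod C h = Dom C m" by simp
      have "a \<cdot> (\<gamma> \<cdot> (u' \<cdot> g)) = u \<cdot> g"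
        using Comp_reassoc[OF \<gamma>u', of g] Comp_reassoc[OF ak, of g] by simp
      then have "u' \<cdot> g = m \<cdot> h" by (intro monicD[OF a\<gamma>, of "u' \<cdot> g" "m \<cdot> h"]) (use ug in simp_all)
      then show "g = Zero C (Dom C g) (Dom C u)" using *[of g h] by simp
    qed simp
    then show "m = Zero C (Dom C m) (Cod C m)" using monic_Zero[OF a\<gamma>, of m] by simp
  qed
  moreover have "u' \<in> Hom C (Dom C k) (Dom C \<gamma>)" by (simp add: Hom_def)
  ultimately show ?thesis unfolding ess_in_retract_def using \<gamma>\<delta>r \<gamma>u' by blast
qed

end

section \<open>Joint kernels under a biproduct\<close>

text \<open>An infinite type is equipotent to itself with one point removed, so a family using every
  index can be reindexed to free a place for \<open>a\<close>. This is the source of the condition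
  that the index type be infinite.\<close>

lemma insert_range_infinite:
  fixes g :: "'i::infinite \<Rightarrow> 'b"
  obtains g' :: "'i \<Rightarrow> 'b" where "range g' = insert a (range g)"
proof -
  obtain i :: 'i where True by simp
  obtain b where b: "bij_betw b (UNIV :: 'i set) (UNIV - {i})"
    using infinite_imp_bij_betw[OF infinite_UNIV] by blast
  define g' where "g' x = (if x = i then a else g (inv_into UNIV b x))" for x
  have "g y \<in> range g'" for y
  proof -
    have "b y \<noteq> i" "inv_into UNIV b (b y) = y" using b by (auto simp: bij_betw_def)
    then show ?thesis by (metis g'_def rangeI)
  qed
  moreover have "a \<in> range g'" by (metis g'_def rangeI)
  moreover have "range g' \<subseteq> insert a (range g)" by (auto simp: g'_def)
  ultimately show thesis using that by blast
qed

context abelian_category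
begin

lemma retraction_ESSIPD:
  fixes g :: "'i \<Rightarrow> 'b"
  assumes "retraction_ESSIP TYPE('i) s C X" "F \<subseteq> range g" "\<And>c. c \<in> F \<Longrightarrow> \<exists>t. retract C X t c"
    "joint_kernel C X F j"
  shows "ess_in_retract s C X j"
  using assms(1)[unfolded retraction_ESSIP_def, rule_format, of F g j] assms(2-4) by blast

text \<open>The self-dual core: only arrows, retractions and joint kernels occur, so the statement
  can be instantiated at the opposite category.\<close>

lemma joint_kernel_ess_in_retract:
  fixes g :: "'i::infinite \<Rightarrow> 'b"
  assumes P: "retraction_ESSIP TYPE('i) s C P" and b: "biproduct C M N P i\<^sub>1 i\<^sub>2 p\<^sub>1 p\<^sub>2"
    and F: "F \<subseteq> range g" "F \<subseteq> Hom C M N" and k: "joint_kernel C M F k"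
  shows "ess_in_retract s C M k"
proof -
  note bR = biproduct_retract[OF b]
  note [simp] = b[unfolded biproduct_def Hom_def, simplified]
  have F' [simp]: "f \<in> Arr C" "Dom C f = M" "Cod C f = N" if "f \<in> F" for f
    using F that by (auto simp: Hom_def)
  have [simp]: "k \<in> Arr C" "Cod C k = M" using k by (auto simp: joint_kernel_def)
  \<comment> \<open>The kernel of \<open>S f\<close> is the graph of the negative of
    \<open>f\<close>, a complement of N in P; it meets M, the kernel of \<open>p\<^sub>2\<close>,
    exactly in the kernel of \<open>f\<close>.\<close>
  define S where "S f = Add C p\<^sub>2 (f \<cdot> p\<^sub>1)" for f
  have S: "S f \<in> Arr C" "Dom C (S f) = P" "Cod C (S f) = N" if "f \<in> F" for f
    using that by (simp_all add: S_def)
  have "range (S \<circ> g) = S ` range g" by auto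
  with insert_range_infinite[of p\<^sub>2 "S \<circ> g"] obtain g' :: "'i \<Rightarrow> 'b"
    where "range g' = insert p\<^sub>2 (S ` range g)" by metis
  then have "insert p\<^sub>2 (S ` F) \<subseteq> range g'" using F by auto
  \<comment> \<open>Since \<open>p\<^sub>2\<close> always belongs to the family, this also covers
    empty \<open>F\<close>, where the joint kernel is M itself.\<close>
  moreover have "joint_kernel C P (insert p\<^sub>2 (S ` F)) (i\<^sub>1 \<cdot> k)"
  proof (rule joint_kernel_biproduct[OF b k])
    fix x assume x [simp]: "x \<in> Arr C" "Cod C x = M"
    have "S f \<cdot> (i\<^sub>1 \<cdot> x) = f \<cdot> x" if f: "f \<in> F" for f
    proof -
      note [simp] = F'[OF f]
      have "p\<^sub>1 \<cdot> (i\<^sub>1 \<cdot> x) = x" "p\<^sub>2 \<cdot> (i\<^sub>1 \<cdot> x) = Zero C (Dom C x) N"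
        using Comp_reassoc[of p\<^sub>1 i\<^sub>1 "Ident C M" x] Comp_reassoc[of p\<^sub>2 i\<^sub>1 "Zero C M N" x] by simp_all
      then show ?thesis by (simp add: S_def)
    qed
    then show "(\<forall>f\<in>F. f \<cdot> x = Zero C (Dom C x) (Cod C f)) \<longleftrightarrow>
      (\<forall>e\<in>S ` F. e \<cdot> (i\<^sub>1 \<cdot> x) = Zero C (Dom C x) (Cod C e))"
      using S F' by auto
  qed (use S in auto)
  moreover have "retract C P i\<^sub>2 (S f)" if f: "f \<in> F" for f
  proof -
    note [simp] = F'[OF f]
    show ?thesis by (simp add: retract_def Hom_def S_def)
  qed
  with bR(2) have "\<And>c. c \<in> insert p\<^sub>2 (S ` F) \<Longrightarrow> \<exists>t. retract C P t c" by auto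
  ultimately have i1k: "ess_in_retract s C P (i\<^sub>1 \<cdot> k)"
    by (intro retraction_ESSIPD[OF P])
  note km = joint_kernel_monic[OF k] \<open>Cod C k = M\<close>
  show ?thesis
  proof (cases s)
    case True
    then show ?thesis using ess_in_retract_biproduct_invariant[OF b km] i1k by simp
  next
    case False
    obtain d q u where dq: "retract C P d q"
      and u: "u \<in> Hom C (Dom C (i\<^sub>1 \<cdot> k)) (Dom C d)" and du: "d \<cdot> u = i\<^sub>1 \<cdot> k" and ess: "ess C u"
      using i1k unfolding ess_in_retract_def by blast
    note [simp] = dq[unfolded retract_def Hom_def, simplified]
    define k\<^sub>1 where "k\<^sub>1 = Ker C (q \<cdot> i\<^sub>1)"
    have k\<^sub>1: "is_kernel C (q \<cdot> i\<^sub>1) k\<^sub>1" unfolding k\<^sub>1_def by (rule is_kernel_Ker) simp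
    have "joint_kernel C P {p\<^sub>2, q} (i\<^sub>1 \<cdot> k\<^sub>1)"
    proof (rule joint_kernel_biproduct[OF b])
      show "joint_kernel C M {q \<cdot> i\<^sub>1} k\<^sub>1" using k\<^sub>1 by (simp add: is_kernel_iff_joint)
    qed simp_all
    \<comment> \<open>Two insertions into the range of \<open>g\<close> make room for the two
      retractions in the index type.\<close>
    moreover obtain g'' :: "'i \<Rightarrow> 'b" where "{p\<^sub>2, q} \<subseteq> range g''"
    proof -
      obtain g\<^sub>1 :: "'i \<Rightarrow> 'b" where "range g\<^sub>1 = insert q (range g)" by (rule insert_range_infinite)
      moreover obtain g\<^sub>2 :: "'i \<Rightarrow> 'b" where "range g\<^sub>2 = insert p\<^sub>2 (range g\<^sub>1)"
        by (rule insert_range_infinite)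
      ultimately show thesis using that[of g\<^sub>2] by auto
    qed
    moreover have "\<And>c. c \<in> {p\<^sub>2, q} \<Longrightarrow> \<exists>t. retract C P t c" using bR dq by blast
    ultimately have "ess_in_retract s C P (i\<^sub>1 \<cdot> k\<^sub>1)" by (intro retraction_ESSIPD[OF P])
    then have "ess_in_retract False C P (i\<^sub>1 \<cdot> k\<^sub>1)" using False by simp
    then show ?thesis
      using ess_in_retract_biproduct[OF b km dq u du ess k\<^sub>1] False by simp
  qed
qed

end

section \<open>Intersections and essential subobjects\<close>

text \<open>Several arrows may share a kernel, and a kernel is only determined up to isomorphism.
  The link between the two sets is therefore a correspondence that covers both sides, not a
  function.\<close>

definition kernels_of :: "('o, 'm, 'x) ab_cat_scheme \<Rightarrow> 'm set \<Rightarrow> 'm set \<Rightarrow> bool" where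
  "kernels_of C F S \<longleftrightarrow> (\<forall>f\<in>F. \<exists>s\<in>S. is_kernel C f s) \<and> (\<forall>s\<in>S. \<exists>f\<in>F. is_kernel C f s)"

context preadditive_category
begin

lemma sub_leE:
  assumes "sub_le C k l"
  obtains u where "u \<in> Arr C" "Dom C u = Dom C k" "Cod C u = Dom C l" "l \<cdot> u = k"
  using assms by (auto simp: sub_le_def Hom_def)

text \<open>An arrow is killed by \<open>f\<close> exactly when it factors through a kernel of
  \<open>f\<close>.\<close>

lemma joint_kernel_is_intersection:
  assumes k: "joint_kernel C X F k" and S: "kernels_of C F S"
  shows "is_intersection C X S k"
  unfolding is_intersection_def
proof (intro conjI ballI allI impI)
  have [simp]: "k \<in> Arr C" "Cod C k = X" and F: "\<And>f. f \<in> F \<Longrightarrow> f \<in> Arr C" "\<And>f. f \<in> F \<Longrightarrow> Dom C f = X"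
    "\<And>f. f \<in> F \<Longrightarrow> f \<cdot> k = Zero C (Dom C k) (Cod C f)"
    using k by (auto simp: joint_kernel_def)
  show "subobject C X k" using joint_kernel_monic[OF k] by (simp add: subobject_def)
  show "sub_le C k s" if "s \<in> S" for s
  proof -
    obtain f where f: "f \<in> F" "is_kernel C f s" using S \<open>s \<in> S\<close> by (auto simp: kernels_of_def)
    show ?thesis by (rule is_kernel_lift[OF f(2), of k]) (use F f in \<open>auto simp: sub_le_def Hom_def\<close>)
  qed
  fix l assume l: "subobject C X l \<and> (\<forall>s\<in>S. sub_le C l s)"
  then have [simp]: "l \<in> Arr C" "Cod C l = X" by (auto simp: subobject_def)
  have "f \<cdot> l = Zero C (Dom C l) (Cod C f)" if f: "f \<in> F" for f
  proof -
    obtain s where s: "s \<in> S" "is_kernel C f s" using S f by (auto simp: kernels_of_def)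
    note sD = is_kernelD[OF s(2)]
    obtain u where [simp]: "u \<in> Arr C" "Dom C u = Dom C l" "Cod C u = Dom C s" and su: "s \<cdot> u = l"
      using l s by (auto elim: sub_leE)
    have "f \<cdot> (s \<cdot> u) = Zero C (Dom C s) (Cod C f) \<cdot> u"
      by (rule Comp_reassoc[OF sD(4)]) (use sD in auto)
    then show ?thesis using sD by (simp add: su)
  qed
  then obtain h where "h \<in> Arr C" "Dom C h = Dom C l" "Cod C h = Dom C k" "k \<cdot> h = l"
    using joint_kernel_lift[OF k, of l] by auto
  then show "sub_le C l k" by (auto simp: sub_le_def Hom_def)
qed

lemma joint_kernel_sub_eq:
  assumes j: "joint_kernel C X F j" and k: "monic C k" "sub_eq C j k"
  shows "joint_kernel C X F k"
proof -
  have [simp]: "j \<in> Arr C" "Cod C j = X" "k \<in> Arr C" and F: "\<And>f. f \<in> F \<Longrightarrow> f \<in> Arr C" "\<And>f. f \<in> F \<Longrightarrow> Dom C f = X"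
    "\<And>f. f \<in> F \<Longrightarrow> f \<cdot> j = Zero C (Dom C j) (Cod C f)"
    using j k by (auto simp: joint_kernel_def)
  obtain u where u [simp]: "u \<in> Arr C" "Dom C u = Dom C k" "Cod C u = Dom C j" and ju: "j \<cdot> u = k"
    using k by (auto simp: sub_eq_def elim: sub_leE)
  obtain v where v [simp]: "v \<in> Arr C" "Dom C v = Dom C j" "Cod C v = Dom C k" and kv: "k \<cdot> v = j"
    using k by (auto simp: sub_eq_def elim: sub_leE)
  have [simp]: "Cod C k = X" using ju[symmetric] by simp
  show ?thesis
  proof (rule joint_kernelI[OF k(1)])
    fix f assume f: "f \<in> F"
    have "f \<cdot> (j \<cdot> u) = Zero C (Dom C j) (Cod C f) \<cdot> u"
      by (rule Comp_reassoc) (use F f in simp_all)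
    then show "f \<in> Arr C \<and> Dom C f = X \<and> f \<cdot> k = Zero C (Dom C k) (Cod C f)" using F f by (simp add: ju)
  next
    fix g assume g [simp]: "g \<in> Arr C" "Cod C g = X"
      and g0: "\<And>f. f \<in> F \<Longrightarrow> f \<cdot> g = Zero C (Dom C g) (Cod C f)"
    obtain h where h [simp]: "h \<in> Arr C" "Dom C h = Dom C g" "Cod C h = Dom C j" and jh: "j \<cdot> h = g"
      using joint_kernel_lift[OF j g g0] by auto
    have "k \<cdot> (v \<cdot> h) = g" using Comp_reassoc[OF kv, of h] jh by simp
    then show "\<exists>h. h \<in> Hom C (Dom C g) (Dom C k) \<and> k \<cdot> h = g"
      by (intro exI[of _ "v \<cdot> h"]) (simp add: Hom_def)
  qed simp
qed

lemma joint_kernel_unique: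
  assumes "joint_kernel C X F j" "joint_kernel C X F k"
  shows "sub_le C j k"
proof -
  have "j \<in> Arr C" "Cod C j = X" "\<And>f. f \<in> F \<Longrightarrow> f \<cdot> j = Zero C (Dom C j) (Cod C f)"
    using assms(1) by (auto simp: joint_kernel_def)
  then show ?thesis
    by (rule joint_kernel_lift[OF assms(2)]) (auto simp: sub_le_def Hom_def)
qed

text \<open>A joint kernel witnesses that an intersection exists, so the choice in
  \<open>Intersection\<close> is meaningful; the representative chosen is equivalent to that joint
  kernel and inherits its universal property.\<close>

lemma joint_kernel_Intersection:
  assumes "joint_kernel C X F j" "kernels_of C F S"
  shows "joint_kernel C X F (Intersection C X S)"
proof -
  have j: "is_intersection C X S j" using assms by (rule joint_kernel_is_intersection)
  have i: "is_intersection C X S (Intersection C X S)"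
    unfolding Intersection_def by (rule someI) (rule j)
  have "monic C (Intersection C X S)" using i by (auto simp: is_intersection_def subobject_def)
  moreover have "sub_eq C j (Intersection C X S)" using i j by (auto simp: is_intersection_def sub_eq_def)
  ultimately show ?thesis by (rule joint_kernel_sub_eq[OF assms(1)])
qed

text \<open>Intersections and sums enter through arbitrary representatives, so the property must not
  depend on the representing monomorphism. The comparison arrow \<open>v\<close> is inverted by
  \<open>w\<close>, which transports test arrows for \<open>u\<close> to test arrows for
  \<open>u \<cdot> v\<close>.\<close>

lemma ess_in_retract_sub_eq:
  assumes k: "ess_in_retract s C X k" and j: "monic C j" "sub_eq C j k"
  shows "ess_in_retract s C X j"
proof -
  obtain d r u where dr: "retract C X d r" and inv: "s \<longrightarrow> invariant_retract C X d r"
    and u: "u \<in> Hom C (Dom C k) (Dom C d)" and du: "d \<cdot> u = k" and ess: "ess C u"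
    using k unfolding ess_in_retract_def by blast
  note [simp] = dr[unfolded retract_def Hom_def, simplified] u[unfolded Hom_def, simplified]
  have [simp]: "k \<in> Arr C" using du[symmetric] by simp
  have [simp]: "j \<in> Arr C" using j by simp
  obtain v where v [simp]: "v \<in> Arr C" "Dom C v = Dom C j" "Cod C v = Dom C k" and kv: "k \<cdot> v = j"
    using j by (auto simp: sub_eq_def elim: sub_leE)
  obtain w where w [simp]: "w \<in> Arr C" "Dom C w = Dom C k" "Cod C w = Dom C j" and jw: "j \<cdot> w = k"
    using j by (auto simp: sub_eq_def elim: sub_leE)
  have duv: "d \<cdot> (u \<cdot> v) = j" using Comp_reassoc[OF du, of v] kv by simp
  have "monic C k" unfolding du[symmetric]
    by (rule monic_comp) (use ess_monic[OF ess] retract_monic[OF dr] in simp_all)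
  then have vw: "v \<cdot> w = Ident C (Dom C k)"
    by (rule monicD) (use Comp_reassoc[OF kv, of w] jw in simp_all)
  have "ess C (u \<cdot> v)"
  proof (rule essI)
    show "monic C (u \<cdot> v)" by (rule monic_comp_left[of d]) (use duv j in simp_all)
    fix c assume c: "monic C c" and [simp]: "Cod C c = Cod C (u \<cdot> v)"
      and *: "\<And>g h. g \<in> Arr C \<Longrightarrow> h \<in> Arr C \<Longrightarrow> Dom C h = Dom C g \<Longrightarrow> Cod C g = Dom C (u \<cdot> v)
        \<Longrightarrow> Cod C h = Dom C c \<Longrightarrow> (u \<cdot> v) \<cdot> g = c \<cdot> h \<Longrightarrow> g = Zero C (Dom C g) (Dom C (u \<cdot> v))"
    have [simp]: "c \<in> Arr C" using c by simp
    show "c = Zero C (Dom C c) (Cod C c)"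
    proof (rule essD[OF ess c])
      fix g h
      assume gh [simp]: "g \<in> Arr C" "h \<in> Arr C" "Dom C h = Dom C g" "Cod C g = Dom C u" "Cod C h = Dom C c"
        and ug: "u \<cdot> g = c \<cdot> h"
      have [simp]: "Cod C g = Dom C k" by simp
      have vwg: "v \<cdot> (w \<cdot> g) = g" using Comp_reassoc[OF vw, of g] by simp
      then have "w \<cdot> g = Zero C (Dom C g) (Dom C j)" using *[of "w \<cdot> g" h] ug by simp
      then show "g = Zero C (Dom C g) (Dom C u)" using vwg by simp
    qed simp
  qed
  then show ?thesis unfolding ess_in_retract_def using dr inv duv
    by (intro exI[of _ d] exI[of _ r] exI[of _ "u \<cdot> v"]) (simp add: Hom_def)
qed

text \<open>If \<open>c\<close> is zero, every arrow into its domain is killed by \<open>c\<close>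
  and hence zero. This includes the identity of the domain, which settles the arrows out of it as
  well.\<close>

lemma monic_zero_object:
  assumes c: "monic C c"
  shows "zero_object C (Dom C c) \<longleftrightarrow> c = Zero C (Dom C c) (Cod C c)"
proof
  have [simp]: "c \<in> Arr C" using c by simp
  have mem: "c \<in> Hom C (Dom C c) (Cod C c)" "Zero C (Dom C c) (Cod C c) \<in> Hom C (Dom C c) (Cod C c)"
    by (simp_all add: Hom_def)
  show "c = Zero C (Dom C c) (Cod C c)" if "zero_object C (Dom C c)"
  proof -
    have "\<exists>!f. f \<in> Hom C (Dom C c) (Cod C c)" using that by (simp add: zero_object_def)
    with mem show ?thesis by blast
  qed
  assume c0: "c = Zero C (Dom C c) (Cod C c)"
  have z: "f = Zero C (Dom C f) (Dom C c)" if [simp]: "f \<in> Arr C" "Cod C f = Dom C c" for f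
  proof -
    have "c \<cdot> f = Zero C (Dom C f) (Cod C c)" by (subst c0) simp
    then show ?thesis using monic_Zero[OF c, of f] by simp
  qed
  show "zero_object C (Dom C c)"
    unfolding zero_object_def
  proof (intro conjI ballI)
    fix X assume [simp]: "X \<in> Obj C"
    show "\<exists>!f. f \<in> Hom C X (Dom C c)"
      by (rule ex1I[of _ "Zero C X (Dom C c)"]) (use z in \<open>auto simp: Hom_def\<close>)
    have "f = Zero C (Dom C c) X" if "f \<in> Hom C (Dom C c) X" for f
    proof -
      have [simp]: "f \<in> Arr C" "Dom C f = Dom C c" "Cod C f = X" using that by (auto simp: Hom_def)
      have "f \<cdot> Ident C (Dom C c) = Zero C (Dom C c) X"
        by (subst z[of "Ident C (Dom C c)"]) simp_all
      then show ?thesis by simp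
    qed
    then show "\<exists>!f. f \<in> Hom C (Dom C c) X"
      by (intro ex1I[of _ "Zero C (Dom C c) X"]) (auto simp: Hom_def)
  qed simp
qed

end

context abelian_category
begin

lemma ex_joint_kernel_pair:
  assumes "f \<in> Arr C" "g \<in> Arr C" "Dom C f = X" "Dom C g = X"
  obtains k where "joint_kernel C X {f, g} k"
proof -
  note [simp] = assms
  define k where "k = Ker C f"
  have kk: "is_kernel C f k" unfolding k_def by (rule is_kernel_Ker) simp
  note k = is_kernelD[OF kk]
  have [simp]: "k \<in> Arr C" "Cod C k = X" using k by auto
  define l where "l = Ker C (g \<cdot> k)"
  have ll: "is_kernel C (g \<cdot> k) l" unfolding l_def by (rule is_kernel_Ker) simp
  note l = is_kernelD[OF ll]
  have [simp]: "l \<in> Arr C" "Cod C l = Dom C k" using l by auto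
  have "joint_kernel C X {f, g} (k \<cdot> l)"
  proof (rule joint_kernelI)
    show "monic C (k \<cdot> l)" using l(1) k(1) by (rule monic_comp) simp
    have "f \<cdot> (k \<cdot> l) = Zero C (Dom C l) (Cod C f)" by (subst Comp_reassoc[OF k(4)]) simp_all
    moreover have "g \<cdot> (k \<cdot> l) = Zero C (Dom C l) (Cod C g)" using l(4) by simp
    ultimately show "h \<in> Arr C \<and> Dom C h = X \<and> h \<cdot> (k \<cdot> l) = Zero C (Dom C (k \<cdot> l)) (Cod C h)"
      if "h \<in> {f, g}" for h using that by auto
    fix x assume [simp]: "x \<in> Arr C" "Cod C x = X"
      and x: "\<And>h. h \<in> {f, g} \<Longrightarrow> h \<cdot> x = Zero C (Dom C x) (Cod C h)"
    obtain y where [simp]: "y \<in> Arr C" "Dom C y = Dom C x" "Cod C y = Dom C k" and y: "k \<cdot> y = x"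
      by (rule is_kernel_lift[OF kk, of x]) (use x[of f] in simp_all)
    obtain z where [simp]: "z \<in> Arr C" "Dom C z = Dom C y" "Cod C z = Dom C l" and z: "l \<cdot> z = y"
      by (rule is_kernel_lift[OF ll, of y]) (use x[of g] in \<open>simp_all add: y\<close>)
    show "\<exists>h. h \<in> Hom C (Dom C x) (Dom C (k \<cdot> l)) \<and> k \<cdot> l \<cdot> h = x"
      by (rule exI[of _ z]) (simp add: Hom_def z y)
  qed simp
  then show thesis by (rule that)
qed

text \<open>\<open>a\<close> and \<open>c\<close> are kernels of their cokernels, so the
  intersection is the joint kernel of these two. A pair of arrows with
  \<open>a \<cdot> g = c \<cdot> h\<close> is an arrow into it.\<close>

lemma Intersection_zero_iff:
  assumes a: "subobject C B a" and c: "subobject C B c"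
  shows "zero_object C (Dom C (Intersection C B {a, c})) \<longleftrightarrow>
    (\<forall>W\<in>Obj C. \<forall>g\<in>Hom C W (Dom C a). \<forall>h\<in>Hom C W (Dom C c). a \<cdot> g = c \<cdot> h \<longrightarrow> g = Zero C W (Dom C a))"
    (is "?L \<longleftrightarrow> ?R")
proof -
  have ac: "monic C a" "monic C c" and [simp]: "Cod C a = B" "Cod C c = B"
    using a c by (auto simp: subobject_def)
  then have [simp]: "a \<in> Arr C" "c \<in> Arr C" by auto
  have [simp]: "B \<in> Obj C" using Cod_Obj[of a] by simp
  define f g where "f = Coker C a" and "g = Coker C c"
  have fa: "is_kernel C f a" and gc: "is_kernel C g c"
    unfolding f_def g_def by (auto intro!: monic_kernel_of_cokernel is_cokernel_Coker ac)
  note fD = is_kernelD[OF fa] and gD = is_kernelD[OF gc]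
  have [simp]: "f \<in> Arr C" "Dom C f = B" "g \<in> Arr C" "Dom C g = B" using fD gD by auto
  obtain k where k: "joint_kernel C B {f, g} k" by (rule ex_joint_kernel_pair[of f g]) auto
  define J where "J = Intersection C B {a, c}"
  have "kernels_of C {f, g} {a, c}" using fa gc by (auto simp: kernels_of_def)
  with k have J: "joint_kernel C B {f, g} J" unfolding J_def by (rule joint_kernel_Intersection)
  have Jm: "monic C J" by (rule joint_kernel_monic[OF J])
  have [simp]: "J \<in> Arr C" "Cod C J = B" and fJ: "f \<cdot> J = Zero C (Dom C J) (Cod C f)"
    and gJ: "g \<cdot> J = Zero C (Dom C J) (Cod C g)" using J by (auto simp: joint_kernel_def)
  have "J = Zero C (Dom C J) (Cod C J) \<longleftrightarrow> ?R"
  proof (intro iffI ballI impI)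
    fix W x y assume J0: "J = Zero C (Dom C J) (Cod C J)" and "W \<in> Obj C"
      and xy: "x \<in> Hom C W (Dom C a)" "y \<in> Hom C W (Dom C c)" and e: "a \<cdot> x = c \<cdot> y"
    note [simp] = xy[unfolded Hom_def, simplified] \<open>W \<in> Obj C\<close>
    have "f \<cdot> (a \<cdot> x) = Zero C W (Cod C f)" by (subst Comp_reassoc[OF fD(4)]) simp_all
    moreover have "g \<cdot> (a \<cdot> x) = Zero C W (Cod C g)" unfolding e by (subst Comp_reassoc[OF gD(4)]) simp_all
    ultimately obtain h where [simp]: "h \<in> Arr C" "Dom C h = W" "Cod C h = Dom C J" and h: "J \<cdot> h = a \<cdot> x"
      using joint_kernel_lift[OF J, of "a \<cdot> x"] by auto
    have "J \<cdot> h = Zero C W B" by (subst J0) simp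
    then show "x = Zero C W (Dom C a)" using monic_Zero[OF ac(1), of x] h by simp
  next
    assume R: ?R
    obtain x where [simp]: "x \<in> Arr C" "Dom C x = Dom C J" "Cod C x = Dom C a" and x: "a \<cdot> x = J"
      by (rule is_kernel_lift[OF fa, of J]) (use fJ in simp_all)
    obtain y where [simp]: "y \<in> Arr C" "Dom C y = Dom C J" "Cod C y = Dom C c" and y: "c \<cdot> y = J"
      by (rule is_kernel_lift[OF gc, of J]) (use gJ in simp_all)
    have "x = Zero C (Dom C J) (Dom C a)"
      using R[rule_format, of "Dom C J" x y] x y by (simp add: Hom_def)
    then show "J = Zero C (Dom C J) (Cod C J)" using x by simp
  qed
  then show ?thesis using monic_zero_object[OF Jm] by (simp add: J_def)
qed

lemma essential_iff_ess: "essential C B a \<longleftrightarrow> ess C a \<and> Cod C a = B"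
proof (cases "subobject C B a")
  case True
  then have a: "monic C a" "Cod C a = B" by (auto simp: subobject_def)
  have "(\<forall>c. subobject C B c \<and> zero_object C (Dom C (Intersection C B {a, c})) \<longrightarrow> zero_object C (Dom C c)) \<longleftrightarrow>
    (\<forall>c. subobject C B c \<and> (\<forall>W\<in>Obj C. \<forall>g\<in>Hom C W (Dom C a). \<forall>h\<in>Hom C W (Dom C c).
      a \<cdot> g = c \<cdot> h \<longrightarrow> g = Zero C W (Dom C a)) \<longrightarrow> c = Zero C (Dom C c) (Cod C c))"
    using Intersection_zero_iff[OF True] monic_zero_object by (auto simp: subobject_def)
  also have "\<dots> \<longleftrightarrow> ess C a"
    using a by (auto simp: ess_def subobject_def Hom_def)
  finally show ?thesis using a True by (simp add: essential_def)
next
  case False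
  then show ?thesis by (auto simp: essential_def subobject_def ess_def)
qed

section \<open>Summands and full invariance through retractions\<close>

lemma direct_summand_iff: "direct_summand C X d \<longleftrightarrow> (\<exists>r. retract C X d r)"
proof
  show "\<exists>r. retract C X d r" if "direct_summand C X d"
    using that biproduct_retract unfolding direct_summand_def by blast
  show "direct_summand C X d" if ex: "\<exists>r. retract C X d r"
  proof -
    obtain r where r: "retract C X d r" using ex by blast
    then have "r \<in> Arr C" by (simp add: retract_def Hom_def)
    then obtain \<delta> where "biproduct C (Dom C d) (Dom C (Ker C r)) X d (Ker C r) r \<delta>"
      using retract_biproduct[OF r is_kernel_Ker] by blast
    moreover have "subobject C X d"
      using retract_monic[OF r] r by (simp add: subobject_def retract_def Hom_def)
    ultimately show ?thesis unfolding direct_summand_def by blast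
  qed
qed

lemma fully_invariant_iff:
  assumes dr: "retract C X d r"
  shows "fully_invariant C X d \<longleftrightarrow> invariant_retract C X d r"
proof -
  note [simp] = dr[unfolded retract_def Hom_def, simplified]
  have "(\<exists>a\<in>Hom C (Dom C d) (Dom C d). h \<cdot> d = d \<cdot> a) \<longleftrightarrow> d \<cdot> (r \<cdot> (h \<cdot> d)) = h \<cdot> d"
    if "h \<in> Hom C X X" for h
  proof
    note [simp] = that[unfolded Hom_def, simplified]
    show "d \<cdot> (r \<cdot> (h \<cdot> d)) = h \<cdot> d" if ex: "\<exists>a\<in>Hom C (Dom C d) (Dom C d). h \<cdot> d = d \<cdot> a"
    proof -
      obtain a where a: "a \<in> Hom C (Dom C d) (Dom C d)" and e: "h \<cdot> d = d \<cdot> a" using ex by blast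
      note [simp] = a[unfolded Hom_def, simplified]
      show ?thesis unfolding e using Comp_reassoc[of r d "Ident C (Dom C d)" a] by simp
    qed
    assume "d \<cdot> (r \<cdot> (h \<cdot> d)) = h \<cdot> d"
    then show "\<exists>a\<in>Hom C (Dom C d) (Dom C d). h \<cdot> d = d \<cdot> a"
      by (intro bexI[of _ "r \<cdot> (h \<cdot> d)"]) (simp_all add: Hom_def)
  qed
  moreover have "subobject C X d" using retract_monic[OF dr] by (simp add: subobject_def)
  ultimately show ?thesis by (auto simp: fully_invariant_def invariant_retract_def)
qed

lemma ess_in_retract_iff:
  "(\<exists>d. direct_summand C X d \<and> (s \<longrightarrow> fully_invariant C X d) \<and> essential_in C k d) \<longleftrightarrow>
    ess_in_retract s C X k"
proof -
  have "(direct_summand C X d \<and> (s \<longrightarrow> fully_invariant C X d) \<and> essential_in C k d) \<longleftrightarrow>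
    (\<exists>r u. retract C X d r \<and> (s \<longrightarrow> invariant_retract C X d r) \<and>
       u \<in> Hom C (Dom C k) (Dom C d) \<and> d \<cdot> u = k \<and> ess C u)" for d
  proof -
    have "essential_in C k d \<longleftrightarrow> (\<exists>u. u \<in> Hom C (Dom C k) (Dom C d) \<and> d \<cdot> u = k \<and> ess C u)"
      by (auto simp: essential_in_def essential_iff_ess Hom_def)
    then show ?thesis unfolding direct_summand_iff using fully_invariant_iff by blast
  qed
  then show ?thesis by (simp only: ess_in_retract_def)
qed

lemma ESSIP_imp_retraction_ESSIP:
  assumes "if s then strictly_ESSIP TYPE('i) C X else ESSIP TYPE('i) C X"
  shows "retraction_ESSIP TYPE('i) s C X"
  unfolding retraction_ESSIP_def
proof (intro allI impI)
  fix g :: "'i \<Rightarrow> 'b" and F j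
  assume *: "F \<subseteq> range g \<and> (\<forall>c\<in>F. \<exists>t. retract C X t c) \<and> joint_kernel C X F j"
  then have j: "joint_kernel C X F j" and F: "F \<subseteq> range g" by auto
  \<comment> \<open>The set \<open>F\<close> becomes an indexed family again, with those indices
    whose arrow lies in \<open>F\<close>; the summands are the kernels of these retractions, that
    is, complements of their sections.\<close>
  define I where "I = {i. g i \<in> F}"
  define f where "f i = Ker C (g i)" for i
  have gI: "g ` I = F" using F by (auto simp: I_def)
  have "direct_summand C X (f i)" if "i \<in> I" for i
  proof -
    have "g i \<in> F" using that by (simp add: I_def)
    with * obtain t where t: "retract C X t (g i)" by blast
    then have "is_kernel C (g i) (f i)"
      unfolding f_def by (intro is_kernel_Ker) (simp add: retract_def Hom_def)
    then obtain \<delta> where "biproduct C (Dom C t) (Dom C (f i)) X t (f i) (g i) \<delta>"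
      using retract_biproduct[OF t] by blast
    then show ?thesis using biproduct_retract direct_summand_iff by blast
  qed
  then have "\<exists>d. direct_summand C X d \<and> (s \<longrightarrow> fully_invariant C X d) \<and>
      essential_in C (Intersection C X (f ` I)) d"
    using assms by (auto simp: strictly_ESSIP_def ESSIP_def split: if_splits)
  then have e: "ess_in_retract s C X (Intersection C X (f ` I))" by (simp add: ess_in_retract_iff)
  have "f i = Ker C (g i)" "is_kernel C (g i) (f i)" if "i \<in> I" for i
    using that j is_kernel_Ker by (auto simp: I_def joint_kernel_def f_def)
  then have "kernels_of C F (f ` I)" unfolding gI[symmetric] kernels_of_def by blast
  with j have i: "joint_kernel C X F (Intersection C X (f ` I))" by (rule joint_kernel_Intersection)
  show "ess_in_retract s C X j"
    by (rule ess_in_retract_sub_eq[OF e joint_kernel_monic[OF j]])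
      (use joint_kernel_unique i j in \<open>auto simp: sub_eq_def\<close>)
qed

text \<open>The joint kernel is the kernel of the arrow \<open>h\<close> into the product of the
  codomains. This is where the products of an AB3* category enter.\<close>

lemma ex_joint_kernel:
  fixes g :: "'i \<Rightarrow> 'b"
  assumes "AB3_star TYPE('i) C" and X: "X \<in> Obj C" and F: "\<And>i. i \<in> I \<Longrightarrow> g i \<in> Arr C \<and> Dom C (g i) = X"
  obtains k where "joint_kernel C X (g ` I) k"
proof -
  have "\<forall>i\<in>I. Cod C (g i) \<in> Obj C" using F by simp
  then obtain P p where p: "is_product C I (\<lambda>i. Cod C (g i)) P p"
    using assms(1)[unfolded AB3_star_def, rule_format, of I "\<lambda>i. Cod C (g i)"] by blast
  have "\<exists>h. h \<in> Hom C X P \<and> (\<forall>i \<in> I. p i \<cdot> h = g i)"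
    using p X F Hom_arr unfolding is_product_def by metis
  then obtain h where h: "h \<in> Hom C X P" and ph: "\<And>i. i \<in> I \<Longrightarrow> p i \<cdot> h = g i" by blast
  note [simp] = h[unfolded Hom_def, simplified]
  have pi: "p i \<in> Arr C" "Dom C (p i) = P" "Cod C (p i) = Cod C (g i)" if "i \<in> I" for i
    using p that by (auto simp: is_product_def Hom_def)
  have [simp]: "P \<in> Obj C" using p by (simp add: is_product_def)
  define k where "k = Ker C h"
  have kk: "is_kernel C h k" unfolding k_def by (rule is_kernel_Ker) simp
  note k = is_kernelD[OF kk]
  have [simp]: "k \<in> Arr C" "Cod C k = X" using k by auto
  have "joint_kernel C X (g ` I) k"
  proof (rule joint_kernelI[OF k(1)])
    fix f assume "f \<in> g ` I"
    then obtain i where i: "i \<in> I" "f = g i" by auto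
    have "(p i \<cdot> h) \<cdot> k = Zero C (Dom C k) (Cod C (g i))" using i pi k(4) by simp
    then show "f \<in> Arr C \<and> Dom C f = X \<and> f \<cdot> k = Zero C (Dom C k) (Cod C f)"
      using i F by (simp add: ph)
  next
    fix x assume [simp]: "x \<in> Arr C" "Cod C x = X"
      and x: "\<And>f. f \<in> g ` I \<Longrightarrow> f \<cdot> x = Zero C (Dom C x) (Cod C f)"
    have "\<forall>i\<in>I. Zero C (Dom C x) (Cod C (g i)) \<in> Hom C (Dom C x) (Cod C (g i))"
      using F by (simp add: Hom_def)
    \<comment> \<open>Uniqueness in the product identifies \<open>h \<cdot> x\<close> with the zero
      arrow, as their components agree.\<close>
    then have u: "\<exists>!y. y \<in> Hom C (Dom C x) P \<and> (\<forall>i\<in>I. p i \<cdot> y = Zero C (Dom C x) (Cod C (g i)))"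
      using p unfolding is_product_def by simp
    have "p i \<cdot> (h \<cdot> x) = Zero C (Dom C x) (Cod C (g i))" if "i \<in> I" for i
      using Comp_reassoc[OF ph, of i x] pi x that by simp
    moreover have "p i \<cdot> Zero C (Dom C x) P = Zero C (Dom C x) (Cod C (g i))" if "i \<in> I" for i
      using pi that by simp
    moreover have "h \<cdot> x \<in> Hom C (Dom C x) P" "Zero C (Dom C x) P \<in> Hom C (Dom C x) P"
      by (simp_all add: Hom_def)
    ultimately have "h \<cdot> x = Zero C (Dom C x) P" using u by blast
    then obtain y where "y \<in> Arr C" "Dom C y = Dom C x" "Cod C y = Dom C k" "k \<cdot> y = x"
      using is_kernel_lift[OF kk, of x] by auto
    then show "\<exists>h. h \<in> Hom C (Dom C x) (Dom C k) \<and> k \<cdot> h = x" by (auto simp: Hom_def)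
  qed simp
  then show thesis by (rule that)
qed

lemma family_ess_in_retract:
  fixes f :: "'i::infinite \<Rightarrow> 'b"
  assumes "AB3_star TYPE('i) C" "retraction_ESSIP TYPE('i) s C P" "biproduct C M N P i\<^sub>1 i\<^sub>2 p\<^sub>1 p\<^sub>2"
    and f: "\<And>i. i \<in> I \<Longrightarrow> f i \<in> Hom C M N"
  obtains k where "joint_kernel C M (f ` I) k"
    "\<And>k. joint_kernel C M (f ` I) k \<Longrightarrow> ess_in_retract s C M k"
proof -
  have M: "M \<in> Obj C" using assms(3) by (simp add: biproduct_def)
  obtain k where k: "joint_kernel C M (f ` I) k"
    by (rule ex_joint_kernel[OF assms(1) M, of I f]) (use f in \<open>auto simp: Hom_def\<close>)
  have "f ` I \<subseteq> range f" "f ` I \<subseteq> Hom C M N" using f by auto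
  then show thesis using k by (intro that joint_kernel_ess_in_retract[OF assms(2,3)])
qed

lemma ESSIP_biproduct_CS_Baer:
  fixes s :: bool
  assumes "AB3_star TYPE('i::infinite) C" "biproduct C M N P i\<^sub>1 i\<^sub>2 p\<^sub>1 p\<^sub>2"
    and "if s then strictly_ESSIP TYPE('i) C P else ESSIP TYPE('i) C P"
  shows "if s then strongly_CS_Baer TYPE('i) C M N else CS_Baer TYPE('i) C M N"
proof -
  have "\<exists>d. direct_summand C M d \<and> (s \<longrightarrow> fully_invariant C M d) \<and>
      essential_in C (Intersection C M ((\<lambda>i. Ker C (f i)) ` I)) d"
    if f: "\<forall>i\<in>I. f i \<in> Hom C M N" for I and f :: "'i \<Rightarrow> 'b"
  proof -
    obtain k where k: "joint_kernel C M (f ` I) k"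
      and e: "\<And>k. joint_kernel C M (f ` I) k \<Longrightarrow> ess_in_retract s C M k"
      using family_ess_in_retract[OF assms(1) ESSIP_imp_retraction_ESSIP[OF assms(3)] assms(2)] f by blast
    have "\<And>i. i \<in> I \<Longrightarrow> is_kernel C (f i) (Ker C (f i))" using f is_kernel_Ker by (auto simp: Hom_def)
    then have "kernels_of C (f ` I) ((\<lambda>i. Ker C (f i)) ` I)" by (auto simp: kernels_of_def)
    with k show ?thesis unfolding ess_in_retract_iff by (intro e joint_kernel_Intersection)
  qed
  then show ?thesis by (auto simp: strongly_CS_Baer_def CS_Baer_def)
qed

end

section \<open>The opposite category\<close>

text \<open>The record type is unchanged, so every fact of the locale can be instantiated at
  \<open>op_cat C\<close>. \<open>Zero\<close> takes domain and codomain as arguments, which have to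
  be exchanged; \<open>Add\<close> needs no change.\<close>

definition op_cat :: "('o, 'm, 'x) ab_cat_scheme \<Rightarrow> ('o, 'm, 'x) ab_cat_scheme" where
  "op_cat C = C\<lparr>Dom := Cod C, Cod := Dom C, Comp := \<lambda>g f. f \<cdot>\<^bsub>C\<^esub> g, Zero := \<lambda>X Y. Zero C Y X\<rparr>"

lemma op_cat_simps [simp]:
  "Obj (op_cat C) = Obj C" "Arr (op_cat C) = Arr C" "Dom (op_cat C) = Cod C" "Cod (op_cat C) = Dom C"
  "Ident (op_cat C) = Ident C" "g \<cdot>\<^bsub>op_cat C\<^esub> f = f \<cdot>\<^bsub>C\<^esub> g" "Add (op_cat C) = Add C"
  "Zero (op_cat C) X Y = Zero C Y X"
  by (simp_all add: op_cat_def)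

lemma Hom_op [simp]: "Hom (op_cat C) X Y = Hom C Y X"
  by (auto simp: Hom_def)

lemma op_cat_notions [simp]:
  "monic (op_cat C) f \<longleftrightarrow> epic C f" "epic (op_cat C) f \<longleftrightarrow> monic C f"
  "is_kernel (op_cat C) f k \<longleftrightarrow> is_cokernel C f k" "is_cokernel (op_cat C) f k \<longleftrightarrow> is_kernel C f k"
  "zero_object (op_cat C) Z \<longleftrightarrow> zero_object C Z" "hom_group (op_cat C) X Y = hom_group C Y X"
  "AB3_star T (op_cat C) \<longleftrightarrow> AB3 T C"
  by (auto simp: monic_def epic_def is_kernel_def is_cokernel_def zero_object_def hom_group_def
      AB3_star_def AB3_def is_product_def is_coproduct_def)

lemma biproduct_op [simp]:
  "biproduct (op_cat C) A B P i\<^sub>1 i\<^sub>2 p\<^sub>1 p\<^sub>2 \<longleftrightarrow> biproduct C A B P p\<^sub>1 p\<^sub>2 i\<^sub>1 i\<^sub>2"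
  by (auto simp: biproduct_def)

lemma retract_op [simp]: "retract (op_cat C) X d r \<longleftrightarrow> retract C X r d"
  by (auto simp: retract_def Hom_def)

lemma joint_kernel_op:
  "joint_kernel (op_cat C) X F k \<longleftrightarrow> k \<in> Arr C \<and> Dom C k = X \<and>
    (\<forall>f \<in> F. f \<in> Arr C \<and> Cod C f = X \<and> k \<cdot>\<^bsub>C\<^esub> f = Zero C (Dom C f) (Cod C k)) \<and>
    (\<forall>Z \<in> Obj C. \<forall>g \<in> Hom C X Z. (\<forall>f \<in> F. g \<cdot>\<^bsub>C\<^esub> f = Zero C (Dom C f) Z) \<longrightarrow>
       (\<exists>!h. h \<in> Hom C (Cod C k) Z \<and> h \<cdot>\<^bsub>C\<^esub> k = g))"
  by (simp add: joint_kernel_def)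

lemma (in abelian_category) abelian_category_op: "abelian_category (op_cat C)"
proof -
  have "category (op_cat C)"
    by unfold_locales (auto simp: Comp_Hom Comp_Id Id_Comp Comp_assoc Id_Hom)
  moreover have "preadditive_category_axioms (op_cat C)"
    by (auto simp: preadditive_category_axioms_def Hom_comm_group Comp_Add Add_Comp)
  moreover have "abelian_category_axioms (op_cat C)"
  proof
    fix A B assume "A \<in> Obj (op_cat C)" "B \<in> Obj (op_cat C)"
    then obtain P i\<^sub>1 i\<^sub>2 p\<^sub>1 p\<^sub>2 where "biproduct C A B P i\<^sub>1 i\<^sub>2 p\<^sub>1 p\<^sub>2" using ex_biproduct[of A B] by auto
    then show "\<exists>P i\<^sub>1 i\<^sub>2 p\<^sub>1 p\<^sub>2. biproduct (op_cat C) A B P i\<^sub>1 i\<^sub>2 p\<^sub>1 p\<^sub>2"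
      unfolding biproduct_op by blast
  qed (simp_all add: ex_zero_object ex_kernel ex_cokernel monic_normal epic_normal)
  ultimately show ?thesis
    by (simp add: abelian_category_def preadditive_category_def)
qed

text \<open>\<open>v\<close> embeds \<open>d'\<close> into \<open>d\<close> and carries
  \<open>u'\<close> to \<open>u\<close>, so a subobject meeting \<open>u'\<close> trivially is
  carried to one meeting \<open>u\<close> trivially. In the opposite category this replaces a split
  epimorphism by the chosen cokernel of its kernel.\<close>

lemma (in preadditive_category) ess_retract_unique:
  assumes d: "retract C X d r" "d \<cdot> u = k" "ess C u" "u \<in> Hom C (Dom C k) (Dom C d)"
    and d': "retract C X d' r'" "d' \<cdot> u' = k" "u' \<in> Hom C (Dom C k) (Dom C d')" and eq: "sub_le C d' d"
  shows "ess C u'"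
proof (rule essI)
  note [simp] = d(1)[unfolded retract_def Hom_def, simplified] d'(1)[unfolded retract_def Hom_def, simplified]
    d(4)[unfolded Hom_def, simplified] d'(3)[unfolded Hom_def, simplified]
  have [simp]: "k \<in> Arr C" using d(2)[symmetric] by simp
  note dm = retract_monic[OF d(1)] retract_monic[OF d'(1)]
  obtain v where [simp]: "v \<in> Arr C" "Dom C v = Dom C d'" "Cod C v = Dom C d" and dv: "d \<cdot> v = d'"
    using eq by (rule sub_leE)
  have vm: "monic C v" by (rule monic_comp_left[of d]) (use dv dm in simp_all)
  have "d \<cdot> (v \<cdot> u') = d \<cdot> u" using Comp_reassoc[OF dv, of u'] d d' by simp
  then have vu: "v \<cdot> u' = u" by (rule monicD[OF dm(1)]) simp_all
  show "monic C u'" by (rule monic_comp_left[of v]) (use vu ess_monic[OF d(3)] in simp_all)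
  fix c assume c: "monic C c" and [simp]: "Cod C c = Cod C u'"
    and *: "\<And>g h. g \<in> Arr C \<Longrightarrow> h \<in> Arr C \<Longrightarrow> Dom C h = Dom C g \<Longrightarrow> Cod C g = Dom C u' \<Longrightarrow> Cod C h = Dom C c
        \<Longrightarrow> u' \<cdot> g = c \<cdot> h \<Longrightarrow> g = Zero C (Dom C g) (Dom C u')"
  have [simp]: "c \<in> Arr C" using c by simp
  have "v \<cdot> c = Zero C (Dom C (v \<cdot> c)) (Cod C (v \<cdot> c))"
  proof (rule essD[OF d(3)])
    show "monic C (v \<cdot> c)" using c vm by (rule monic_comp) simp
    fix g h assume gh [simp]: "g \<in> Arr C" "h \<in> Arr C" "Dom C h = Dom C g" "Cod C g = Dom C u" "Cod C h = Dom C (v \<cdot> c)"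
      and e: "u \<cdot> g = (v \<cdot> c) \<cdot> h"
    have [simp]: "Cod C h = Dom C c" by simp
    have "v \<cdot> (u' \<cdot> g) = v \<cdot> (c \<cdot> h)" using Comp_reassoc[OF vu, of g] e by simp
    then have "u' \<cdot> g = c \<cdot> h" by (rule monicD[OF vm]) simp_all
    then show "g = Zero C (Dom C g) (Dom C u)" using *[of g h] by simp
  qed simp
  then show "c = Zero C (Dom C c) (Cod C c)" using monic_Zero[OF vm, of c] by simp
qed

section \<open>Sums of subobjects as kernels of joint cokernels\<close>

context abelian_category
begin

lemma sub_le_IdentI: "subobject C X k \<Longrightarrow> sub_le C k (Ident C X)"
  unfolding sub_le_def by (rule bexI[of _ k]) (auto simp: subobject_def Hom_def)

lemma Ident_sub_le_kernel:
  assumes k: "is_kernel C y k"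
  shows "sub_le C (Ident C (Dom C y)) k \<longleftrightarrow> y = Zero C (Dom C y) (Cod C y)"
proof
  note kD = is_kernelD[OF k]
  note [simp] = kD(2)
  have [simp]: "k \<in> Arr C" "Cod C k = Dom C y" using kD by auto
  show "y = Zero C (Dom C y) (Cod C y)" if le: "sub_le C (Ident C (Dom C y)) k"
  proof -
    obtain u where [simp]: "u \<in> Arr C" "Cod C u = Dom C k" "Dom C u = Dom C (Ident C (Dom C y))"
      and u: "k \<cdot> u = Ident C (Dom C y)"
      using le by (rule sub_leE) blast
    have "y \<cdot> (k \<cdot> u) = Zero C (Dom C k) (Cod C y) \<cdot> u" by (rule Comp_reassoc[OF kD(4)]) simp_all
    then show ?thesis using u by simp
  qed
  assume y: "y = Zero C (Dom C y) (Cod C y)"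
  have y0: "y \<cdot> Ident C (Dom C y) = Zero C (Dom C y) (Cod C y)" by (simp flip: y)
  show "sub_le C (Ident C (Dom C y)) k"
    by (rule is_kernel_lift[OF k, of "Ident C (Dom C y)"]) (use y0 in \<open>auto simp: sub_le_def Hom_def\<close>)
qed

text \<open>If \<open>l\<close> contains every member of \<open>S\<close>, its cokernel kills them
  all and hence factors through \<open>j\<close>. So it kills the kernel of \<open>j\<close>, which
  therefore lies in \<open>l\<close>.\<close>

lemma joint_cokernel_is_sum:
  assumes j: "joint_kernel (op_cat C) X S j"
  shows "is_sum C X S (Ker C j)"
  unfolding is_sum_def
proof (intro conjI ballI allI impI)
  have [simp]: "j \<in> Arr C" "Dom C j = X" and S: "\<And>s. s \<in> S \<Longrightarrow> s \<in> Arr C \<and> Cod C s = X"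
    "\<And>s. s \<in> S \<Longrightarrow> j \<cdot> s = Zero C (Dom C s) (Cod C j)"
    using j by (auto simp: joint_kernel_op)
  have kk: "is_kernel C j (Ker C j)" by (rule is_kernel_Ker) simp
  note k = is_kernelD[OF kk]
  have [simp]: "Ker C j \<in> Arr C" "Cod C (Ker C j) = X" using k by auto
  show "subobject C X (Ker C j)" using k by (simp add: subobject_def)
  show "sub_le C s (Ker C j)" if "s \<in> S" for s
    by (rule is_kernel_lift[OF kk, of s]) (use S that in \<open>auto simp: sub_le_def Hom_def\<close>)
  fix l assume l: "subobject C X l \<and> (\<forall>s\<in>S. sub_le C s l)"
  then have lm: "monic C l" "Cod C l = X" by (auto simp: subobject_def)
  have [simp]: "l \<in> Arr C" "Cod C l = X" using lm by auto
  define c where "c = Coker C l"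
  have cc: "is_cokernel C l c" unfolding c_def by (rule is_cokernel_Coker) simp
  note c = is_cokernelD[OF cc]
  have [simp]: "c \<in> Arr C" "Dom C c = X" using c by auto
  have "c \<cdot> s = Zero C (Dom C s) (Cod C c)" if "s \<in> S" for s
  proof -
    have "sub_le C s l" using l that by blast
    then obtain u where [simp]: "u \<in> Arr C" "Dom C u = Dom C s" "Cod C u = Dom C l" and u: "l \<cdot> u = s"
      by (rule sub_leE)
    have "c \<cdot> (l \<cdot> u) = Zero C (Dom C l) (Cod C c) \<cdot> u" by (rule Comp_reassoc[OF c(4)]) simp_all
    then show ?thesis by (simp add: u)
  qed
  moreover have "Cod C c \<in> Obj C" "c \<in> Hom C X (Cod C c)" by (simp_all add: Hom_def)
  ultimately obtain h where h: "h \<in> Hom C (Cod C j) (Cod C c)" and hj: "h \<cdot> j = c"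
    using j unfolding joint_kernel_op by blast
  note [simp] = h[unfolded Hom_def, simplified]
  have cj: "c \<cdot> Ker C j = Zero C (Dom C (Ker C j)) (Cod C c)"
    using Comp_reassoc[OF hj, of "Ker C j"] k(4) by simp
  show "sub_le C (Ker C j) l"
    by (rule is_kernel_lift[OF monic_kernel_of_cokernel[OF lm(1) cc], of "Ker C j"])
      (use cj in \<open>auto simp: sub_le_def Hom_def\<close>)
qed

text \<open>An arrow kills all members of \<open>S\<close> exactly when its kernel contains each of
  them, hence their sum \<open>k\<close>; so it kills \<open>S\<close> exactly when it kills
  \<open>k\<close>.\<close>

lemma Coker_sum_joint_cokernel:
  assumes sum: "is_sum C X S k" and S: "\<And>s. s \<in> S \<Longrightarrow> s \<in> Arr C \<and> Cod C s = X"
  shows "joint_kernel (op_cat C) X S (Coker C k)"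
proof -
  have km: "monic C k" "Cod C k = X" using sum by (auto simp: is_sum_def subobject_def)
  have [simp]: "k \<in> Arr C" "Cod C k = X" using km by auto
  define c where "c = Coker C k"
  have cc: "is_cokernel C k c" unfolding c_def by (rule is_cokernel_Coker) simp
  note c = is_cokernelD[OF cc]
  have [simp]: "c \<in> Arr C" "Dom C c = X" using c by auto
  have zero_iff: "(\<forall>s\<in>S. y \<cdot> s = Zero C (Dom C s) (Cod C y)) \<longleftrightarrow> y \<cdot> k = Zero C (Dom C k) (Cod C y)"
    if [simp]: "y \<in> Arr C" "Dom C y = X" for y
  proof (intro iffI ballI)
    have nn: "is_kernel C y (Ker C y)" by (rule is_kernel_Ker) simp
    note n = is_kernelD[OF nn]
    have [simp]: "Ker C y \<in> Arr C" "Cod C (Ker C y) = X" using n by auto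
    assume y: "\<forall>s\<in>S. y \<cdot> s = Zero C (Dom C s) (Cod C y)"
    have "sub_le C s (Ker C y)" if "s \<in> S" for s
      by (rule is_kernel_lift[OF nn, of s]) (use S y that in \<open>auto simp: sub_le_def Hom_def\<close>)
    moreover have "subobject C X (Ker C y)" using n by (simp add: subobject_def)
    ultimately have "sub_le C k (Ker C y)" using sum unfolding is_sum_def by blast
    then obtain u where [simp]: "u \<in> Arr C" "Dom C u = Dom C k" "Cod C u = Dom C (Ker C y)"
      and u: "Ker C y \<cdot> u = k" by (rule sub_leE)
    have "y \<cdot> (Ker C y \<cdot> u) = Zero C (Dom C (Ker C y)) (Cod C y) \<cdot> u"
      by (rule Comp_reassoc[OF n(4)]) simp_all
    then show "y \<cdot> k = Zero C (Dom C k) (Cod C y)" by (simp add: u)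
  next
    fix s assume yk: "y \<cdot> k = Zero C (Dom C k) (Cod C y)" and "s \<in> S"
    then have "sub_le C s k" using sum by (auto simp: is_sum_def)
    then obtain u where [simp]: "u \<in> Arr C" "Dom C u = Dom C s" "Cod C u = Dom C k" and u: "k \<cdot> u = s"
      by (rule sub_leE)
    have "y \<cdot> (k \<cdot> u) = Zero C (Dom C k) (Cod C y) \<cdot> u" by (rule Comp_reassoc[OF yk]) simp_all
    then show "y \<cdot> s = Zero C (Dom C s) (Cod C y)" by (simp add: u)
  qed
  show ?thesis
    unfolding joint_kernel_op c_def[symmetric]
  proof (intro conjI ballI impI)
    show "c \<cdot> s = Zero C (Dom C s) (Cod C c)" if "s \<in> S" for s
      using zero_iff[of c] c(4) that by simp
    fix Z g assume "Z \<in> Obj C" and g: "g \<in> Hom C X Z" and g0: "\<forall>s\<in>S. g \<cdot> s = Zero C (Dom C s) Z"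
    then have "g \<cdot> k = Zero C (Dom C k) Z" using zero_iff[of g] by (simp add: Hom_def)
    with g \<open>Z \<in> Obj C\<close> show "\<exists>!h. h \<in> Hom C (Cod C c) Z \<and> h \<cdot> c = g"
      using cc by (simp add: is_cokernel_def)
  qed (use S in auto)
qed

lemma joint_cokernel_Sum_of:
  assumes j: "joint_kernel (op_cat C) X S j"
  shows "subobject C X (Sum_of C X S)" "joint_kernel (op_cat C) X S (Coker C (Sum_of C X S))"
proof -
  have sum: "is_sum C X S (Sum_of C X S)"
    unfolding Sum_of_def by (rule someI) (rule joint_cokernel_is_sum[OF j])
  show "subobject C X (Sum_of C X S)" using sum by (simp add: is_sum_def)
  show "joint_kernel (op_cat C) X S (Coker C (Sum_of C X S))"
    by (rule Coker_sum_joint_cokernel[OF sum]) (use j in \<open>auto simp: joint_kernel_op\<close>)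
qed

text \<open>Each \<open>f i\<close> is its image preceded by an epimorphism, so an arrow kills
  \<open>f i\<close> exactly when it kills the image.\<close>

lemma joint_cokernel_Img:
  assumes "\<And>i. i \<in> I \<Longrightarrow> f i \<in> Arr C \<and> Cod C (f i) = X"
  shows "joint_kernel (op_cat C) X ((\<lambda>i. Img C (f i)) ` I) j \<longleftrightarrow> joint_kernel (op_cat C) X (f ` I) j"
proof -
  have zero_iff: "y \<cdot> Img C (f i) = Zero C (Dom C (Img C (f i))) (Cod C y) \<longleftrightarrow> y \<cdot> f i = Zero C (Dom C (f i)) (Cod C y)"
    and mem: "Img C (f i) \<in> Arr C \<and> Cod C (Img C (f i)) = X"
    if "i \<in> I" and y: "y \<in> Arr C" "Dom C y = X" for i y
  proof -
    have [simp]: "f i \<in> Arr C" "Cod C (f i) = X" using assms[OF \<open>i \<in> I\<close>] by auto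
    note [simp] = y
    obtain m e where me: "monic C m" "epic C e" and [simp]: "Dom C e = Dom C (f i)" "Cod C e = Dom C m"
      "Cod C m = Cod C (f i)" and fe: "m \<cdot> e = f i" and m: "m = Img C (f i)"
      by (rule image_factorization[of "f i"]) simp_all
    have [simp]: "m \<in> Arr C" "e \<in> Arr C" using me by auto
    have "y \<cdot> m = Zero C (Dom C m) (Cod C y)" if "y \<cdot> (m \<cdot> e) = Zero C (Dom C (f i)) (Cod C y)"
      using epic_Zero[OF me(2), of "y \<cdot> m"] that by simp
    moreover have "y \<cdot> (m \<cdot> e) = Zero C (Dom C (f i)) (Cod C y)" if "y \<cdot> m = Zero C (Dom C m) (Cod C y)"
      by (subst Comp_reassoc[OF that]) simp_all
    ultimately show "y \<cdot> Img C (f i) = Zero C (Dom C (Img C (f i))) (Cod C y) \<longleftrightarrow>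
        y \<cdot> f i = Zero C (Dom C (f i)) (Cod C y)"
      unfolding m[symmetric] fe by blast
    show "Img C (f i) \<in> Arr C \<and> Cod C (Img C (f i)) = X" unfolding m[symmetric] by simp
  qed
  show ?thesis
  proof (cases "j \<in> Arr C \<and> Dom C j = X")
    case True
    then have "\<And>i. i \<in> I \<Longrightarrow> Img C (f i) \<in> Arr C \<and> Cod C (Img C (f i)) = X \<and>
        j \<cdot> Img C (f i) = Zero C (Dom C (Img C (f i))) (Cod C j) \<longleftrightarrow>
        f i \<in> Arr C \<and> Cod C (f i) = X \<and> j \<cdot> f i = Zero C (Dom C (f i)) (Cod C j)"
      using zero_iff mem assms by blast
    moreover have "g \<cdot> Img C (f i) = Zero C (Dom C (Img C (f i))) Z \<longleftrightarrow> g \<cdot> f i = Zero C (Dom C (f i)) Z"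
      if "i \<in> I" "g \<in> Hom C X Z" for g Z i
      using zero_iff[of i g] that by (simp add: Hom_def)
    ultimately show ?thesis using True by (simp add: joint_kernel_op)
  qed (auto simp: joint_kernel_op)
qed

text \<open>The sum is all of \<open>B\<close> exactly when its cokernel \<open>q\<close> vanishes.
  As \<open>q\<close> is the joint cokernel of \<open>a\<close> and \<open>c\<close>, this means
  that only zero arrows kill both.\<close>

lemma Sum_eq_Ident_iff:
  assumes a: "subobject C B a" and c: "subobject C B c"
  shows "sub_eq C (Sum_of C B {a, c}) (Ident C B) \<longleftrightarrow>
    (\<forall>y \<in> Arr C. Dom C y = B \<longrightarrow> y \<cdot> a = Zero C (Dom C a) (Cod C y) \<longrightarrow>
      y \<cdot> c = Zero C (Dom C c) (Cod C y) \<longrightarrow> y = Zero C B (Cod C y))" (is "_ \<longleftrightarrow> ?R")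
proof -
  have [simp]: "a \<in> Arr C" "c \<in> Arr C" "Cod C a = B" "Cod C c = B" using a c by (auto simp: subobject_def)
  have [simp]: "B \<in> Obj C" using Cod_Obj[of a] by simp
  obtain j where "joint_kernel (op_cat C) B {a, c} j"
    using abelian_category.ex_joint_kernel_pair[OF abelian_category_op, of a c B] by auto
  note \<sigma> = joint_cokernel_Sum_of[OF this]
  define k where "k = Sum_of C B {a, c}"
  define q where "q = Coker C k"
  have km: "monic C k" and [simp]: "Cod C k = B" using \<sigma>(1) by (auto simp: subobject_def k_def)
  have qq: "is_cokernel C k q" unfolding q_def by (rule is_cokernel_Coker) (use km in simp)
  note qD = is_cokernelD[OF qq]
  have [simp]: "q \<in> Arr C" "Dom C q = B" using qD by auto
  have j: "joint_kernel (op_cat C) B {a, c} q" using \<sigma> by (simp add: q_def k_def)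
  have "sub_eq C k (Ident C B) \<longleftrightarrow> q = Zero C B (Cod C q)"
    using Ident_sub_le_kernel[OF monic_kernel_of_cokernel[OF km qq]] sub_le_IdentI[OF \<sigma>(1)]
    by (simp add: sub_eq_def k_def)
  also have "\<dots> \<longleftrightarrow> ?R"
  proof (intro iffI ballI impI)
    assume ?R
    then show "q = Zero C B (Cod C q)" using j by (simp add: joint_kernel_op)
  next
    fix y assume q0: "q = Zero C B (Cod C q)" and y [simp]: "y \<in> Arr C" "Dom C y = B"
      and ya: "y \<cdot> a = Zero C (Dom C a) (Cod C y)" "y \<cdot> c = Zero C (Dom C c) (Cod C y)"
    have "Cod C y \<in> Obj C" "y \<in> Hom C B (Cod C y)" by (simp_all add: Hom_def)
    then obtain h where "h \<in> Hom C (Cod C q) (Cod C y)" and h: "h \<cdot> q = y"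
      using j ya unfolding joint_kernel_op by blast
    then have "h \<cdot> q = Zero C B (Cod C y)" by (subst q0) (simp add: Hom_def)
    then show "y = Zero C B (Cod C y)" unfolding h .
  qed
  finally show ?thesis by (simp add: k_def)
qed

text \<open>Kernels and cokernels match subobjects \<open>c\<close> of the domain of
  \<open>U\<close> with its quotients \<open>n\<close>. An arrow kills \<open>m\<close> and
  \<open>c\<close> exactly when it factors through both \<open>U\<close> and \<open>n\<close>; thus
  \<open>m\<close> and \<open>c\<close> add up to everything exactly when \<open>U\<close> and
  \<open>n\<close> meet trivially in the opposite category. Likewise \<open>c\<close> is everything
  exactly when \<open>n\<close> is zero.\<close>

lemma superfluous_iff_ess_op:
  assumes U: "epic C U" and m: "is_kernel C U m"
  shows "superfluous C (Dom C U) m \<longleftrightarrow> ess (op_cat C) U"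
proof
  note mD = is_kernelD[OF m]
  define B where "B = Dom C U"
  have [simp]: "U \<in> Arr C" "Dom C U = B" "m \<in> Arr C" "Cod C m = B" using mD by (auto simp: B_def)
  have mB: "subobject C B m" using mD by (simp add: subobject_def)
  interpret op: abelian_category "op_cat C" by (rule abelian_category_op)
  show "ess (op_cat C) U" if "superfluous C (Dom C U) m"
  proof (rule op.essI)
    show "monic (op_cat C) U" using U by simp
    fix n assume n: "monic (op_cat C) n" and cod: "Cod (op_cat C) n = Cod (op_cat C) U"
      and *: "\<And>g h. g \<in> Arr (op_cat C) \<Longrightarrow> h \<in> Arr (op_cat C) \<Longrightarrow> Dom (op_cat C) h = Dom (op_cat C) g
        \<Longrightarrow> Cod (op_cat C) g = Dom (op_cat C) U \<Longrightarrow> Cod (op_cat C) h = Dom (op_cat C) n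
        \<Longrightarrow> U \<cdot>\<^bsub>op_cat C\<^esub> g = n \<cdot>\<^bsub>op_cat C\<^esub> h \<Longrightarrow> g = Zero (op_cat C) (Dom (op_cat C) g) (Dom (op_cat C) U)"
    have ne: "epic C n" and [simp]: "n \<in> Arr C" "Dom C n = B" using n cod by auto
    define c where "c = Ker C n"
    have cc: "is_kernel C n c" unfolding c_def by (rule is_kernel_Ker) simp
    note cD = is_kernelD[OF cc]
    have [simp]: "c \<in> Arr C" "Cod C c = B" using cD by auto
    have cB: "subobject C B c" using cD by (simp add: subobject_def)
    have "sub_eq C (Sum_of C B {m, c}) (Ident C B)"
      unfolding Sum_eq_Ident_iff[OF mB cB]
    proof (intro ballI impI)
      fix y assume y [simp]: "y \<in> Arr C" "Dom C y = B"
        and y0: "y \<cdot> m = Zero C (Dom C m) (Cod C y)" "y \<cdot> c = Zero C (Dom C c) (Cod C y)"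
      obtain g where g [simp]: "g \<in> Arr C" "Cod C g = Cod C y" "Dom C g = Cod C U" and gU: "g \<cdot> U = y"
        by (rule epic_cokernel_of_kernel[OF U m, of y]) (use y0 in simp_all)
      obtain h where h [simp]: "h \<in> Arr C" "Cod C h = Cod C y" "Dom C h = Cod C n" and hn: "h \<cdot> n = y"
        by (rule epic_cokernel_of_kernel[OF ne cc, of y]) (use y0 in simp_all)
      have "g = Zero C (Cod C U) (Cod C y)" using *[of g h] gU hn by simp
      then have "g \<cdot> U = Zero C (Cod C U) (Cod C y) \<cdot> U" by simp
      also have "\<dots> = Zero C B (Cod C y)" by simp
      finally show "y = Zero C B (Cod C y)" unfolding gU .
    qed
    then have "sub_eq C c (Ident C B)" using that cB by (simp add: superfluous_def)
    then show "n = Zero (op_cat C) (Dom (op_cat C) n) (Cod (op_cat C) n)"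
      using Ident_sub_le_kernel[OF cc] by (simp add: sub_eq_def)
  qed
  assume ess: "ess (op_cat C) U"
  show "superfluous C (Dom C U) m"
    unfolding superfluous_def
  proof (intro conjI allI impI)
    fix c assume "subobject C (Dom C U) c \<and> sub_eq C (Sum_of C (Dom C U) {m, c}) (Ident C (Dom C U))"
    then have cB: "subobject C B c" and sum: "sub_eq C (Sum_of C B {m, c}) (Ident C B)" by auto
    have cm: "monic C c" and [simp]: "c \<in> Arr C" "Cod C c = B" using cB by (auto simp: subobject_def)
    define n where "n = Coker C c"
    have nn: "is_cokernel C c n" unfolding n_def by (rule is_cokernel_Coker) simp
    note nD = is_cokernelD[OF nn]
    have [simp]: "n \<in> Arr C" "Dom C n = B" using nD by auto
    have "n = Zero (op_cat C) (Dom (op_cat C) n) (Cod (op_cat C) n)"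
    proof (rule op.essD[OF ess])
      fix g h
      assume "g \<in> Arr (op_cat C)" "h \<in> Arr (op_cat C)" "Dom (op_cat C) h = Dom (op_cat C) g"
        "Cod (op_cat C) g = Dom (op_cat C) U" "Cod (op_cat C) h = Dom (op_cat C) n"
        "U \<cdot>\<^bsub>op_cat C\<^esub> g = n \<cdot>\<^bsub>op_cat C\<^esub> h"
      then have [simp]: "g \<in> Arr C" "h \<in> Arr C" "Cod C h = Cod C g" "Dom C g = Cod C U" "Dom C h = Cod C n"
        and e: "g \<cdot> U = h \<cdot> n" by auto
      have "(g \<cdot> U) \<cdot> m = Zero C (Dom C m) (Cod C g)" using mD(4) by simp
      moreover have "(g \<cdot> U) \<cdot> c = Zero C (Dom C c) (Cod C g)" unfolding e using nD(4) by simp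
      ultimately have "g \<cdot> U = Zero C B (Cod C g)"
        using sum[unfolded Sum_eq_Ident_iff[OF mB cB], rule_format, of "g \<cdot> U"] by simp
      then show "g = Zero (op_cat C) (Dom (op_cat C) g) (Dom (op_cat C) U)"
        using epic_Zero[OF U, of g] by simp
    qed (use nD in simp_all)
    then show "sub_eq C c (Ident C (Dom C U))"
      using Ident_sub_le_kernel[OF monic_kernel_of_cokernel[OF cm nn]] sub_le_IdentI[OF cB]
      by (simp add: sub_eq_def)
  qed (simp add: mB)
qed

lemma direct_summand_Coker:
  assumes "direct_summand C X d"
  obtains R where "retract C X R (Coker C d)"
proof -
  interpret op: abelian_category "op_cat C" by (rule abelian_category_op)
  obtain r where r: "retract (op_cat C) X r d" using assms by (auto simp: direct_summand_iff)
  have "is_kernel (op_cat C) d (Coker C d)"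
    using assms by (simp add: is_cokernel_Coker direct_summand_def subobject_def)
  with r obtain R where "biproduct (op_cat C) (Dom (op_cat C) r) (Dom (op_cat C) (Coker C d)) X r (Coker C d) d R"
    by (rule op.retract_biproduct)
  then have "retract (op_cat C) X (Coker C d) R" by (rule op.biproduct_retract)
  then show thesis using that by simp
qed

text \<open>Third isomorphism theorem: with \<open>d\<close> contained in \<open>k\<close>, the
  kernel of the quotient map \<open>U\<close> from X/d to X/k is the inclusion \<open>m\<close> of
  k/d.\<close>

lemma quotient_map_kernel:
  assumes D: "retract C X R D" and d: "is_kernel C D d" and k: "subobject C X k" and j: "is_cokernel C k j"
    and U: "U \<in> Hom C (Cod C D) (Cod C j)" "U \<cdot> D = j"
    and u: "u \<in> Hom C (Dom C d) (Dom C k)" "k \<cdot> u = d" and c: "is_cokernel C u c"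
    and m: "m \<in> Hom C (Cod C c) (Cod C D)" "m \<cdot> c = D \<cdot> k"
  shows "is_kernel C U m"
proof -
  note [simp] = D[unfolded retract_def Hom_def, simplified] U(1)[unfolded Hom_def, simplified]
    u(1)[unfolded Hom_def, simplified] m(1)[unfolded Hom_def, simplified]
  note dD = is_kernelD[OF d] and jD = is_cokernelD[OF j] and cD = is_cokernelD[OF c]
  have km: "monic C k" and [simp]: "k \<in> Arr C" "Cod C k = X" using k by (auto simp: subobject_def)
  have [simp]: "d \<in> Arr C" "Cod C d = X" "j \<in> Arr C" "Dom C j = X" "c \<in> Arr C" "Dom C c = Dom C k"
    using dD jD cD by auto
  have kj: "is_kernel C j k" by (rule monic_kernel_of_cokernel[OF km j])
  have mm: "monic C m"
  proof (rule monicI)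
    fix y assume y [simp]: "y \<in> Arr C" "Cod C y = Dom C m" and my: "m \<cdot> y = Zero C (Dom C y) (Cod C m)"
    \<comment> \<open>After an epic cover, \<open>y\<close> comes from an arrow \<open>z\<close>
      into the domain of \<open>k\<close>. As \<open>D\<close> kills \<open>k \<cdot> z\<close>,
      \<open>z\<close> factors through \<open>u\<close>, and \<open>c\<close> kills it.\<close>
    obtain e z where e: "epic C e" and [simp]: "Cod C e = Dom C y" "z \<in> Arr C" "Dom C z = Dom C e"
      "Cod C z = Dom C c" and cz: "c \<cdot> z = y \<cdot> e"
      by (rule epic_pullback[OF cD(1), of y]) simp_all
    have [simp]: "e \<in> Arr C" using e by simp
    have "D \<cdot> (k \<cdot> z) = m \<cdot> (c \<cdot> z)" using Comp_reassoc[OF m(2), of z] by simp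
    also have "\<dots> = Zero C (Dom C e) (Cod C D)" unfolding cz by (subst Comp_reassoc[OF my]) simp_all
    finally obtain t where [simp]: "t \<in> Arr C" "Dom C t = Dom C e" "Cod C t = Dom C d" and t: "d \<cdot> t = k \<cdot> z"
      using is_kernel_lift[OF d, of "k \<cdot> z"] by auto
    have "k \<cdot> (u \<cdot> t) = k \<cdot> z" using Comp_reassoc[OF u(2), of t] t by simp
    then have "u \<cdot> t = z" by (rule monicD[OF km]) simp_all
    then have "c \<cdot> z = c \<cdot> (u \<cdot> t)" by simp
    also have "\<dots> = Zero C (Dom C e) (Cod C c)" by (subst Comp_reassoc[OF cD(4)]) simp_all
    finally have "y \<cdot> e = Zero C (Dom C e) (Cod C c)" unfolding cz .
    then show "y = Zero C (Dom C y) (Dom C m)" using epic_Zero[OF e, of y] by simp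
  qed simp
  have "(U \<cdot> m) \<cdot> c = U \<cdot> (D \<cdot> k)" using m(2) by simp
  also have "\<dots> = Zero C (Dom C k) (Cod C j)" by (subst Comp_reassoc[OF U(2)]) (simp_all add: jD)
  finally have Um: "U \<cdot> m = Zero C (Cod C c) (Cod C j)" using epic_Zero[OF cD(1), of "U \<cdot> m"] by simp
  show ?thesis
    unfolding is_kernel_iff_joint
  proof (intro conjI joint_kernelI mm)
    fix y assume y [simp]: "y \<in> Arr C" "Cod C y = Dom C U"
      and "\<And>f. f \<in> {U} \<Longrightarrow> f \<cdot> y = Zero C (Dom C y) (Cod C f)"
    then have Uy: "U \<cdot> y = Zero C (Dom C y) (Cod C j)" by simp
    \<comment> \<open>The section \<open>R\<close> lifts \<open>y\<close> to X itself; the lift is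
      killed by \<open>j\<close> and so lies in \<open>k\<close>.\<close>
    have DR: "D \<cdot> (R \<cdot> y) = y" using Comp_reassoc[of D R "Ident C (Dom C R)" y] by simp
    have "j \<cdot> (R \<cdot> y) = U \<cdot> (D \<cdot> (R \<cdot> y))" by (subst Comp_reassoc[OF U(2)]) simp_all
    then have "j \<cdot> (R \<cdot> y) = Zero C (Dom C y) (Cod C j)" by (simp only: DR Uy)
    then obtain z where [simp]: "z \<in> Arr C" "Dom C z = Dom C y" "Cod C z = Dom C k" and z: "k \<cdot> z = R \<cdot> y"
      using is_kernel_lift[OF kj, of "R \<cdot> y"] by auto
    have "m \<cdot> (c \<cdot> z) = D \<cdot> (k \<cdot> z)" using Comp_reassoc[OF m(2), of z] by simp
    then have "m \<cdot> (c \<cdot> z) = y" by (simp only: z DR)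
    then show "\<exists>h. h \<in> Hom C (Dom C y) (Dom C m) \<and> m \<cdot> h = y"
      by (intro exI[of _ "c \<cdot> z"]) (simp add: Hom_def)
  qed (use Um in auto)
qed

lemma lies_above_iff:
  assumes d: "direct_summand C X d" and k: "subobject C X k"
  shows "lies_above C k d \<longleftrightarrow>
    (\<exists>U \<in> Hom C (Cod C (Coker C d)) (Cod C (Coker C k)). U \<cdot> Coker C d = Coker C k \<and> ess (op_cat C) U)"
proof -
  have km: "monic C k" and [simp]: "k \<in> Arr C" "Cod C k = X" using k by (auto simp: subobject_def)
  have dm: "monic C d" and [simp]: "d \<in> Arr C" "Cod C d = X" using d by (auto simp: direct_summand_def subobject_def)
  define D j where "D = Coker C d" and "j = Coker C k"
  have dD: "is_cokernel C d D" and kj: "is_cokernel C k j"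
    unfolding D_def j_def by (simp_all add: is_cokernel_Coker)
  note DD = is_cokernelD[OF dD] and jD = is_cokernelD[OF kj]
  have [simp]: "D \<in> Arr C" "Dom C D = X" "j \<in> Arr C" "Dom C j = X" using DD jD by auto
  have Dd: "is_kernel C D d" and jk: "is_kernel C j k"
    using monic_kernel_of_cokernel dm km dD kj by auto
  obtain R where R: "retract C X R D" using d unfolding D_def by (rule direct_summand_Coker)
  have key: "superfluous C (Cod C D) m \<longleftrightarrow> ess (op_cat C) U"
    if U: "U \<in> Hom C (Cod C D) (Cod C j)" "U \<cdot> D = j"
      and u: "u \<in> Hom C (Dom C d) (Dom C k)" "k \<cdot> u = d"
      and m: "m \<in> Hom C (Cod C (Coker C u)) (Cod C D)" "m \<cdot> Coker C u = D \<cdot> k" for u m U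
  proof -
    note [simp] = U(1)[unfolded Hom_def, simplified]
    have "is_cokernel C u (Coker C u)" using u by (intro is_cokernel_Coker) (simp add: Hom_def)
    then have "is_kernel C U m" using quotient_map_kernel[OF R Dd k kj U u] m by blast
    moreover have "epic C U"
    proof (rule epicI)
      fix g assume [simp]: "g \<in> Arr C" "Dom C g = Cod C U" and "g \<cdot> U = Zero C (Dom C U) (Cod C g)"
      then have "(g \<cdot> U) \<cdot> D = Zero C X (Cod C g)" by simp
      then have "g \<cdot> j = Zero C X (Cod C g)" by (simp add: U(2))
      then show "g = Zero C (Cod C U) (Cod C g)" using epic_Zero[OF jD(1), of g] by simp
    qed simp
    ultimately show ?thesis using superfluous_iff_ess_op[of U m] by simp
  qed
  have above: "\<exists>U. U \<in> Hom C (Cod C D) (Cod C j) \<and> U \<cdot> D = j"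
    if u: "u \<in> Hom C (Dom C d) (Dom C k)" "k \<cdot> u = d" for u
  proof -
    note [simp] = u(1)[unfolded Hom_def, simplified]
    have "j \<cdot> (k \<cdot> u) = Zero C (Dom C d) (Cod C j)" by (subst Comp_reassoc[OF jD(4)]) simp_all
    then have "j \<cdot> d = Zero C (Dom C d) (Cod C j)" by (simp only: u(2))
    then obtain U where "U \<in> Arr C" "Cod C U = Cod C j" "Dom C U = Cod C D" "U \<cdot> D = j"
      using is_cokernel_desc[OF dD, of j] by auto
    then show ?thesis by (auto simp: Hom_def)
  qed
  have below: "\<exists>u m. u \<in> Hom C (Dom C d) (Dom C k) \<and> k \<cdot> u = d \<and>
      m \<in> Hom C (Cod C (Coker C u)) (Cod C D) \<and> m \<cdot> Coker C u = D \<cdot> k"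
    if U: "U \<in> Hom C (Cod C D) (Cod C j)" "U \<cdot> D = j" for U
  proof -
    note [simp] = U(1)[unfolded Hom_def, simplified]
    have "U \<cdot> (D \<cdot> d) = j \<cdot> d" by (rule Comp_reassoc[OF U(2)]) simp_all
    then have "j \<cdot> d = Zero C (Dom C d) (Cod C j)" by (simp add: DD)
    then obtain u where [simp]: "u \<in> Arr C" "Dom C u = Dom C d" "Cod C u = Dom C k" and u: "k \<cdot> u = d"
      using is_kernel_lift[OF jk, of d] by auto
    have cc: "is_cokernel C u (Coker C u)" by (rule is_cokernel_Coker) simp
    obtain m where "m \<in> Arr C" "Cod C m = Cod C D" "Dom C m = Cod C (Coker C u)" "m \<cdot> Coker C u = D \<cdot> k"
      using is_cokernel_desc[OF cc, of "D \<cdot> k"] by (auto simp: u DD)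
    then have "m \<in> Hom C (Cod C (Coker C u)) (Cod C D)" "m \<cdot> Coker C u = D \<cdot> k" by (simp_all add: Hom_def)
    moreover have "u \<in> Hom C (Dom C d) (Dom C k)" by (simp add: Hom_def)
    ultimately show ?thesis using u by blast
  qed
  show ?thesis
    unfolding lies_above_def D_def[symmetric] j_def[symmetric] using key above below by blast
qed

text \<open>\<open>h\<close> preserves the kernel of \<open>D\<close> exactly when
  \<open>D \<cdot> h\<close> kills \<open>d\<close>, that is, factors through \<open>D\<close>.
  Composing with the section \<open>R\<close> shows that the factor must be
  \<open>D \<cdot> h \<cdot> R\<close>.\<close>

lemma fully_invariant_iff_op:
  assumes R: "retract C X R D" and d: "is_kernel C D d"
  shows "fully_invariant C X d \<longleftrightarrow> invariant_retract (op_cat C) X D R"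
proof -
  note [simp] = R[unfolded retract_def Hom_def, simplified]
  note dD = is_kernelD[OF d]
  have [simp]: "d \<in> Arr C" "Cod C d = X" using dD by auto
  have "retract (op_cat C) X D R" using R by simp
  then have De: "epic C D" using category.retract_monic[of "op_cat C" X D R] abelian_category_op
    by (simp add: abelian_category_def preadditive_category_def)
  have "(\<exists>a\<in>Hom C (Dom C d) (Dom C d). h \<cdot> d = d \<cdot> a) \<longleftrightarrow> (D \<cdot> h \<cdot> R) \<cdot> D = D \<cdot> h"
    if h: "h \<in> Hom C X X" for h
  proof -
    note [simp] = h[unfolded Hom_def, simplified]
    have "(\<exists>a\<in>Hom C (Dom C d) (Dom C d). h \<cdot> d = d \<cdot> a) \<longleftrightarrow> D \<cdot> (h \<cdot> d) = Zero C (Dom C d) (Cod C D)"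
    proof
      assume "\<exists>a\<in>Hom C (Dom C d) (Dom C d). h \<cdot> d = d \<cdot> a"
      then obtain a where a: "a \<in> Hom C (Dom C d) (Dom C d)" "h \<cdot> d = d \<cdot> a" by blast
      note [simp] = a(1)[unfolded Hom_def, simplified]
      show "D \<cdot> (h \<cdot> d) = Zero C (Dom C d) (Cod C D)"
        unfolding a(2) by (subst Comp_reassoc[OF dD(4)]) simp_all
    next
      assume "D \<cdot> (h \<cdot> d) = Zero C (Dom C d) (Cod C D)"
      then obtain a where "a \<in> Arr C" "Dom C a = Dom C d" "Cod C a = Dom C d" "d \<cdot> a = h \<cdot> d"
        using is_kernel_lift[OF d, of "h \<cdot> d"] by auto
      then show "\<exists>a\<in>Hom C (Dom C d) (Dom C d). h \<cdot> d = d \<cdot> a"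
        by (intro bexI[of _ a]) (auto simp: Hom_def)
    qed
    also have "\<dots> \<longleftrightarrow> (D \<cdot> h \<cdot> R) \<cdot> D = D \<cdot> h"
    proof
      assume "D \<cdot> (h \<cdot> d) = Zero C (Dom C d) (Cod C D)"
      then obtain x where [simp]: "x \<in> Arr C" "Dom C x = Cod C D" "Cod C x = Cod C D" and x: "x \<cdot> D = D \<cdot> h"
        using epic_cokernel_of_kernel[OF De d, of "D \<cdot> h"] by auto
      have "(x \<cdot> D) \<cdot> (R \<cdot> D) = x \<cdot> D"
        using Comp_reassoc[of D R "Ident C (Dom C R)" D] by simp
      then show "(D \<cdot> h \<cdot> R) \<cdot> D = D \<cdot> h" unfolding x by simp
    next
      assume e: "(D \<cdot> h \<cdot> R) \<cdot> D = D \<cdot> h"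
      have "(D \<cdot> h) \<cdot> d = ((D \<cdot> h \<cdot> R) \<cdot> D) \<cdot> d" unfolding e ..
      also have "\<dots> = Zero C (Dom C d) (Cod C D)" by (simp add: dD(4))
      finally show "D \<cdot> (h \<cdot> d) = Zero C (Dom C d) (Cod C D)" by simp
    qed
    finally show ?thesis .
  qed
  moreover have "subobject C X d" using dD by (simp add: subobject_def)
  ultimately show ?thesis by (auto simp: fully_invariant_def invariant_retract_def)
qed

lemma ess_in_retract_op_iff:
  assumes k: "subobject C X k"
  shows "(\<exists>d. direct_summand C X d \<and> (s \<longrightarrow> fully_invariant C X d) \<and> lies_above C k d) \<longleftrightarrow>
    ess_in_retract s (op_cat C) X (Coker C k)"
proof
  interpret op: abelian_category "op_cat C" by (rule abelian_category_op)
  define j where "j = Coker C k"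
  have [simp]: "k \<in> Arr C" "Cod C k = X" using k by (auto simp: subobject_def)
  have kj: "is_cokernel C k j" unfolding j_def by (simp add: is_cokernel_Coker)
  note jD = is_cokernelD[OF kj]
  have [simp]: "j \<in> Arr C" "Dom C j = X" using jD by auto
  have ker: "is_kernel C (Coker C d) d" if "direct_summand C X d" for d
    using that by (simp add: monic_kernel_of_cokernel is_cokernel_Coker direct_summand_def subobject_def)
  show "ess_in_retract s (op_cat C) X (Coker C k)"
    if ex: "\<exists>d. direct_summand C X d \<and> (s \<longrightarrow> fully_invariant C X d) \<and> lies_above C k d"
  proof -
    obtain d where d: "direct_summand C X d" "s \<longrightarrow> fully_invariant C X d" "lies_above C k d"
      using ex by blast
    obtain R where R: "retract C X R (Coker C d)" using d(1) by (rule direct_summand_Coker)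
    obtain U where U: "U \<in> Hom C (Cod C (Coker C d)) (Cod C (Coker C k))" "U \<cdot> Coker C d = Coker C k"
        "ess (op_cat C) U"
      using d lies_above_iff[OF d(1) k] by blast
    have "retract (op_cat C) X (Coker C d) R" using R by simp
    moreover have "s \<longrightarrow> invariant_retract (op_cat C) X (Coker C d) R"
      using fully_invariant_iff_op[OF R ker[OF d(1)]] d(2) by simp
    ultimately show ?thesis
      unfolding ess_in_retract_def using U by (intro exI[of _ "Coker C d"] exI[of _ R] exI[of _ U]) simp
  qed
  assume "ess_in_retract s (op_cat C) X (Coker C k)"
  then obtain D R U where D: "retract (op_cat C) X D R" and inv: "s \<longrightarrow> invariant_retract (op_cat C) X D R"
    and U: "U \<in> Hom C (Cod C D) (Cod C j)" "U \<cdot> D = j" "ess (op_cat C) U"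
    unfolding ess_in_retract_def j_def[symmetric] by auto
  have R: "retract C X R D" using D by simp
  note [simp] = R[unfolded retract_def Hom_def, simplified] U(1)[unfolded Hom_def, simplified]
  define d where "d = Ker C D"
  have dk: "is_kernel C D d" unfolding d_def by (rule is_kernel_Ker) simp
  note dD = is_kernelD[OF dk]
  have [simp]: "d \<in> Arr C" "Cod C d = X" using dD by auto
  obtain \<delta> where "biproduct C (Dom C R) (Dom C d) X R d D \<delta>" using retract_biproduct[OF R dk] by blast
  then have ds: "direct_summand C X d" using biproduct_retract(2) direct_summand_iff by blast
  have fi: "s \<longrightarrow> fully_invariant C X d" using fully_invariant_iff_op[OF R dk] inv by simp
  \<comment> \<open>\<open>lies_above\<close> speaks of the chosen cokernel of \<open>d\<close>,
    which need not be the arrow \<open>D\<close> given by the hypothesis. Both are cokernels of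
    \<open>d\<close>, so essentiality can be carried from \<open>U\<close> to
    \<open>U'\<close>.\<close>
  obtain R' where R': "retract C X R' (Coker C d)" using ds by (rule direct_summand_Coker)
  have cc: "is_cokernel C d (Coker C d)" by (simp add: is_cokernel_Coker)
  have "U \<cdot> (D \<cdot> d) = j \<cdot> d" by (rule Comp_reassoc[OF U(2)]) simp_all
  then have "j \<cdot> d = Zero C (Dom C d) (Cod C j)" by (simp add: dD(4))
  then obtain U' where U': "U' \<in> Arr C" "Cod C U' = Cod C j" "Dom C U' = Cod C (Coker C d)" "U' \<cdot> Coker C d = j"
    using is_cokernel_desc[OF cc, of j] by auto
  have "ess (op_cat C) U'"
  proof (rule op.ess_retract_unique)
    show "retract (op_cat C) X D R" by (rule D)
    show "retract (op_cat C) X (Coker C d) R'" using R' by simp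
    note DD = epic_cokernel_of_kernel[OF op.retract_monic[OF D, simplified] dk, of "Coker C d"]
    obtain v where "v \<in> Arr C" "Cod C v = Cod C (Coker C d)" "Dom C v = Cod C D" "v \<cdot> D = Coker C d"
      by (rule DD) (use is_cokernelD[OF cc] in auto)
    then show "sub_le (op_cat C) (Coker C d) D" by (auto simp: sub_le_def Hom_def)
    show "U \<in> Hom (op_cat C) (Dom (op_cat C) j) (Dom (op_cat C) D)"
      using U(1) by (simp only: Hom_op op_cat_simps)
    show "U' \<in> Hom (op_cat C) (Dom (op_cat C) j) (Dom (op_cat C) (Coker C d))"
      using U'(1-3) by (simp add: Hom_def)
  qed (simp_all add: U U')
  then have "lies_above C k d"
    using lies_above_iff[OF ds k] U' by (auto simp: Hom_def j_def)
  then show "\<exists>d. direct_summand C X d \<and> (s \<longrightarrow> fully_invariant C X d) \<and> lies_above C k d"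
    using ds fi by blast
qed

section \<open>Part (2) from the opposite category\<close>

lemma LSSSP_imp_retraction_ESSIP_op:
  assumes "if s then strictly_LSSSP TYPE('i) C X else LSSSP TYPE('i) C X"
  shows "retraction_ESSIP TYPE('i) s (op_cat C) X"
  unfolding retraction_ESSIP_def
proof (intro allI impI)
  interpret op: abelian_category "op_cat C" by (rule abelian_category_op)
  fix g :: "'i \<Rightarrow> 'b" and F j
  assume *: "F \<subseteq> range g \<and> (\<forall>c\<in>F. \<exists>t. retract (op_cat C) X t c) \<and> joint_kernel (op_cat C) X F j"
  then have j: "joint_kernel (op_cat C) X F j" and F: "F \<subseteq> range g" by auto
  define I where "I = {i. g i \<in> F}"
  have gI: "g ` I = F" using F by (auto simp: I_def)
  \<comment> \<open>A retraction in the opposite category is a split monomorphism here, so the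
    members of \<open>F\<close> are themselves the summands, with no passage to kernels.\<close>
  have "direct_summand C X (g i)" if "i \<in> I" for i
  proof -
    have "g i \<in> F" using that by (simp add: I_def)
    with * show ?thesis by (auto simp: direct_summand_iff)
  qed
  then have "\<exists>d. direct_summand C X d \<and> (s \<longrightarrow> fully_invariant C X d) \<and> lies_above C (Sum_of C X (g ` I)) d"
    using assms by (auto simp: strictly_LSSSP_def LSSSP_def split: if_splits)
  then have e: "ess_in_retract s (op_cat C) X (Coker C (Sum_of C X F))"
    unfolding gI by (subst (asm) ess_in_retract_op_iff[OF joint_cokernel_Sum_of(1)[OF j]])
  note \<sigma> = joint_cokernel_Sum_of(2)[OF j]
  show "ess_in_retract s (op_cat C) X j"
    by (rule op.ess_in_retract_sub_eq[OF e op.joint_kernel_monic[OF j]])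
      (simp add: sub_eq_def op.joint_kernel_unique[OF j \<sigma>] op.joint_kernel_unique[OF \<sigma> j])
qed

lemma biproduct_swap:
  assumes b: "biproduct C M N P i\<^sub>1 i\<^sub>2 p\<^sub>1 p\<^sub>2"
  shows "biproduct C N M P i\<^sub>2 i\<^sub>1 p\<^sub>2 p\<^sub>1"
proof -
  note [simp] = b[unfolded biproduct_def Hom_def, simplified]
  interpret G: comm_group "hom_group C P P" by (rule Hom_comm_group) simp_all
  have "Add C (i\<^sub>2 \<cdot> p\<^sub>2) (i\<^sub>1 \<cdot> p\<^sub>1) = Add C (i\<^sub>1 \<cdot> p\<^sub>1) (i\<^sub>2 \<cdot> p\<^sub>2)"
    using G.m_comm[of "i\<^sub>2 \<cdot> p\<^sub>2" "i\<^sub>1 \<cdot> p\<^sub>1"] by (simp add: Hom_def)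
  then show ?thesis by (simp add: biproduct_def Hom_def)
qed

lemma LSSSP_biproduct_dual_CS_Baer:
  fixes s :: bool
  assumes "AB3 TYPE('i::infinite) C" "biproduct C M N P i\<^sub>1 i\<^sub>2 p\<^sub>1 p\<^sub>2"
    and "if s then strictly_LSSSP TYPE('i) C P else LSSSP TYPE('i) C P"
  shows "if s then dual_strongly_CS_Baer TYPE('i) C M N else dual_CS_Baer TYPE('i) C M N"
proof -
  have "\<exists>d. direct_summand C N d \<and> (s \<longrightarrow> fully_invariant C N d) \<and>
      lies_above C (Sum_of C N ((\<lambda>i. Img C (f i)) ` I)) d"
    if f: "\<forall>i\<in>I. f i \<in> Hom C M N" for I and f :: "'i \<Rightarrow> 'b"
  proof -
    interpret op: abelian_category "op_cat C" by (rule abelian_category_op)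
    \<comment> \<open>Reversed, the arrows run from N to M, so N has to be the first summand and the
      injections become projections.\<close>
    have b: "biproduct (op_cat C) N M P p\<^sub>2 p\<^sub>1 i\<^sub>2 i\<^sub>1" using biproduct_swap[OF assms(2)] by simp
    obtain k where k: "joint_kernel (op_cat C) N (f ` I) k"
      and e: "\<And>k. joint_kernel (op_cat C) N (f ` I) k \<Longrightarrow> ess_in_retract s (op_cat C) N k"
      using op.family_ess_in_retract[OF _ LSSSP_imp_retraction_ESSIP_op[OF assms(3)] b, of I f] assms(1) f
      by auto
    \<comment> \<open>The definition adds up images, whereas the dual of the core result speaks of
      the arrows themselves; both have the same joint cokernels.\<close>
    have img: "joint_kernel (op_cat C) N ((\<lambda>i. Img C (f i)) ` I) j \<longleftrightarrow> joint_kernel (op_cat C) N (f ` I) j" for j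
      by (rule joint_cokernel_Img) (use f in \<open>auto simp: Hom_def\<close>)
    note \<sigma> = joint_cokernel_Sum_of[OF k[folded img]]
    show ?thesis
      unfolding ess_in_retract_op_iff[OF \<sigma>(1)] by (rule e) (use \<sigma>(2) in \<open>simp only: img\<close>)
  qed
  then show ?thesis by (auto simp: dual_strongly_CS_Baer_def dual_CS_Baer_def)
qed

end

theorem lemma6p7:
  fixes A :: "('o, 'm, 'x) ab_cat_scheme"
    and M N MN :: 'o
  assumes "abelian_category A"
    and "M \<in> Obj A" and "N \<in> Obj A"
    and "biproduct A M N MN i\<^sub>1 i\<^sub>2 p\<^sub>1 p\<^sub>2"
  shows
    "(AB3_star TYPE('i::infinite) A \<longrightarrow>
        (ESSIP TYPE('i) A MN \<longrightarrow> CS_Baer TYPE('i) A M N) \<and>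
        (strictly_ESSIP TYPE('i) A MN \<longrightarrow> strongly_CS_Baer TYPE('i) A M N)) \<and>
     (AB3 TYPE('i) A \<longrightarrow>
        (LSSSP TYPE('i) A MN \<longrightarrow> dual_CS_Baer TYPE('i) A M N) \<and>
        (strictly_LSSSP TYPE('i) A MN \<longrightarrow> dual_strongly_CS_Baer TYPE('i) A M N))"
  using abelian_category.ESSIP_biproduct_CS_Baer[OF assms(1) _ assms(4), where s = False and 'i = 'i]
    abelian_category.ESSIP_biproduct_CS_Baer[OF assms(1) _ assms(4), where s = True and 'i = 'i]
    abelian_category.LSSSP_biproduct_dual_CS_Baer[OF assms(1) _ assms(4), where s = False and 'i = 'i]
    abelian_category.LSSSP_biproduct_dual_CS_Baer[OF assms(1) _ assms(4), where s = True and 'i = 'i]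
  by simp

end
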